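(* Let $n\ge2$, $d=n(n-1)/2$, $G\ge1$, $m_1,\ldots,m_G\ge1$ with $\sum_g m_g=n$, $\nu_1,\ldots,\nu_G>2$. Let $V_g\sim t^{\mathrm{std}}_{\nu_g}(0,I_{m_g})$ be mutually independent, $V=(V_1',\ldots,V_G')'$, $P=(P_1,\ldots,P_G)$ an $n\times n$ orthonormal matrix with $P_g\in\mathbb R^{n\times m_g}$, $C$ a nonsingular correlation matrix parametrized by $\gamma=\mathrm{vecl}(\log C)$, $C^{1/2}$ its symmetric positive definite square root, and $Z=C^{1/2}PV$ (i.e. $Z\sim\mathrm{CT}^{\mathrm{std}}_{\boldsymbol m,\boldsymbol\nu}(0,C^{1/2}P)$). Let $U=C^{-1/2}Z$ (so $V_g=P_g'U$), let $\ell(Z)$ be the log-density of $Z$ viewed as a function of $\gamma$, $\nabla=\partial\ell/\partial\gamma$ and $\mathcal I=\mathbb E[\nabla\nabla']$. Then $$\nabla=M'\Omega\Big[\sum_{g=1}^GW_g\,\mathrm{vec}(P_gV_gU')-\mathrm{vec}(I_n)\Big],\qquad \mathcal I=M'\Omega(K_n+\Upsilon_G)\Omega M,$$ where $M=\partial\mathrm{vec}(C)/\partial\gamma'$ (as specified in the context), $\Omega=(I_n\otimes C^{-1/2})(C^{1/2}\oplus I_n)^{-1}$, $\Upsilon_G=\sum_{g=1}^G\Psi_g$ with $$\Psi_g=\psi_g(I_n\otimes J_g)+(\phi_g-\psi_g)J_{g\otimes}+(\phi_g-1)\big[J_{g\otimes}K_n+\mathrm{vec}(J_g)\mathrm{vec}(J_g)'\big],$$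 $J_g=P_gP_g'$, $J_{g\otimes}=J_g\otimes J_g$, and $$W_g=\frac{\nu_g+m_g}{\nu_g-2+V_g'V_g},\quad \phi_g=\frac{\nu_g+m_g}{\nu_g+m_g+2},\quad \psi_g=\phi_g\frac{\nu_g}{\nu_g-2}.$$
   Context: For $\nu>2$ and positive definite $\Sigma$ ($m\times m$), $t^{\mathrm{std}}_\nu(0,\Sigma)$ has density $\frac{\Gamma((\nu+m)/2)}{\Gamma(\nu/2)}[(\nu-2)\pi]^{-m/2}|\Sigma|^{-1/2}[1+\tfrac1{\nu-2}y'\Sigma^{-1}y]^{-(\nu+m)/2}$. $\log C$ is the matrix logarithm; $\mathrm{vecl}(B)$ stacks the strictly-below-diagonal elements of $B$ column by column. $A\oplus B=A\otimes B+B\otimes A$; $K_n$ is the $n^2\times n^2$ commutation matrix ($K_n\mathrm{vec}(B)=\mathrm{vec}(B')$). $M=(E_l+E_u)'E_l(I_{n^2}-\Gamma E_d'(E_d\Gamma E_d')^{-1}E_d)\Gamma(E_l+E_u)'$, where $E_l,E_u,E_d$ are the matrices with $E_l\mathrm{vec}(B)=\mathrm{vecl}(B)$, $E_u\mathrm{vec}(B)=\mathrm{vecl}(B')$, $E_d\mathrm{vec}(B)=\mathrm{diag}(B)$, and $\Gamma=\partial\mathrm{vec}(C)/\partial\mathrm{vec}(\log C)'=(Q\otimes Q)\Xi(Q\otimes Q)'$ with $\log C=Q\,\mathrm{diag}(\lambda_1,\ldots,\lambda_n)Q'$, $Q$ orthonormal, $\Xi$ diagonal with $(i-1)n+j$-th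 entry $e^{\lambda_i}$ if $\lambda_i=\lambda_j$ and $(e^{\lambda_i}-e^{\lambda_j})/(\lambda_i-\lambda_j)$ otherwise. *)

theory Defs
  imports "HOL-Analysis.Analysis"
begin

text \<open>Conventions. An n x n matrix is a value of type real^'n^'n (A $ i $ j = row i, column j).
  vec stacks columns; the entry B(i,j) sits at index (j,i) :: 'n \<times> 'n, so that the
  lexicographic order of the index pairs is the usual position (j-1)n+i.  With this
  convention the Kronecker product below is the textbook one.\<close>

definition vecm :: "real^'n::finite^'n \<Rightarrow> real^('n \<times> 'n)" where
  "vecm B = (\<chi> p. B $ snd p $ fst p)"

definition kron :: "real^'a::finite^'b::finite \<Rightarrow> real^'c::finite^'d::finite \<Rightarrow> real^('a \<times> 'c)^('b \<times> 'd)" where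
  "kron A B = (\<chi> p q. A $ fst p $ fst q * B $ snd p $ snd q)"

definition ksum :: "real^'a::finite^'a \<Rightarrow> real^'a^'a \<Rightarrow> real^('a \<times> 'a)^('a \<times> 'a)" where
  "ksum A B = kron A B + kron B A"

text \<open>Commutation matrix: commat *v vecm B = vecm (transpose B).\<close>
definition commat :: "real^('n::finite \<times> 'n)^('n \<times> 'n)" where
  "commat = (\<chi> p q. if q = (snd p, fst p) then 1 else 0)"

definition outerv :: "real^'a::finite \<Rightarrow> real^'b::finite \<Rightarrow> real^'b^'a" where
  "outerv x y = (\<chi> a b. x $ a * y $ b)"

definition diagm :: "real^'n::finite \<Rightarrow> real^'n^'n" where
  "diagm v = (\<chi> i j. if i = j then v $ i else 0)"

definition pos_def_mat :: "real^'n::finite^'n \<Rightarrow> bool" where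
  "pos_def_mat A \<longleftrightarrow> transpose A = A \<and> (\<forall>x. x \<noteq> 0 \<longrightarrow> x \<bullet> (A *v x) > 0)"

definition is_corr :: "real^'n::finite^'n \<Rightarrow> bool" where
  "is_corr C \<longleftrightarrow> pos_def_mat C \<and> (\<forall>i. C $ i $ i = 1)"

text \<open>Matrix logarithm of a symmetric positive definite matrix: the symmetric L with exp L = C,
  the exponential of a symmetric matrix being taken through its spectral decomposition.\<close>
definition matlog :: "real^'n::finite^'n \<Rightarrow> real^'n^'n" where
  "matlog C = (THE L. \<exists>Q lam. orthogonal_matrix Q \<and> L = Q ** diagm lam ** transpose Q
                 \<and> C = Q ** diagm (\<chi> i. exp (lam $ i)) ** transpose Q)"

definition msqrt :: "real^'n::finite^'n \<Rightarrow> real^'n^'n" where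
  "msqrt C = (THE S. pos_def_mat S \<and> S ** S = C)"

text \<open>Index set of vecl (strictly below the diagonal): vec-index (j,i) with row i > column j.
  Vectors in R^d are represented as vectors in R^(n^2) of which only the coordinates in
  lowidx are meaningful; d x n^2 selection matrices are padded with zero rows.\<close>
definition lowidx :: "('n::{finite,linorder} \<times> 'n) set" where
  "lowidx = {p. fst p < snd p}"

definition El :: "real^('n::{finite,linorder} \<times> 'n)^('n \<times> 'n)" where
  "El = (\<chi> p q. if p \<in> lowidx \<and> q = p then 1 else 0)"

definition Eu :: "real^('n::{finite,linorder} \<times> 'n)^('n \<times> 'n)" where
  "Eu = (\<chi> p q. if p \<in> lowidx \<and> q = (snd p, fst p) then 1 else 0)"

definition Ed :: "real^('n::finite \<times> 'n)^'n" where
  "Ed = (\<chi> k q. if q = (k, k) then 1 else 0)"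

definition corr_of :: "(real, 'n::{finite,linorder} \<times> 'n) vec \<Rightarrow> ((real, 'n) vec, 'n) vec" where
  "corr_of gam = (THE C. is_corr C \<and> (\<forall>p\<in>lowidx. vecm (matlog C) $ p = gam $ p))"

definition Xi_vec :: "real^'n::finite \<Rightarrow> real^('n \<times> 'n)" where
  "Xi_vec lam = (\<chi> p. if lam $ fst p = lam $ snd p then exp (lam $ fst p)
       else (exp (lam $ fst p) - exp (lam $ snd p)) / (lam $ fst p - lam $ snd p))"

definition GammaM :: "real^'n::finite^'n \<Rightarrow> real^('n \<times> 'n)^('n \<times> 'n)" where
  "GammaM C = (let (Q, lam) = (SOME (Q, lam). orthogonal_matrix Q \<and> matlog C = Q ** diagm lam ** transpose Q)
     in kron Q Q ** diagm (Xi_vec lam) ** transpose (kron Q Q))"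

definition Mmat :: "((real, 'n::{finite,linorder}) vec, 'n) vec \<Rightarrow> real^('n \<times> 'n)^('n \<times> 'n)" where
  "Mmat C = (let Gm = GammaM C in
     transpose (El + Eu) ** El ** (mat 1 - Gm ** transpose Ed ** matrix_inv (Ed ** Gm ** transpose Ed) ** Ed)
       ** Gm ** transpose (El + Eu))"

definition OmegaM :: "real^'n::finite^'n \<Rightarrow> real^('n \<times> 'n)^('n \<times> 'n)" where
  "OmegaM C = kron (mat 1) (matrix_inv (msqrt C)) ** matrix_inv (ksum (msqrt C) (mat 1))"

text \<open>Density of t^std_nu(0, I_m) at a point y with y'y = q.\<close>
definition tstd_dens :: "real \<Rightarrow> nat \<Rightarrow> real \<Rightarrow> real" where
  "tstd_dens nu m q = Gamma ((nu + real m) / 2) / Gamma (nu / 2) * ((nu - 2) * pi) powr (- real m / 2)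
      * (1 + q / (nu - 2)) powr (- (nu + real m) / 2)"

text \<open>Groups: grp j is the group of column j of P (and of coordinate j of V).\<close>
definition gsize :: "('n::finite \<Rightarrow> nat) \<Rightarrow> nat \<Rightarrow> nat" where
  "gsize grp g = card {j. grp j = g}"

text \<open>Density of Z = C^(1/2) P V, V = (V_1',...,V_G')', V_g ~ t^std_(nu_g)(0, I_(m_g)) independent.\<close>
definition ct_density :: "(nat \<Rightarrow> real) \<Rightarrow> ('n::finite \<Rightarrow> nat) \<Rightarrow> nat \<Rightarrow> real^'n^'n \<Rightarrow> real^'n^'n \<Rightarrow> real^'n \<Rightarrow> real" where
  "ct_density nu grp G C P z = (let v = matrix_inv (msqrt C ** P) *v z in
     (\<Prod>g\<in>{1..G}. tstd_dens (nu g) (gsize grp g) (\<Sum>j | grp j = g. (v $ j)\<^sup>2)) / \<bar>det (msqrt C ** P)\<bar>)"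

definition Wg :: "(nat \<Rightarrow> real) \<Rightarrow> ('n::finite \<Rightarrow> nat) \<Rightarrow> real^'n \<Rightarrow> nat \<Rightarrow> real" where
  "Wg nu grp v g = (nu g + real (gsize grp g)) / (nu g - 2 + (\<Sum>j | grp j = g. (v $ j)\<^sup>2))"

definition phig :: "(nat \<Rightarrow> real) \<Rightarrow> ('n::finite \<Rightarrow> nat) \<Rightarrow> nat \<Rightarrow> real" where
  "phig nu grp g = (nu g + real (gsize grp g)) / (nu g + real (gsize grp g) + 2)"

definition psig :: "(nat \<Rightarrow> real) \<Rightarrow> ('n::finite \<Rightarrow> nat) \<Rightarrow> nat \<Rightarrow> real" where
  "psig nu grp g = phig nu grp g * nu g / (nu g - 2)"

definition Jg :: "real^'n::finite^'n \<Rightarrow> ('n \<Rightarrow> nat) \<Rightarrow> nat \<Rightarrow> real^'n^'n" where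
  "Jg P grp g = (\<chi> a b. \<Sum>j | grp j = g. P $ a $ j * P $ b $ j)"

definition Psig :: "(nat \<Rightarrow> real) \<Rightarrow> ('n::finite \<Rightarrow> nat) \<Rightarrow> real^'n^'n \<Rightarrow> nat \<Rightarrow> real^('n \<times> 'n)^('n \<times> 'n)" where
  "Psig nu grp P g = (let J = Jg P grp g; ph = phig nu grp g; ps = psig nu grp g in
     ps *\<^sub>R kron (mat 1) J + (ph - ps) *\<^sub>R kron J J
     + (ph - 1) *\<^sub>R (kron J J ** commat + outerv (vecm J) (vecm J)))"

definition UpsilonG :: "(nat \<Rightarrow> real) \<Rightarrow> ('n::finite \<Rightarrow> nat) \<Rightarrow> nat \<Rightarrow> real^'n^'n \<Rightarrow> real^('n \<times> 'n)^('n \<times> 'n)" where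
  "UpsilonG nu grp G P = (\<Sum>g\<in>{1..G}. Psig nu grp P g)"

definition score :: "(nat \<Rightarrow> real) \<Rightarrow> ('n::{finite,linorder} \<Rightarrow> nat) \<Rightarrow> nat \<Rightarrow> ((real, 'n) vec, 'n) vec \<Rightarrow> ((real, 'n) vec, 'n) vec \<Rightarrow> (real, 'n) vec \<Rightarrow> real^('n \<times> 'n)" where
  "score nu grp G C P z = (let u = matrix_inv (msqrt C) *v z; v = transpose P *v u in
     transpose (Mmat C) *v (OmegaM C *v
       ((\<Sum>g\<in>{1..G}. Wg nu grp v g *\<^sub>R vecm (outerv (\<chi> i. \<Sum>j | grp j = g. P $ i $ j * v $ j) u))
        - vecm (mat 1))))"

definition infomat :: "(nat \<Rightarrow> real) \<Rightarrow> ('n::{finite,linorder} \<Rightarrow> nat) \<Rightarrow> nat \<Rightarrow> ((real, 'n) vec, 'n) vec \<Rightarrow> ((real, 'n) vec, 'n) vec \<Rightarrow> real^('n \<times> 'n)^('n \<times> 'n)" where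
  "infomat nu grp G C P = transpose (Mmat C) ** OmegaM C ** (commat + UpsilonG nu grp G P) ** OmegaM C ** Mmat C"

end

theory Submission
  imports Defs "HOL-Probability.Distributions"
begin

text \<open>
  For symmetric \<open>X = Q diag(a) Q'\<close> and \<open>Y = R diag(b) R'\<close> the entries of \<open>Q' (f(Y) - f(X)) R\<close> are
  \<open>(Q' R)\<^sub>i\<^sub>j (f(b\<^sub>j) - f(a\<^sub>i))\<close>. This one identity makes spectral functions well defined and Lipschitz, makes the
  matrix exponential strictly monotone, and, with divided differences in place of \<open>f\<close>, differentiates it.
  Strict monotonicity shows that a correlation matrix is determined by the off-diagonal part of its logarithm;
  the inverse function theorem for injective maps then gives a differentiable path of correlation matrices in
  each coordinate direction of \<open>\<gamma>\<close>, along which the log-density is differentiated.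

  For the information matrix, the substitution \<open>z = C\<^bsup>1/2\<^esup> P v\<close> reduces everything to moments of \<open>V\<close>. Each power of
  \<open>1 + V\<^sub>g'V\<^sub>g/(\<nu>\<^sub>g-2)\<close> is a Gamma mixture of Gaussian kernels, so even moments factor over coordinates; odd ones
  vanish by reflecting a coordinate.
\<close>

section \<open>Spectral theorem\<close>

text \<open>\<open>corr_of\<close> is a definite description, so there is no formula to
  differentiate: gamma fixes only the off-diagonal part of L = log C, and the unit diagonal of C
  determines the diagonal of L implicitly. All calculus is therefore done on L, since C, C^{1/2} and
  C^{-1/2} are the exponentials of L, L/2 and -L/2 and share one eigenbasis.

  The factors of the result have direct meanings. The inner projection in M adds to the direction of
  gamma the motion of diag L that keeps diag C = 1. With S = C^{1/2}, Omega solves dS S + S dS = dC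
  and multiplies by S^{-1}, so Omega vec(dC) = vec(S^{-1} dS). A score coordinate is then the
  pairing of S^{-1} dS with the sum of W_g P_g V_g U' minus I, where -I comes from the
  log-determinant.

  Fourth-order products of V occur under the sole condition nu_g > 2. They are integrable because a
  fourth-order product within one group always carries W_g^2, and each factor W_g raises the decay
  exponent of the density of V_g by one.\<close>

declare transpose_matrix_vector [simp del]

abbreviation spectral :: "real^'n^'n \<Rightarrow> real^'n \<Rightarrow> real^'n^'n" where
  "spectral Q a \<equiv> Q ** diagm a ** transpose Q"

lemma diagm_nth [simp]: "diagm v $ i $ j = (if i = j then v $ i else 0)"
  by (simp add: diagm_def)

lemma mult_diagm_nth: "((A::real^'n^'m) ** diagm d) $ i $ j = A $ i $ j * d $ j"
  by (simp add: matrix_matrix_mult_def if_distrib[of "\<lambda>x. _ * x"] cong: if_cong)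

lemma diagm_mult_nth: "(diagm d ** (A::real^'n^'m)) $ i $ j = d $ i * A $ i $ j"
  by (simp add: matrix_matrix_mult_def if_distrib[of "\<lambda>x. x * _"] cong: if_cong)

lemma transpose_diagm [simp]: "transpose (diagm d) = diagm d"
  by (simp add: vec_eq_iff transpose_def)

lemma inner_mat: "(A::real^'n^'m) \<bullet> B = (\<Sum>i\<in>UNIV. \<Sum>j\<in>UNIV. A $ i $ j * B $ i $ j)"
  by (simp add: inner_vec_def)

lemma inner_mat_trace: "(A::real^'n^'m) \<bullet> B = trace (transpose A ** B)"
  by (simp add: inner_mat trace_def matrix_matrix_mult_def transpose_def) (rule sum.swap)

lemma inner_mult_left:
  fixes A :: "real^'n^'k" and Q :: "real^'k^'m"
  shows "(Q ** A) \<bullet> B = A \<bullet> (transpose Q ** B)"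
  by (simp add: inner_mat_trace matrix_transpose_mul matrix_mul_assoc)

lemma inner_transpose: "transpose A \<bullet> transpose B = A \<bullet> (B::real^'n^'m)"
  unfolding inner_mat transpose_def by simp (rule sum.swap)

lemma inner_mult_right: 
  fixes A :: "real^'k^'m" and R :: "real^'n^'k"
  shows "(A ** R) \<bullet> B = A \<bullet> (B ** transpose R)"
proof -
  have "(A ** R) \<bullet> B = (transpose R ** transpose A) \<bullet> transpose B"
    by (metis inner_transpose matrix_transpose_mul)
  also have "\<dots> = transpose A \<bullet> (R ** transpose B)"
    by (simp add: inner_mult_left)
  also have "\<dots> = A \<bullet> (B ** transpose R)"
    by (metis inner_transpose matrix_transpose_mul transpose_transpose)
  finally show ?thesis .
qed

lemma orthogonal_matrixD:
  assumes "orthogonal_matrix Q"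
  shows "transpose Q ** Q = mat 1" "Q ** transpose Q = mat 1"
    "transpose Q ** (Q ** A) = A" "Q ** (transpose Q ** A) = A"
  using assms by (auto simp: orthogonal_matrix_def matrix_mul_assoc)

lemma inner_conj_orthogonal:
  fixes A :: "real^'n^'n"
  assumes "orthogonal_matrix Q" "orthogonal_matrix R"
  shows "(Q ** A ** R) \<bullet> (Q ** B ** R) = A \<bullet> B"
proof -
  have "(Q ** A ** R) \<bullet> (Q ** B ** R) = A \<bullet> (transpose Q ** Q ** B ** (R ** transpose R))"
    by (metis inner_mult_right inner_mult_left matrix_mul_assoc)
  then show ?thesis
    using assms by (simp add: orthogonal_matrixD)
qed

lemma norm_conj_orthogonal:
  fixes A :: "real^'n^'n"
  assumes "orthogonal_matrix Q" "orthogonal_matrix R"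
  shows "norm (Q ** A ** R) = norm A"
  using inner_conj_orthogonal[OF assms, of A A] by (simp add: norm_eq_sqrt_inner)

text \<open>First variation at a maximizer of the Rayleigh quotient: to first order in t, a step t
  along the residual w = A x - mu x would raise it by 2 t |w|^2, so w must vanish. The hypothesis
  \<open>inv\<close> places w in S.\<close>

lemma quadratic_form_max_eigenvector:
  fixes A :: "real^'n^'n"
  assumes sym: "transpose A = A" and S: "subspace S" and x: "x \<in> S" "norm x = 1"
    and inv: "A *v x \<in> S"
    and max: "\<And>y. y \<in> S \<Longrightarrow> norm y = 1 \<Longrightarrow> y \<bullet> (A *v y) \<le> x \<bullet> (A *v x)"
  shows "A *v x = (x \<bullet> (A *v x)) *\<^sub>R x"
proof -
  define \<mu> where "\<mu> = x \<bullet> (A *v x)"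
  define w where "w = A *v x - \<mu> *\<^sub>R x"
  have wS: "w \<in> S" unfolding w_def using S x inv by (intro subspace_diff subspace_mul) auto
  have symm: "w \<bullet> (A *v x) = x \<bullet> (A *v w)"
    by (metis dot_lmul_matrix inner_commute sym vector_transpose_matrix)
  have le: "y \<bullet> (A *v y) \<le> \<mu> * (y \<bullet> y)" if "y \<in> S" for y
  proof (cases "y = 0")
    case False
    have "(1 / norm y) *\<^sub>R y \<in> S" using S that by (simp add: subspace_mul)
    moreover have "norm ((1 / norm y) *\<^sub>R y) = 1" using False by simp
    ultimately have "((1 / norm y) *\<^sub>R y) \<bullet> (A *v ((1 / norm y) *\<^sub>R y)) \<le> \<mu>"
      using max unfolding \<mu>_def by blast
    then show ?thesis using False
      by (simp add: matrix_vector_mult_scaleR dot_square_norm field_simps power2_eq_square)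
  qed auto
  \<comment> \<open>This is \<open>le\<close> at x + t w. The terms containing w \<bullet> x cancel
    and leave a quadratic in t with linear coefficient 2 |w|^2.\<close>
  have quad: "2 * t * (w \<bullet> w) + t\<^sup>2 * (w \<bullet> (A *v w) - \<mu> * (w \<bullet> w)) \<le> 0" for t
  proof -
    have "x + t *\<^sub>R w \<in> S" using S x wS by (simp add: subspace_add subspace_mul)
    from le[OF this] have "\<mu> + 2 * t * (w \<bullet> (A *v x)) + t\<^sup>2 * (w \<bullet> (A *v w))
        \<le> \<mu> * (x \<bullet> x + 2 * t * (w \<bullet> x) + t\<^sup>2 * (w \<bullet> w))"
      using symm by (simp add: matrix_vector_right_distrib matrix_vector_mult_scaleR inner_add_left inner_add_right
          \<mu>_def[symmetric] algebra_simps power2_eq_square inner_commute)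
    moreover have "x \<bullet> x = 1" using x by (simp add: dot_square_norm)
    moreover have ww: "w \<bullet> (A *v x) = w \<bullet> w + \<mu> * (w \<bullet> x)"
    proof -
      have "w \<bullet> w = w \<bullet> (A *v x - \<mu> *\<^sub>R x)" by (simp only: w_def)
      then show ?thesis by (simp add: inner_diff_right)
    qed
    ultimately have "\<mu> + 2 * t * (w \<bullet> w + \<mu> * (w \<bullet> x)) + t\<^sup>2 * (w \<bullet> (A *v w))
        \<le> \<mu> * (1 + 2 * t * (w \<bullet> x) + t\<^sup>2 * (w \<bullet> w))"
      by (simp only:)
    then show ?thesis by (simp add: algebra_simps)
  qed
  have "w \<bullet> w = 0"
  proof (rule ccontr)
    assume "w \<bullet> w \<noteq> 0"
    then have pos: "w \<bullet> w > 0" by simp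
    define a where "a = w \<bullet> w"
    define b where "b = w \<bullet> (A *v w) - \<mu> * (w \<bullet> w)"
    \<comment> \<open>Small enough that |t b| \<le> a, so that 2 a + t b \<ge> a > 0 contradicts the
      quadratic bound.\<close>
    define t where "t = a / (1 + \<bar>b\<bar>)"
    have t: "t > 0" using pos by (simp add: t_def a_def)
    have "2 * a + t * b \<le> 0"
    proof -
      have "t * (2 * a + t * b) \<le> 0"
        using quad[of t] by (simp add: a_def b_def algebra_simps power2_eq_square)
      then show ?thesis using t by (simp add: mult_le_0_iff)
    qed
    moreover have "t * b \<ge> - a"
    proof -
      have "a * - b \<le> a * (1 + \<bar>b\<bar>)" using pos by (intro mult_left_mono) (auto simp: a_def)
      then show ?thesis by (simp add: t_def field_simps)
    qed
    ultimately show False using pos by (simp add: a_def)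
  qed
  then show ?thesis by (simp add: w_def \<mu>_def)
qed

lemma symmetric_eigenvector_in_subspace:
  fixes A :: "real^'n^'n"
  assumes sym: "transpose A = A" and S: "subspace S" "S \<noteq> {0}" 
    and inv: "\<And>x. x \<in> S \<Longrightarrow> A *v x \<in> S"
  obtains x c where "x \<in> S" "norm x = 1" "A *v x = c *\<^sub>R x"
proof -
  obtain y where y: "y \<in> S" "y \<noteq> 0" using S subspace_0 by blast
  let ?K = "S \<inter> sphere 0 1"
  have "compact ?K" using S(1) by (intro closed_Int_compact closed_subspace) auto
  moreover have "(1 / norm y) *\<^sub>R y \<in> ?K" using y S by (simp add: subspace_mul)
  then have "?K \<noteq> {}" by blast
  moreover have "continuous_on ?K (\<lambda>x. x \<bullet> (A *v x))"
    by (intro continuous_intros linear_continuous_on matrix_vector_mul_bounded_linear)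
  ultimately have "\<exists>x\<in>?K. \<forall>y\<in>?K. y \<bullet> (A *v y) \<le> x \<bullet> (A *v x)"
    by (rule continuous_attains_sup)
  then obtain x where x: "x \<in> ?K" "\<And>y. y \<in> ?K \<Longrightarrow> y \<bullet> (A *v y) \<le> x \<bullet> (A *v x)"
    by blast
  then show thesis
    using quadratic_form_max_eigenvector[OF sym S(1), of x] inv by (intro that[of x]) auto
qed

text \<open>Split off a unit eigenvector x and continue in the part of S orthogonal to x, which
  stays invariant because A is symmetric. Invariant subspaces are the objects of the induction so
  that A itself never has to be restricted.\<close>

lemma symmetric_orthonormal_eigenbasis:
  fixes A :: "real^'n^'n"
  assumes sym: "transpose A = A"
  shows "subspace S \<Longrightarrow> (\<And>x. x \<in> S \<Longrightarrow> A *v x \<in> S) \<Longrightarrow>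
    \<exists>B. B \<subseteq> S \<and> pairwise orthogonal B \<and> span B = S \<and> (\<forall>b\<in>B. norm b = 1 \<and> (\<exists>c. A *v b = c *\<^sub>R b))"
proof (induction "dim S" arbitrary: S rule: less_induct)
  case less
  show ?case
  proof (cases "S = {0}")
    case True
    then show ?thesis by (intro exI[of _ "{}"]) (auto simp: pairwise_empty)
  next
    case False
    obtain x c where x: "x \<in> S" "norm x = 1" "A *v x = c *\<^sub>R x"
      using symmetric_eigenvector_in_subspace[OF sym less.prems(1) False less.prems(2)] by blast
    define S' where "S' = S \<inter> {y. x \<bullet> y = 0}"
    have S': "subspace S'" unfolding S'_def using less.prems(1) by (intro subspace_inter subspace_hyperplane)
    have xx: "x \<bullet> x = 1" using x by (simp add: dot_square_norm)
    have "x \<notin> S'" using xx by (simp add: S'_def)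
    moreover have "S' \<subseteq> S" by (simp add: S'_def)
    ultimately have "S' \<subset> S" using x by blast
    then have dim: "dim S' < dim S"
      using S' less.prems(1) by (metis dim_psubset span_eq_iff)
    have inv: "A *v y \<in> S'" if "y \<in> S'" for y
    proof -
      have "x \<bullet> (A *v y) = (A *v x) \<bullet> y"
        by (metis dot_lmul_matrix sym vector_transpose_matrix)
      then show ?thesis using that less.prems(2) x by (auto simp: S'_def)
    qed
    obtain B where B: "B \<subseteq> S'" "pairwise orthogonal B" "span B = S'"
      "\<forall>b\<in>B. norm b = 1 \<and> (\<exists>c. A *v b = c *\<^sub>R b)"
      using less.hyps[OF dim S' inv] by blast
    have "span (insert x B) = S"
    proof
      show "span (insert x B) \<subseteq> S"
        using less.prems(1) B(1) x by (intro span_minimal) (auto simp: S'_def)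
      show "S \<subseteq> span (insert x B)"
      proof
        fix y assume y: "y \<in> S"
        have "y - (x \<bullet> y) *\<^sub>R x \<in> S'"
          using y x less.prems(1) xx by (auto simp: S'_def inner_diff_right subspace_diff subspace_mul)
        then show "y \<in> span (insert x B)" using B(3) span_breakdown_eq by blast
      qed
    qed
    moreover have "pairwise orthogonal (insert x B)"
      using B(1,2) by (auto simp: pairwise_insert orthogonal_def S'_def inner_commute)
    ultimately show ?thesis
      using B x by (intro exI[of _ "insert x B"]) (auto simp: S'_def)
  qed
qed

lemma spectral_decomposition:
  fixes A :: "real^'n^'n"
  assumes sym: "transpose A = A"
  obtains Q lam where "orthogonal_matrix Q" "A = spectral Q lam"
proof -
  obtain B :: "(real^'n) set" where B: "pairwise orthogonal B" "span B = UNIV"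
      "\<And>b. b \<in> B \<Longrightarrow> norm b = 1" "\<And>b. b \<in> B \<Longrightarrow> \<exists>c. A *v b = c *\<^sub>R b"
    using symmetric_orthonormal_eigenbasis[OF sym subspace_UNIV] by blast
  have "0 \<notin> B" using B(3) by fastforce
  then have indep: "independent B" using B(1) pairwise_orthogonal_independent by blast
  then have fin: "finite B" using independent_imp_finite by blast
  have "card B = CARD('n)"
    using basis_card_eq_dim[of B UNIV] indep B(2) by simp
  then obtain b where b: "bij_betw b (UNIV::'n set) B"
    using fin finite_same_card_bij[of "UNIV::'n set" B] by auto
  have "\<forall>j. \<exists>c. A *v b j = c *\<^sub>R b j"
    using B(4) b by (auto simp: bij_betw_def)
  then obtain c where c: "\<And>j. A *v b j = c j *\<^sub>R b j"
    by metis
  define Q :: "real^'n^'n" where "Q = (\<chi> i j. b j $ i)"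
  have orth: "b i \<bullet> b j = (if i = j then 1 else 0)" for i j
  proof (cases "i = j")
    case True
    then show ?thesis using B(3)[of "b j"] b by (simp add: bij_betwE dot_square_norm)
  next
    case False
    then have "b i \<noteq> b j" using b by (metis bij_betw_def inj_eq)
    then show ?thesis using B(1) b False by (auto simp: pairwise_def orthogonal_def bij_betw_def)
  qed
  have "transpose Q ** Q = mat 1"
    using orth by (simp add: vec_eq_iff matrix_matrix_mult_def transpose_def Q_def mat_def inner_vec_def)
  then have Q: "orthogonal_matrix Q" by (simp add: orthogonal_matrix)
  have "(A ** Q) $ i $ j = (Q ** diagm (\<chi> j. c j)) $ i $ j" for i j
  proof -
    have "(A ** Q) $ i $ j = (A *v b j) $ i"
      by (simp add: matrix_matrix_mult_def matrix_vector_mult_def Q_def)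
    then show ?thesis by (simp add: c mult_diagm_nth Q_def)
  qed
  then have "A ** Q = Q ** diagm (\<chi> j. c j)" by (simp add: vec_eq_iff)
  then have "A = spectral Q (\<chi> j. c j)"
    using Q by (metis matrix_mul_assoc matrix_mul_rid orthogonal_matrixD(2))
  with Q show thesis by (rule that)
qed

section \<open>Spectral functions and the derivative of the exponential\<close>

text \<open>A general f is allowed because the Taylor estimate below applies the Lipschitz bound to
  the functions \<open>xi (a $ i)\<close>, not only to \<open>exp\<close>.\<close>

definition specfun :: "(real \<Rightarrow> real) \<Rightarrow> real^'n^'n \<Rightarrow> real^'n^'n" where
  "specfun f X = (THE E. \<exists>Q lam. orthogonal_matrix Q \<and> X = spectral Q lam
     \<and> E = spectral Q (\<chi> i. f (lam $ i)))"

abbreviation mexp :: "real^'n^'n \<Rightarrow> real^'n^'n" where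
  "mexp \<equiv> specfun exp"

lemma matrix_diff_ldistrib: "(A::real^'n^'m) ** (B - C) = A ** B - A ** (C::real^'k^'n)"
  by (simp add: vec_eq_iff matrix_matrix_mult_def right_diff_distrib sum_subtractf)

lemma matrix_diff_rdistrib: "(A - B) ** C = A ** C - (B::real^'n^'m) ** (C::real^'k^'n)"
  by (simp add: vec_eq_iff matrix_matrix_mult_def left_diff_distrib sum_subtractf)

lemma matrix_mult_scaleR_left: "(c *\<^sub>R A) ** B = c *\<^sub>R ((A::real^'n^'m) ** (B::real^'k^'n))"
  by (simp add: vec_eq_iff matrix_matrix_mult_def sum_distrib_left mult_ac)

lemma matrix_mult_scaleR_right: "A ** (c *\<^sub>R B) = c *\<^sub>R ((A::real^'n^'m) ** (B::real^'k^'n))"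
  by (simp add: vec_eq_iff matrix_matrix_mult_def sum_distrib_left mult_ac)

lemma matrix_mult_nth: "((A::real^'n^'m) ** (B::real^'k^'n)) $ i $ j = (\<Sum>k\<in>UNIV. A $ i $ k * B $ k $ j)"
  by (simp add: matrix_matrix_mult_def)

lemma transpose_nth: "transpose A $ i $ j = A $ j $ i"
  by (simp add: transpose_def)

lemma matrix_add_rdist: "(A + B) ** C = A ** C + (B::real^'n^'m) ** (C::real^'k^'n)"
  by (simp add: vec_eq_iff matrix_matrix_mult_def distrib_right sum.distrib)

text \<open>Using a different eigenbasis on each side turns the difference into T diag(b) - diag(a)
  T with T = Q' R, so the entries decouple although the two matrices need not commute.\<close>

lemma conj_diff_nth:
  fixes Q R :: "real^'n^'n"
  assumes "orthogonal_matrix Q" "orthogonal_matrix R"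
  shows "(transpose Q ** (spectral R b - spectral Q a) ** R) $ i $ j
    = (transpose Q ** R) $ i $ j * (b $ j - a $ i)"
proof -
  have "transpose Q ** (spectral R b - spectral Q a) ** R
     = (transpose Q ** R) ** diagm b ** (transpose R ** R) - (transpose Q ** Q) ** (diagm a ** (transpose Q ** R))"
    by (simp add: matrix_diff_ldistrib matrix_diff_rdistrib matrix_mul_assoc)
  also have "\<dots> = (transpose Q ** R) ** diagm b - diagm a ** (transpose Q ** R)"
    using assms by (simp add: orthogonal_matrixD)
  finally have eq: "transpose Q ** (spectral R b - spectral Q a) ** R
      = (transpose Q ** R) ** diagm b - diagm a ** (transpose Q ** R)" .
  show ?thesis unfolding eq by (simp add: mult_diagm_nth diagm_mult_nth algebra_simps)
qed

lemma orthogonal_conj_cancel: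
  fixes Q R :: "real^'n^'n"
  assumes "orthogonal_matrix Q" "orthogonal_matrix R" "transpose Q ** A ** R = transpose Q ** B ** R"
  shows "A = B"
proof -
  have "Q ** (transpose Q ** A ** R) ** transpose R = Q ** (transpose Q ** B ** R) ** transpose R"
    using assms(3) by simp
  then have "(Q ** transpose Q) ** A ** (R ** transpose R) = (Q ** transpose Q) ** B ** (R ** transpose R)"
    by (simp only: matrix_mul_assoc)
  then show ?thesis using assms(1,2) by (simp add: orthogonal_matrixD)
qed

text \<open>Equality forces T_ij (b_j - a_i) = 0 for T = Q' R. Where T_ij is nonzero the two
  eigenvalues agree, hence so do their images under f.\<close>

lemma spectral_function_unique:
  fixes Q R :: "real^'n^'n"
  assumes Q: "orthogonal_matrix Q" and R: "orthogonal_matrix R"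
    and eq: "spectral Q a = spectral R b"
  shows "spectral Q (\<chi> i. f (a $ i)) = spectral R (\<chi> i. f (b $ i))"
proof -
  have "(transpose Q ** R) $ i $ j * (f (b $ j) - f (a $ i)) = 0" for i j
    using conj_diff_nth[OF Q R, of b a i j] eq by auto
  then have "(transpose Q ** (spectral R (\<chi> i. f (b $ i)) - spectral Q (\<chi> i. f (a $ i))) ** R) $ i $ j = 0" for i j
    using conj_diff_nth[OF Q R, of "\<chi> i. f (b $ i)" "\<chi> i. f (a $ i)" i j] by simp
  then have "transpose Q ** (spectral R (\<chi> i. f (b $ i)) - spectral Q (\<chi> i. f (a $ i))) ** R
     = transpose Q ** 0 ** R"
    by (simp add: vec_eq_iff)
  from orthogonal_conj_cancel[OF Q R this] show ?thesis by simp
qed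

lemma specfun_eq:
  assumes "orthogonal_matrix Q"
  shows "specfun f (spectral Q a) = spectral Q (\<chi> i. f (a $ i))"
  unfolding specfun_def
proof (rule the_equality, goal_cases)
  case 1
  show ?case using assms by (intro exI[of _ Q] exI[of _ a]) simp
next
  case (2 E)
  then obtain R b where "orthogonal_matrix R" "spectral Q a = spectral R b"
    "E = spectral R (\<chi> i. f (b $ i))" by blast
  then show ?case
    using spectral_function_unique[OF assms, of R a b f] by simp
qed

lemma abs_mat_nth_le_norm: "\<bar>(A::real^'n^'m) $ i $ j\<bar> \<le> norm A"
  using component_le_norm_cart[of "A $ i" j] Finite_Cartesian_Product.norm_nth_le[of A i] by simp

lemma norm_mat_le_entrywise:
  fixes A B :: "real^'n^'m"
  assumes "\<And>i j. \<bar>A $ i $ j\<bar> \<le> K * \<bar>B $ i $ j\<bar>" "K \<ge> 0"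
  shows "norm A \<le> K * norm B"
proof -
  have "norm A \<le> norm (K *\<^sub>R B)"
    using assms by (intro norm_le_componentwise_cart) (simp add: abs_mult)
  then show ?thesis using assms(2) by simp
qed

lemma norm_mat_le_l1: "norm (A::real^'n^'m) \<le> (\<Sum>i\<in>UNIV. \<Sum>j\<in>UNIV. \<bar>A $ i $ j\<bar>)"
proof -
  have "norm A \<le> (\<Sum>i\<in>UNIV. norm (A $ i))" by (simp add: norm_vec_def L2_set_le_sum)
  also have "\<dots> \<le> (\<Sum>i\<in>UNIV. \<Sum>j\<in>UNIV. \<bar>A $ i $ j\<bar>)" by (intro sum_mono norm_le_l1_cart)
  finally show ?thesis .
qed

lemma eigenvalue_le_norm:
  assumes "orthogonal_matrix Q"
  shows "\<bar>a $ i\<bar> \<le> norm (spectral Q a)"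
proof -
  have "\<bar>a $ i\<bar> = \<bar>diagm a $ i $ i\<bar>" by simp
  also have "\<dots> \<le> norm (diagm a)" by (rule abs_mat_nth_le_norm)
  also have "\<dots> = norm (spectral Q a)"
    using assms by (simp add: norm_conj_orthogonal orthogonal_matrix_transpose)
  finally show ?thesis .
qed

text \<open>In the mixed bases the entries compared are T_ij (f(b_j) - f(a_i)) and T_ij (b_j - a_i),
  and conjugation preserves the Frobenius norm. So the scalar constant K carries over
  unchanged.\<close>

lemma specfun_lipschitz:
  fixes X Y :: "real^'n^'n"
  assumes sym: "transpose X = X" "transpose Y = Y" and B: "norm X \<le> B" "norm Y \<le> B"
    and f: "\<And>x y. \<bar>x\<bar> \<le> B \<Longrightarrow> \<bar>y\<bar> \<le> B \<Longrightarrow> \<bar>f x - f y\<bar> \<le> K * \<bar>x - y\<bar>" and K: "K \<ge> 0"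
  shows "norm (specfun f Y - specfun f X) \<le> K * norm (Y - X)"
proof -
  obtain Q a where Q: "orthogonal_matrix Q" and X: "X = spectral Q a"
    using spectral_decomposition[OF sym(1)] .
  obtain R b where R: "orthogonal_matrix R" and Y: "Y = spectral R b"
    using spectral_decomposition[OF sym(2)] .
  have Q': "orthogonal_matrix (transpose Q)" using Q by (simp add: orthogonal_matrix_transpose)
  have "norm (specfun f Y - specfun f X) = norm (transpose Q ** (specfun f Y - specfun f X) ** R)"
    by (simp add: norm_conj_orthogonal[OF Q' R])
  also have "\<dots> \<le> K * norm (transpose Q ** (Y - X) ** R)"
  proof (rule norm_mat_le_entrywise[OF _ K])
    fix i j
    have "\<bar>f (b $ j) - f (a $ i)\<bar> \<le> K * \<bar>b $ j - a $ i\<bar>"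
      using eigenvalue_le_norm[OF Q, of a i] eigenvalue_le_norm[OF R, of b j] B
      by (intro f) (auto simp: X Y)
    then have "\<bar>(transpose Q ** R) $ i $ j\<bar> * \<bar>f (b $ j) - f (a $ i)\<bar> \<le> \<bar>(transpose Q ** R) $ i $ j\<bar> * (K * \<bar>b $ j - a $ i\<bar>)"
      by (rule mult_left_mono) simp
    then show "\<bar>(transpose Q ** (specfun f Y - specfun f X) ** R) $ i $ j\<bar> \<le> K * \<bar>(transpose Q ** (Y - X) ** R) $ i $ j\<bar>"
      unfolding X Y specfun_eq[OF Q] specfun_eq[OF R] conj_diff_nth[OF Q R] by (simp add: abs_mult mult_ac)
  qed
  also have "\<dots> = K * norm (Y - X)" by (simp add: norm_conj_orthogonal[OF Q' R])
  finally show ?thesis .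
qed

lemma abs_exp_diff_le:
  fixes x y :: real
  assumes "x \<le> B" "y \<le> B"
  shows "\<bar>exp x - exp y\<bar> \<le> exp B * \<bar>x - y\<bar>"
proof -
  have *: "exp v - exp u \<le> exp B * (v - u)" if "u \<le> v" "v \<le> B" for u v :: real
  proof -
    have "1 + (u - v) \<le> exp (u - v)" by (rule exp_ge_add_one_self)
    then have "exp v * (1 + (u - v)) \<le> exp u"
      by (metis exp_diff exp_gt_zero mult.commute pos_le_divide_eq)
    then have "exp v - exp u \<le> exp v * (v - u)" by (simp add: algebra_simps)
    also have "\<dots> \<le> exp B * (v - u)" using that by (intro mult_right_mono) auto
    finally show ?thesis .
  qed
  show ?thesis
    using *[of x y] *[of y x] assms by (cases "x \<le> y") auto
qed

text \<open>The first divided difference of exp, which is also the diagonal entry of Xi.\<close>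

definition xi :: "real \<Rightarrow> real \<Rightarrow> real" where
  "xi a b = (if a = b then exp a else (exp a - exp b) / (a - b))"

lemma xi_mult: "xi a b * (b - a) = exp b - exp a"
proof (cases "a = b")
  case False
  then have "xi a b * (a - b) = exp a - exp b" by (simp add: xi_def)
  then show ?thesis by (simp add: right_diff_distrib)
qed simp

lemma xi_sym: "xi a b = xi b a"
  unfolding xi_def by (auto simp: field_simps)

lemma xi_pos: "xi a b > 0"
  unfolding xi_def by (auto simp: zero_less_divide_iff)

text \<open>This form absorbs the case distinction at a = b, so that a bound on the integrand gives
  a Lipschitz bound for \<open>xi\<close> everywhere.\<close>

lemma xi_integral: "((\<lambda>s. exp (b + s * (a - b))) has_integral xi a b) {0..1}"
proof (cases "a = b")
  case True
  then show ?thesis using has_integral_const_real[of "exp b" 0 1] by (simp add: xi_def)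
next
  case False
  have "((\<lambda>s. exp (b + s * (a - b))) has_integral
     exp (b + 1 * (a - b)) / (a - b) - exp (b + 0 * (a - b)) / (a - b)) {0..1}"
    using False by (intro fundamental_theorem_of_calculus)
      (auto intro!: derivative_eq_intros simp: has_real_derivative_iff_has_vector_derivative[symmetric])
  then show ?thesis using False by (simp add: xi_def diff_divide_distrib)
qed

lemma xi_lipschitz:
  assumes "\<bar>a\<bar> \<le> B" "\<bar>b\<bar> \<le> B" "\<bar>c\<bar> \<le> B"
  shows "\<bar>xi a b - xi a c\<bar> \<le> exp B * \<bar>b - c\<bar>"
proof -
  have "norm (xi a b - xi a c) \<le> (exp B * \<bar>b - c\<bar>) * measure lborel (cbox 0 (1::real))"
  proof (rule has_integral_bound)
    show "((\<lambda>s. exp (b + s * (a - b)) - exp (c + s * (a - c))) has_integral xi a b - xi a c) (cbox 0 1)"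
      using has_integral_diff[OF xi_integral xi_integral] by simp
    fix s :: real assume "s \<in> cbox 0 1"
    then have s: "0 \<le> s" "s \<le> 1" by auto
    have *: "d + s * (a - d) \<le> B" if "\<bar>d\<bar> \<le> B" for d
    proof -
      have "d + s * (a - d) = (1 - s) * d + s * a" by (simp add: algebra_simps)
      also have "\<dots> \<le> (1 - s) * B + s * B" using s that assms(1) by (intro add_mono mult_left_mono) auto
      finally show ?thesis by (simp add: algebra_simps)
    qed
    have "\<bar>exp (b + s * (a - b)) - exp (c + s * (a - c))\<bar> \<le> exp B * \<bar>(b + s * (a - b)) - (c + s * (a - c))\<bar>"
      using * assms by (intro abs_exp_diff_le) auto
    also have "(b + s * (a - b)) - (c + s * (a - c)) = (1 - s) * (b - c)" by (simp add: algebra_simps)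
    also have "exp B * \<bar>(1 - s) * (b - c)\<bar> \<le> exp B * \<bar>b - c\<bar>"
      using s by (intro mult_left_mono) (auto simp: abs_mult intro: mult_left_le_one_le)
    finally show "norm (exp (b + s * (a - b)) - exp (c + s * (a - c))) \<le> exp B * \<bar>b - c\<bar>" by simp
  qed auto
  then show ?thesis by simp
qed

text \<open>The Daleckii--Krein form of the derivative of the exponential at \<open>Q diag(lam) Q'\<close>.\<close>
definition dexp :: "real^'n^'n \<Rightarrow> real^'n \<Rightarrow> real^'n^'n \<Rightarrow> real^'n^'n" where
  "dexp Q lam H = Q ** (\<chi> i j. xi (lam $ i) (lam $ j) * (transpose Q ** H ** Q) $ i $ j) ** transpose Q"

lemma matrix_conj_add: "Q ** (A + B) ** R = Q ** A ** R + Q ** (B::real^'n^'n) ** (R::real^'n^'n)"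
  by (simp add: matrix_add_ldistrib matrix_add_rdist)

lemma linear_dexp: "linear (dexp (Q::real^'n^'n) lam)"
proof (rule linearI)
  fix A B :: "real^'n^'n" and c :: real
  have "(\<chi> i j. xi (lam $ i) (lam $ j) * (transpose Q ** (A + B) ** Q) $ i $ j)
    = (\<chi> i j. xi (lam $ i) (lam $ j) * (transpose Q ** A ** Q) $ i $ j)
    + (\<chi> i j. xi (lam $ i) (lam $ j) * (transpose Q ** B ** Q) $ i $ j)"
    by (simp add: vec_eq_iff matrix_conj_add distrib_left)
  then show "dexp Q lam (A + B) = dexp Q lam A + dexp Q lam B"
    unfolding dexp_def by (simp add: matrix_conj_add)
  have "(\<chi> i j. xi (lam $ i) (lam $ j) * (transpose Q ** (c *\<^sub>R A) ** Q) $ i $ j)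
    = c *\<^sub>R (\<chi> i j. xi (lam $ i) (lam $ j) * (transpose Q ** A ** Q) $ i $ j)"
    by (simp add: vec_eq_iff matrix_mult_scaleR_left matrix_mult_scaleR_right)
  then show "dexp Q lam (c *\<^sub>R A) = c *\<^sub>R dexp Q lam A"
    unfolding dexp_def by (simp add: matrix_mult_scaleR_left matrix_mult_scaleR_right)
qed

text \<open>In the eigenbasis the form is a sum of squares weighted by \<open>xi\<close> > 0. This
  infinitesimal version of strict monotonicity gives the invertibility used both in the inverse
  function theorem and for E_d Gamma E_d'.\<close>

lemma inner_dexp_pos:
  assumes Q: "orthogonal_matrix Q" and H: "H \<noteq> 0"
  shows "H \<bullet> dexp Q lam H > 0"
proof -
  let ?B = "transpose Q ** H ** Q"
  have "H \<bullet> dexp Q lam H = ?B \<bullet> (\<chi> i j. xi (lam $ i) (lam $ j) * ?B $ i $ j)"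
  proof -
    let ?N = "\<chi> i j. xi (lam $ i) (lam $ j) * ?B $ i $ j"
    have "(Q ** ?N ** transpose Q) \<bullet> H = ?N \<bullet> (transpose Q ** (H ** transpose (transpose Q)))"
      by (rule trans[OF inner_mult_right inner_mult_left])
    then show ?thesis by (simp add: dexp_def inner_commute matrix_mul_assoc)
  qed
  also have "\<dots> = (\<Sum>i\<in>UNIV. \<Sum>j\<in>UNIV. xi (lam $ i) (lam $ j) * (?B $ i $ j)\<^sup>2)"
    by (simp add: inner_mat power2_eq_square mult_ac)
  finally have eq: "H \<bullet> dexp Q lam H = (\<Sum>i\<in>UNIV. \<Sum>j\<in>UNIV. xi (lam $ i) (lam $ j) * (?B $ i $ j)\<^sup>2)" .
  have "?B \<noteq> 0"
  proof
    assume "?B = 0"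
    then have "transpose Q ** H ** Q = transpose Q ** 0 ** Q" by simp
    then show False using orthogonal_conj_cancel[OF Q Q] H by blast
  qed
  then obtain i j where "?B $ i $ j \<noteq> 0" by (auto simp: vec_eq_iff)
  then have "0 < xi (lam $ i) (lam $ j) * (?B $ i $ j)\<^sup>2" using xi_pos by simp
  also have "\<dots> \<le> (\<Sum>j\<in>UNIV. xi (lam $ i) (lam $ j) * (?B $ i $ j)\<^sup>2)"
    using xi_pos by (intro member_le_sum) (auto simp: less_imp_le)
  also have "\<dots> \<le> (\<Sum>i\<in>UNIV. \<Sum>j\<in>UNIV. xi (lam $ i) (lam $ j) * (?B $ i $ j)\<^sup>2)"
    using xi_pos by (intro member_le_sum[of i UNIV "\<lambda>i. \<Sum>j\<in>UNIV. xi (lam $ i) (lam $ j) * (?B $ i $ j)\<^sup>2"]) (auto simp: less_imp_le intro!: sum_nonneg)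
  finally show ?thesis by (simp add: eq)
qed

text \<open>Put f_i = \<open>xi (a $ i)\<close> and D = Q' (Y - X) Q. Since exp(b) - exp(a_i) =
  f_i(b) (b - a_i), row i of Q' (mexp Y - mexp X) Q is row i of D times Q' f_i(Y) Q. The linear term
  \<open>dexp\<close> is the same expression with f_i(X). The remainder is thus D times f_i(Y) -
  f_i(X), and both factors are of order norm (Y - X).\<close>

lemma mexp_taylor:
  fixes Q Y :: "real^'n^'n"
  assumes Q: "orthogonal_matrix Q" and X: "X = spectral Q a"
    and Y: "transpose Y = Y" and B: "norm X \<le> B" "norm Y \<le> B"
  shows "norm (mexp Y - mexp X - dexp Q a (Y - X)) \<le> real CARD('n) ^ 3 * exp B * (norm (Y - X))\<^sup>2"
proof -
  obtain R b where R: "orthogonal_matrix R" and Yeq: "Y = spectral R b"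
    using spectral_decomposition[OF Y] .
  have Q': "orthogonal_matrix (transpose Q)" using Q by (simp add: orthogonal_matrix_transpose)
  have Xsym: "transpose X = X" by (simp add: X matrix_transpose_mul matrix_mul_assoc)
  define T where "T = transpose Q ** R"
  define D where "D = transpose Q ** (Y - X) ** Q"
  define F where "F = (\<lambda>i. transpose Q ** (specfun (xi (a $ i)) Y - specfun (xi (a $ i)) X) ** Q)"
  define E where "E = transpose Q ** (mexp Y - mexp X - dexp Q a (Y - X)) ** Q"
  have TT: "T ** transpose T = mat 1"
  proof -
    have "T ** transpose T = transpose Q ** (R ** transpose R) ** Q"
      by (simp only: T_def matrix_transpose_mul transpose_transpose matrix_mul_assoc)
    then show ?thesis using Q R by (simp add: orthogonal_matrixD)
  qed
  \<comment> \<open>T passes between the mixed form with bases Q, R, where differences have explicit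
    entries, and the form with Q on both sides, where \<open>dexp\<close> lives.\<close>
  have RT: "transpose Q ** Z ** R = transpose Q ** Z ** Q ** T" for Z
  proof -
    have "transpose Q ** Z ** Q ** T = transpose Q ** Z ** (Q ** transpose Q) ** R"
      by (simp only: T_def matrix_mul_assoc)
    then show ?thesis using Q by (simp add: orthogonal_matrixD)
  qed
  have QT: "transpose Q ** Z ** Q = (transpose Q ** Z ** R) ** transpose T" for Z
    unfolding RT matrix_mul_assoc[symmetric, of _ T] TT by simp
  have DT: "(D ** T) $ i $ j = T $ i $ j * (b $ j - a $ i)" for i j
  proof -
    have "D ** T = transpose Q ** (Y - X) ** R" by (simp only: D_def RT)
    then show ?thesis unfolding Yeq X T_def by (simp only: conj_diff_nth[OF Q R])
  qed
  have E: "E $ i $ k = (\<Sum>l\<in>UNIV. D $ i $ l * F i $ l $ k)" for i k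
  proof -
    have F1: "(transpose Q ** specfun (xi (a $ i)) Y ** Q) $ l $ k = (\<Sum>j\<in>UNIV. T $ l $ j * xi (a $ i) (b $ j) * T $ k $ j)" for l
    proof -
      have "transpose Q ** specfun (xi (a $ i)) Y ** Q = T ** diagm (\<chi> j. xi (a $ i) (b $ j)) ** transpose T"
        unfolding Yeq specfun_eq[OF R] T_def by (simp add: matrix_transpose_mul matrix_mul_assoc)
      then show ?thesis
        by (simp only: matrix_mult_nth[of _ "transpose T"] mult_diagm_nth transpose_nth vec_lambda_beta)
    qed
    have F2: "(transpose Q ** specfun (xi (a $ i)) X ** Q) $ l $ k = (if l = k then xi (a $ i) (a $ l) else 0)" for l
    proof -
      have "transpose Q ** specfun (xi (a $ i)) X ** Q = (transpose Q ** Q) ** diagm (\<chi> j. xi (a $ i) (a $ j)) ** (transpose Q ** Q)"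
        unfolding X specfun_eq[OF Q] by (simp only: matrix_mul_assoc)
      then show ?thesis using Q by (simp add: orthogonal_matrixD)
    qed
    \<comment> \<open>\<open>xi_mult\<close> splits off the factor b_j - a_i, which together with
      T_ij is an entry of \<open>D ** T\<close>. Expanding that product moves the j-sum into
      f_i(Y).\<close>
    have G1: "(transpose Q ** (mexp Y - mexp X) ** Q) $ i $ k = (\<Sum>l\<in>UNIV. D $ i $ l * (transpose Q ** specfun (xi (a $ i)) Y ** Q) $ l $ k)"
    proof -
      have "(transpose Q ** (mexp Y - mexp X) ** Q) $ i $ k
          = (\<Sum>j\<in>UNIV. (transpose Q ** (mexp Y - mexp X) ** R) $ i $ j * T $ k $ j)"
        by (simp only: QT[of "mexp Y - mexp X"] matrix_mult_nth[of _ "transpose T"] transpose_nth)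
      also have "\<dots> = (\<Sum>j\<in>UNIV. T $ i $ j * (exp (b $ j) - exp (a $ i)) * T $ k $ j)"
        unfolding Yeq X specfun_eq[OF Q] specfun_eq[OF R] conj_diff_nth[OF Q R] T_def by simp
      also have "\<dots> = (\<Sum>j\<in>UNIV. (D ** T) $ i $ j * xi (a $ i) (b $ j) * T $ k $ j)"
        unfolding DT xi_mult[symmetric] by (simp add: mult_ac)
      also have "\<dots> = (\<Sum>j\<in>UNIV. \<Sum>l\<in>UNIV. D $ i $ l * T $ l $ j * xi (a $ i) (b $ j) * T $ k $ j)"
        by (simp add: matrix_matrix_mult_def sum_distrib_right)
      also have "\<dots> = (\<Sum>l\<in>UNIV. \<Sum>j\<in>UNIV. D $ i $ l * T $ l $ j * xi (a $ i) (b $ j) * T $ k $ j)"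
        by (rule sum.swap)
      also have "\<dots> = (\<Sum>l\<in>UNIV. D $ i $ l * (transpose Q ** specfun (xi (a $ i)) Y ** Q) $ l $ k)"
        unfolding F1 by (simp add: sum_distrib_left mult_ac)
      finally show ?thesis .
    qed
    have "transpose Q ** dexp Q a (Y - X) ** Q = (transpose Q ** Q) ** (\<chi> i j. xi (a $ i) (a $ j) * D $ i $ j) ** (transpose Q ** Q)"
      unfolding dexp_def D_def by (simp only: matrix_mul_assoc)
    then have "(transpose Q ** dexp Q a (Y - X) ** Q) $ i $ k = xi (a $ i) (a $ k) * D $ i $ k"
      using Q by (simp add: orthogonal_matrixD)
    also have "\<dots> = (\<Sum>l\<in>UNIV. D $ i $ l * (transpose Q ** specfun (xi (a $ i)) X ** Q) $ l $ k)"
      unfolding F2 by (simp add: if_distrib[of "\<lambda>x. _ * x"] cong: if_cong)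
    finally show ?thesis unfolding E_def F_def using G1
      by (simp add: matrix_diff_ldistrib matrix_diff_rdistrib right_diff_distrib sum_subtractf)
  qed
  have nD: "norm D = norm (Y - X)" unfolding D_def by (rule norm_conj_orthogonal[OF Q' Q])
  have nF: "norm (F i) \<le> exp B * norm (Y - X)" for i
  proof -
    have "norm (F i) = norm (specfun (xi (a $ i)) Y - specfun (xi (a $ i)) X)"
      unfolding F_def by (rule norm_conj_orthogonal[OF Q' Q])
    also have "\<dots> \<le> exp B * norm (Y - X)"
    proof (rule specfun_lipschitz[OF Xsym Y B])
      have "\<bar>a $ i\<bar> \<le> B" using eigenvalue_le_norm[OF Q, of a i] B(1) by (simp add: X)
      then show "\<bar>xi (a $ i) x - xi (a $ i) y\<bar> \<le> exp B * \<bar>x - y\<bar>" if "\<bar>x\<bar> \<le> B" "\<bar>y\<bar> \<le> B" for x y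
        using that by (intro xi_lipschitz)
    qed simp
    finally show ?thesis .
  qed
  have "\<bar>E $ i $ k\<bar> \<le> real CARD('n) * (exp B * (norm (Y - X))\<^sup>2)" for i k
  proof -
    have "\<bar>E $ i $ k\<bar> \<le> (\<Sum>l\<in>UNIV. \<bar>D $ i $ l\<bar> * \<bar>F i $ l $ k\<bar>)"
      unfolding E by (rule order_trans[OF sum_abs]) (simp add: abs_mult)
    also have "\<dots> \<le> (\<Sum>l\<in>(UNIV::'n set). norm (Y - X) * (exp B * norm (Y - X)))"
      using abs_mat_nth_le_norm[of D i] abs_mat_nth_le_norm[of "F i"] nD nF[of i]
      by (intro sum_mono mult_mono) (auto intro: order_trans)
    finally show ?thesis by (simp add: power2_eq_square mult_ac)
  qed
  then have "(\<Sum>i\<in>UNIV. \<Sum>k\<in>UNIV. \<bar>E $ i $ k\<bar>) \<le> (\<Sum>i\<in>(UNIV::'n set). \<Sum>k\<in>(UNIV::'n set). real CARD('n) * (exp B * (norm (Y - X))\<^sup>2))"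
    by (intro sum_mono)
  \<comment> \<open>One factor CARD('n) comes from the sum over l inside an entry of E, two more
    from bounding the norm by the sum of all entries.\<close>
  also have "\<dots> = real CARD('n) ^ 3 * exp B * (norm (Y - X))\<^sup>2"
    by (simp add: power3_eq_cube)
  finally have "norm E \<le> real CARD('n) ^ 3 * exp B * (norm (Y - X))\<^sup>2"
    using norm_mat_le_l1[of E] by linarith
  then show ?thesis unfolding E_def by (simp add: norm_conj_orthogonal[OF Q' Q])
qed

text \<open>The derivative is taken within the symmetric matrices because \<open>specfun\<close> is
  specified only for matrices with an orthogonal diagonalization.\<close>

lemma has_derivative_mexp:
  fixes Q :: "real^'n^'n"
  assumes Q: "orthogonal_matrix Q" and X: "X = spectral Q a"
  shows "(mexp has_derivative dexp Q a) (at X within {Y. transpose Y = Y})"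
  unfolding has_derivative_within_alt
proof (intro conjI allI impI)
  show "bounded_linear (dexp Q a)" using linear_dexp by (simp add: linear_conv_bounded_linear)
  fix e :: real assume e: "e > 0"
  define K where "K = real CARD('n) ^ 3 * exp (norm X + 1)"
  have K: "K > 0" by (simp add: K_def)
  show "\<exists>d>0. \<forall>Y\<in>{Y. transpose Y = Y}. norm (Y - X) < d \<longrightarrow> norm (mexp Y - mexp X - dexp Q a (Y - X)) \<le> e * norm (Y - X)"
  \<comment> \<open>The bound 1 keeps Y in the ball of radius norm X + 1 that enters K; the bound e
    / K then absorbs one of the two factors norm (Y - X).\<close>
  proof (intro exI[of _ "min 1 (e / K)"] conjI ballI impI)
    fix Y :: "real^'n^'n" assume Y: "Y \<in> {Y. transpose Y = Y}" and d: "norm (Y - X) < min 1 (e / K)"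
    have "norm Y \<le> norm X + 1" using d norm_triangle_sub[of Y X] by linarith
    then have "norm (mexp Y - mexp X - dexp Q a (Y - X)) \<le> K * (norm (Y - X))\<^sup>2"
      unfolding K_def using Y by (intro mexp_taylor[OF Q X]) auto
    also have "\<dots> = (K * norm (Y - X)) * norm (Y - X)" by (simp add: power2_eq_square)
    also have "\<dots> \<le> e * norm (Y - X)"
      using d K by (intro mult_right_mono) (auto simp: field_simps)
    finally show "norm (mexp Y - mexp X - dexp Q a (Y - X)) \<le> e * norm (Y - X)" .
  qed (use e K in auto)
qed

text \<open>In mixed bases the inner product is the sum of T_ij^2 (e^{b_j} - e^{a_i}) (b_j - a_i).
  All terms are nonnegative, so if the sum is at most 0 each T_ij (b_j - a_i) vanishes, that is, Q'
  (Y - X) R = 0.\<close>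

lemma mexp_strict_mono_eq:
  fixes X Y :: "real^'n^'n"
  assumes sym: "transpose X = X" "transpose Y = Y" and le: "(mexp Y - mexp X) \<bullet> (Y - X) \<le> 0"
  shows "X = Y"
proof -
  obtain Q a where Q: "orthogonal_matrix Q" and X: "X = spectral Q a"
    using spectral_decomposition[OF sym(1)] .
  obtain R b where R: "orthogonal_matrix R" and Y: "Y = spectral R b"
    using spectral_decomposition[OF sym(2)] .
  have Q': "orthogonal_matrix (transpose Q)" using Q by (simp add: orthogonal_matrix_transpose)
  define T where "T = transpose Q ** R"
  define t where "t = (\<lambda>i j. (T $ i $ j)\<^sup>2 * ((exp (b $ j) - exp (a $ i)) * (b $ j - a $ i)))"
  have "(mexp Y - mexp X) \<bullet> (Y - X) = (transpose Q ** (mexp Y - mexp X) ** R) \<bullet> (transpose Q ** (Y - X) ** R)"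
    by (simp add: inner_conj_orthogonal[OF Q' R])
  also have "\<dots> = (\<Sum>i\<in>UNIV. \<Sum>j\<in>UNIV. t i j)"
    unfolding X Y specfun_eq[OF Q] specfun_eq[OF R] inner_mat conj_diff_nth[OF Q R] t_def T_def
    by (simp add: power2_eq_square mult_ac)
  finally have sum0: "(\<Sum>i\<in>UNIV. \<Sum>j\<in>UNIV. t i j) \<le> 0" using le by simp
  have nonneg: "t i j \<ge> 0" for i j
  proof -
    have "(exp (b $ j) - exp (a $ i)) * (b $ j - a $ i) \<ge> 0"
      by (cases "a $ i \<le> b $ j") (auto intro: mult_nonneg_nonneg mult_nonpos_nonpos)
    then show ?thesis unfolding t_def by (intro mult_nonneg_nonneg[OF zero_le_power2])
  qed
  then have "(\<Sum>i\<in>UNIV. \<Sum>j\<in>UNIV. t i j) = 0"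
    using sum0 by (intro order_antisym sum_nonneg) auto
  then have "t i j = 0" for i j
    using nonneg by (simp add: sum_nonneg_eq_0_iff sum_nonneg)
  then have "(T $ i $ j) * (b $ j - a $ i) = 0" for i j
    unfolding t_def by (auto simp: power2_eq_square)
  then have "transpose Q ** (Y - X) ** R = transpose Q ** 0 ** R"
    using conj_diff_nth[OF Q R, of b a] by (simp add: vec_eq_iff X Y T_def)
  then show ?thesis using orthogonal_conj_cancel[OF Q R] by fastforce
qed

section \<open>Logarithms of correlation matrices\<close>

lemma inner_matrix_vector: "x \<bullet> (A *v y) = (transpose A *v x) \<bullet> (y::real^'n)" for A :: "real^'n^'m"
  by (simp only: dot_lmul_matrix[symmetric] transpose_matrix_vector)

lemma matrix_inv_eqI:
  fixes A :: "real^'n^'n"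
  assumes "A ** B = mat 1"
  shows "matrix_inv A = B"
proof -
  have BA: "B ** A = mat 1" using assms matrix_left_right_inverse by blast
  have "\<exists>A'. A ** A' = mat 1 \<and> A' ** A = mat 1" using assms BA by blast
  then have "A ** matrix_inv A = mat 1 \<and> matrix_inv A ** A = mat 1"
    unfolding matrix_inv_def by (rule someI_ex)
  then have "B ** (A ** matrix_inv A) = B" by simp
  then show ?thesis using BA by (simp add: matrix_mul_assoc)
qed

lemma matrix_inv_injective:
  fixes A :: "real^'n^'n"
  assumes "\<And>x. A *v x = 0 \<Longrightarrow> x = 0"
  shows "matrix_inv A ** A = mat 1" "A ** matrix_inv A = mat 1"
proof -
  obtain B where "B ** A = mat 1"
    using assms matrix_left_invertible_ker[of A] by blast
  then have AB: "A ** B = mat 1" using matrix_left_right_inverse by blast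
  with \<open>B ** A = mat 1\<close> show "matrix_inv A ** A = mat 1" "A ** matrix_inv A = mat 1"
    by (simp_all add: matrix_inv_eqI[OF AB])
qed

lemma transpose_mexp:
  assumes "transpose X = X"
  shows "transpose (mexp X) = mexp X"
proof -
  obtain Q a where Q: "orthogonal_matrix Q" and X: "X = spectral Q a"
    using spectral_decomposition[OF assms] .
  show ?thesis unfolding X specfun_eq[OF Q] by (simp add: matrix_transpose_mul matrix_mul_assoc)
qed

lemma scaleR_spectral: "s *\<^sub>R (spectral Q a) = spectral Q (s *\<^sub>R a)"
proof -
  have "diagm (s *\<^sub>R a) = s *\<^sub>R diagm a" by (simp add: vec_eq_iff)
  then show ?thesis by (simp add: matrix_mult_scaleR_left matrix_mult_scaleR_right)
qed

lemma transpose_scaleR: "transpose (s *\<^sub>R A) = s *\<^sub>R transpose A"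
  by (simp add: vec_eq_iff transpose_def)

text \<open>Multiples of one symmetric matrix share an eigenbasis. The case s + t = 0 gives inverses
  and s = t = 1/2 gives square roots.\<close>

lemma mexp_scaleR_mult:
  fixes X :: "real^'n^'n"
  assumes "transpose X = X"
  shows "mexp (s *\<^sub>R X) ** mexp (t *\<^sub>R X) = mexp ((s + t) *\<^sub>R X)"
proof -
  obtain Q a where Q: "orthogonal_matrix Q" and X: "X = spectral Q a"
    using spectral_decomposition[OF assms] .
  have d: "diagm (\<chi> i. exp ((s *\<^sub>R a) $ i)) ** diagm (\<chi> i. exp ((t *\<^sub>R a) $ i)) = diagm (\<chi> i. exp (((s + t) *\<^sub>R a) $ i))"
    by (simp add: vec_eq_iff mult_diagm_nth exp_add distrib_right)
  have "mexp (s *\<^sub>R X) ** mexp (t *\<^sub>R X)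
      = Q ** diagm (\<chi> i. exp ((s *\<^sub>R a) $ i)) ** (transpose Q ** Q) ** diagm (\<chi> i. exp ((t *\<^sub>R a) $ i)) ** transpose Q"
    unfolding X scaleR_spectral specfun_eq[OF Q] by (simp only: matrix_mul_assoc)
  also have "\<dots> = Q ** (diagm (\<chi> i. exp ((s *\<^sub>R a) $ i)) ** diagm (\<chi> i. exp ((t *\<^sub>R a) $ i))) ** transpose Q"
    using Q by (simp only: orthogonal_matrixD(1) matrix_mul_rid matrix_mul_assoc)
  finally show ?thesis unfolding X scaleR_spectral specfun_eq[OF Q] d .
qed

lemma mexp_0: "mexp (0::real^'n^'n) = mat 1"
proof -
  have I: "orthogonal_matrix (mat 1 :: real^'n^'n)" by (simp add: orthogonal_matrix_id)
  have "mexp (mat 1 ** diagm 0 ** transpose (mat 1 :: real^'n^'n)) = mat 1"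
    unfolding specfun_eq[OF I] by (simp add: vec_eq_iff transpose_mat) (simp add: mat_def)
  moreover have "diagm 0 = (0::real^'n^'n)" by (simp add: vec_eq_iff)
  ultimately show ?thesis by simp
qed

lemma mexp_uminus:
  fixes X :: "real^'n^'n"
  assumes "transpose X = X"
  shows "mexp X ** mexp (- X) = mat 1" "mexp (- X) ** mexp X = mat 1" "matrix_inv (mexp X) = mexp (- X)"
proof -
  show 1: "mexp X ** mexp (- X) = mat 1" "mexp (- X) ** mexp X = mat 1"
    using mexp_scaleR_mult[OF assms, of 1 "-1"] mexp_scaleR_mult[OF assms, of "-1" 1] by (simp_all add: mexp_0)
  show "matrix_inv (mexp X) = mexp (- X)" using 1 by (rule_tac matrix_inv_eqI)
qed

lemma mexp_half:
  fixes X :: "real^'n^'n"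
  assumes "transpose X = X"
  shows "mexp ((1/2) *\<^sub>R X) ** mexp ((1/2) *\<^sub>R X) = mexp X"
  using mexp_scaleR_mult[OF assms, of "1/2" "1/2"] by simp

lemma mexp_inj:
  fixes X Y :: "real^'n^'n"
  assumes "transpose X = X" "transpose Y = Y" "mexp X = mexp Y"
  shows "X = Y"
  using mexp_strict_mono_eq[OF assms(1,2)] assms(3) by simp

lemma pos_def_mexp:
  fixes X :: "real^'n^'n"
  assumes "transpose X = X"
  shows "pos_def_mat (mexp X)"
  unfolding pos_def_mat_def
proof (intro conjI allI impI)
  show "transpose (mexp X) = mexp X" by (rule transpose_mexp[OF assms])
  fix x :: "real^'n" assume x: "x \<noteq> 0"
  define Y where "Y = (1/2) *\<^sub>R X"
  have Y: "transpose Y = Y" using assms by (simp add: Y_def transpose_scaleR)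
  have "mexp Y *v x \<noteq> 0"
  proof
    assume "mexp Y *v x = 0"
    then have "mexp (- Y) *v (mexp Y *v x) = 0" by simp
    then show False using x mexp_uminus(2)[OF Y] by (simp add: matrix_vector_mul_assoc)
  qed
  then have "0 < (mexp Y *v x) \<bullet> (mexp Y *v x)" by simp
  also have "\<dots> = x \<bullet> (mexp Y *v (mexp Y *v x))"
    by (simp only: inner_matrix_vector transpose_mexp[OF Y])
  also have "\<dots> = x \<bullet> (mexp X *v x)"
    using mexp_half[OF assms] by (simp add: matrix_vector_mul_assoc Y_def)
  finally show "0 < x \<bullet> (mexp X *v x)" .
qed

text \<open>Testing positivity at the i-th column of Q shows that each eigenvalue is positive, so
  the logarithm can be taken eigenvalue by eigenvalue.\<close>

lemma pos_def_mat_imp_mexp: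
  fixes C :: "real^'n^'n"
  assumes "pos_def_mat C"
  obtains L where "transpose L = L" "C = mexp L"
proof -
  have "transpose C = C" using assms by (simp add: pos_def_mat_def)
  then obtain Q a where Q: "orthogonal_matrix Q" and C: "C = spectral Q a"
    using spectral_decomposition by blast
  have pos: "a $ i > 0" for i
  proof -
    let ?x = "Q *v axis i 1"
    have "transpose Q *v ?x = axis i 1" using Q by (simp add: matrix_vector_mul_assoc orthogonal_matrixD)
    then have "?x \<noteq> 0" by (metis axis_eq_0_iff matrix_vector_mult_0_right zero_neq_one)
    then have "0 < ?x \<bullet> (C *v ?x)" using assms by (simp add: pos_def_mat_def)
    also have "C *v ?x = Q *v (diagm a *v (transpose Q *v ?x))"
      by (simp only: C matrix_vector_mul_assoc matrix_mul_assoc)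
    also have "transpose Q *v ?x = axis i 1" by fact
    also have "?x \<bullet> (Q *v (diagm a *v axis i 1)) = (transpose Q *v ?x) \<bullet> (diagm a *v axis i 1)"
      by (rule inner_matrix_vector)
    also have "transpose Q *v ?x = axis i 1" by fact
    also have "axis i 1 \<bullet> (diagm a *v axis i 1) = a $ i"
      by (simp add: inner_axis' matrix_vector_mul_component inner_axis)
    finally show ?thesis .
  qed
  define L where "L = spectral Q (\<chi> i. ln (a $ i))"
  have "transpose L = L" by (simp add: L_def matrix_transpose_mul matrix_mul_assoc)
  moreover have "(\<chi> i. exp ((\<chi> i. ln (a $ i)) $ i)) = a" using pos by (simp add: vec_eq_iff)
  then have "C = mexp L" by (simp only: L_def specfun_eq[OF Q] C)
  ultimately show thesis by (rule that)
qed

lemma matlog_mexp: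
  fixes L :: "real^'n^'n"
  assumes "transpose L = L"
  shows "matlog (mexp L) = L"
  unfolding matlog_def
proof (rule the_equality, goal_cases)
  case 1
  obtain Q a where Q: "orthogonal_matrix Q" and L: "L = spectral Q a"
    using spectral_decomposition[OF assms] .
  then show ?case using specfun_eq[OF Q, of exp a] by blast
next
  case (2 L')
  then obtain R b where R: "orthogonal_matrix R" "L' = spectral R b"
    "mexp L = spectral R (\<chi> i. exp (b $ i))" by blast
  then have "mexp L' = mexp L" by (simp add: specfun_eq)
  moreover have "transpose L' = L'" using R by (simp add: matrix_transpose_mul matrix_mul_assoc)
  ultimately show ?case using mexp_inj assms by blast
qed

text \<open>A positive definite root has the form \<open>mexp L\<close>; squaring gives
  \<open>mexp (2 *\<^sub>R L) = mexp X\<close>, and injectivity of \<open>mexp\<close> determines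
  L.\<close>

lemma msqrt_mexp:
  fixes X :: "real^'n^'n"
  assumes "transpose X = X"
  shows "msqrt (mexp X) = mexp ((1/2) *\<^sub>R X)"
  unfolding msqrt_def
proof (rule the_equality)
  show "pos_def_mat (mexp ((1/2) *\<^sub>R X)) \<and> mexp ((1/2) *\<^sub>R X) ** mexp ((1/2) *\<^sub>R X) = mexp X"
    using assms by (auto intro!: pos_def_mexp mexp_half simp: transpose_scaleR)
  fix S :: "real^'n^'n" assume S: "pos_def_mat S \<and> S ** S = mexp X"
  then obtain L where L: "transpose L = L" "S = mexp L" using pos_def_mat_imp_mexp by blast
  then have "mexp (2 *\<^sub>R L) = mexp X" using S mexp_scaleR_mult[OF L(1), of 1 1] by simp
  then have "2 *\<^sub>R L = X" using mexp_inj[of "2 *\<^sub>R L" X] L assms by (simp add: transpose_scaleR)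
  then have "L = (1/2) *\<^sub>R X" by auto
  then show "S = mexp ((1/2) *\<^sub>R X)" using L by simp
qed

lemma det_mexp:
  fixes X :: "real^'n^'n"
  assumes "transpose X = X"
  shows "det (mexp X) = exp (trace X)"
proof -
  obtain Q a where Q: "orthogonal_matrix Q" and X: "X = spectral Q a"
    using spectral_decomposition[OF assms] .
  have "det Q * det (transpose Q) = 1"
    using Q by (metis det_I det_mul orthogonal_matrixD(2))
  then have "det (mexp X) = det (diagm (\<chi> i. exp (a $ i)))"
    unfolding X specfun_eq[OF Q] by (simp add: det_mul)
  also have "\<dots> = exp (\<Sum>i\<in>UNIV. a $ i)"
    by (subst det_diagonal) (auto simp: exp_sum)
  also have "(\<Sum>i\<in>UNIV. a $ i) = trace (diagm a)" by (simp add: trace_def)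
  also have "\<dots> = trace X"
  proof -
    have "trace X = trace (transpose Q ** (Q ** diagm a))" unfolding X by (rule trace_mul_sym)
    then show ?thesis using Q by (simp add: orthogonal_matrixD)
  qed
  finally show ?thesis .
qed

text \<open>Jacobi's formula for the derivative of log det(exp X): in the eigenbasis exp(-a_i)
  cancels the diagonal weight xi(a_i, a_i) = exp(a_i).\<close>

lemma inner_mexp_uminus_dexp:
  assumes Q: "orthogonal_matrix Q"
  shows "mexp (- (spectral Q a)) \<bullet> dexp Q a H = trace H"
proof -
  have "- (spectral Q a) = spectral Q (- a)"
    using scaleR_spectral[of "-1" Q a] by simp
  then have "mexp (- (spectral Q a)) = spectral Q (\<chi> i. exp (- a $ i))"
    by (simp add: specfun_eq[OF Q])
  then have "mexp (- (spectral Q a)) \<bullet> dexp Q a H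
     = diagm (\<chi> i. exp (- a $ i)) \<bullet> (\<chi> i j. xi (a $ i) (a $ j) * (transpose Q ** H ** Q) $ i $ j)"
    using Q by (simp add: dexp_def inner_conj_orthogonal orthogonal_matrix_transpose)
  also have "\<dots> = (\<Sum>i\<in>UNIV. exp (- a $ i) * (xi (a $ i) (a $ i) * (transpose Q ** H ** Q) $ i $ i))"
    by (simp add: inner_mat if_distrib[of "\<lambda>x. x * _"] cong: if_cong)
  also have "\<dots> = trace (transpose Q ** H ** Q)"
    by (simp add: trace_def xi_def exp_minus mult.assoc[symmetric])
  also have "\<dots> = trace (Q ** (transpose Q ** H))" by (rule trace_mul_sym)
  also have "\<dots> = trace H" using Q by (simp add: orthogonal_matrixD)
  finally show ?thesis .
qed

text \<open>For two candidates with the same gamma, the difference of the correlation matrices has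
  zero diagonal and the difference of the logarithms has zero off-diagonal part. Their inner product
  is 0, and strict monotonicity makes them equal.\<close>

lemma corr_of_mexp:
  fixes L :: "((real, 'n::{finite,linorder}) vec, 'n) vec"
  assumes L: "transpose L = L" and C: "is_corr (mexp L)" and low: "\<And>p. p \<in> lowidx \<Longrightarrow> vecm L $ p = gam $ p"
  shows "corr_of gam = mexp L"
  unfolding corr_of_def
proof (rule the_equality)
  show "is_corr (mexp L) \<and> (\<forall>p\<in>lowidx. vecm (matlog (mexp L)) $ p = gam $ p)"
    using L C low by (simp add: matlog_mexp)
  fix C' assume C': "is_corr C' \<and> (\<forall>p\<in>lowidx. vecm (matlog C') $ p = gam $ p)"
  then obtain L' where L': "transpose L' = L'" "C' = mexp L'"
    using pos_def_mat_imp_mexp by (auto simp: is_corr_def)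
  have lower: "L' $ i $ j = L $ i $ j" if "j < i" for i j
  proof -
    have "vecm L' $ (j, i) = vecm L $ (j, i)" using that C' low L' by (simp add: matlog_mexp lowidx_def)
    then show ?thesis by (simp add: vecm_def)
  qed
  have "L' $ i $ j = L $ i $ j" if "i \<noteq> j" for i j
    using lower[of i j] lower[of j i] that L(1) L'(1) by (metis linorder_neqE transpose_nth)
  then have "(mexp L' - mexp L) $ i $ j * (L' - L) $ i $ j = 0" for i j
    using C C' L' by (cases "i = j") (auto simp: is_corr_def)
  then have "(mexp L' - mexp L) \<bullet> (L' - L) = 0" by (simp only: inner_mat sum.neutral_const)
  then show "C' = mexp L" using mexp_strict_mono_eq[OF L L'(1)] L' by simp
qed

lemma mexp_differentiable_path:
  fixes A :: "'a::real_normed_vector \<Rightarrow> real^'n^'n"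
  assumes "\<And>p. transpose (A p) = A p" "(A has_derivative A') (at p)"
    and Q: "orthogonal_matrix Q" "A p = spectral Q a"
  shows "((\<lambda>p. mexp (A p)) has_derivative (\<lambda>h. dexp Q a (A' h))) (at p)"
proof (rule has_derivative_in_compose[OF assms(2)])
  show "(mexp has_derivative dexp Q a) (at (A p) within range A)"
    using has_derivative_mexp[OF Q(1) refl, of a] assms(1) 
    unfolding Q(2) by (auto elim!: has_derivative_subset)
qed

lemma transpose_add: "transpose (A + B) = transpose A + transpose B"
  by (simp add: vec_eq_iff transpose_def)

lemma diag_inner_0:
  assumes "\<And>i. A $ i $ i = 0"
  shows "diagm x \<bullet> A = 0"
  using assms by (simp add: inner_mat if_distrib[of "\<lambda>x. x * _"] cong: if_cong)

lemma diagm_eq_0_iff [simp]: "diagm x = 0 \<longleftrightarrow> x = 0"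
  by (auto simp: vec_eq_iff)

text \<open>A vanishing diagonal makes the pairing of \<open>diagm x\<close> with its image 0, which
  \<open>inner_dexp_pos\<close> permits only for x = 0.\<close>

lemma dexp_diag_injective:
  assumes "orthogonal_matrix Q" "\<And>i. dexp Q a (diagm x) $ i $ i = 0"
  shows "x = 0"
  using inner_dexp_pos[OF assms(1), of "diagm x" a] diag_inner_0[of "dexp Q a (diagm x)" x] assms(2) by force

text \<open>The diagonal correction must be solved for as a function of t. Keeping t as a second
  coordinate turns this implicit problem into inverting f(x, t) = (diag exp(L + t H + diag x), t)
  near (1, 0). The vector x obtained is the velocity of the diagonal of log C, and the last
  conclusion says that diag C is stationary.\<close>

lemma correlation_log_path:
  fixes L H :: "real^'n^'n"
  assumes Q: "orthogonal_matrix Q" and L: "L = spectral Q a"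
    and C: "is_corr (mexp L)" and H: "transpose H = H"
  obtains X x where "(X has_vector_derivative H + diagm x) (at 0)" "X 0 = L" "\<And>t. transpose (X t) = X t"
    "\<forall>\<^sub>F t in nhds 0. is_corr (mexp (X t)) \<and> (\<forall>i j. i \<noteq> j \<longrightarrow> X t $ i $ j = L $ i $ j + t * H $ i $ j)"
    "\<And>i. dexp Q a (H + diagm x) $ i $ i = 0"
proof -
  have Ls: "transpose L = L" by (simp add: L matrix_transpose_mul matrix_mul_assoc)
  define A where "A = (\<lambda>p::(real^'n) \<times> real. L + snd p *\<^sub>R H + diagm (fst p))"
  define A' where "A' = (\<lambda>p::(real^'n) \<times> real. snd p *\<^sub>R H + diagm (fst p))"
  have As: "transpose (A p) = A p" for p by (simp add: A_def transpose_add transpose_scaleR Ls H)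
  have blA': "bounded_linear A'"
    unfolding A'_def linear_conv_bounded_linear[symmetric]
    by (rule linearI) (auto simp: vec_eq_iff algebra_simps)
  have dA: "(A has_derivative A') (at p)" for p
  proof -
    have "A = (\<lambda>p. L + A' p)" by (simp add: A_def A'_def fun_eq_iff algebra_simps)
    then show ?thesis using bounded_linear_imp_has_derivative[OF blA', of "at p"] by (auto intro!: derivative_eq_intros)
  qed
  define f where "f = (\<lambda>p. ((\<chi> i. mexp (A p) $ i $ i)::real^'n, snd p))"
  define f' where "f' = (\<lambda>Q a p. ((\<chi> i. dexp Q a (A' p) $ i $ i)::real^'n, snd p))"
  have df: "(f has_derivative f' R b) (at p)" if R: "orthogonal_matrix R" "A p = spectral R b" for R b p
  proof -
    have *: "((\<lambda>p. mexp (A p)) has_derivative (\<lambda>h. dexp R b (A' h))) (at p)"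
      by (rule mexp_differentiable_path[OF As dA R])
    have "bounded_linear (\<lambda>B::real^'n^'n. (\<chi> i. B $ i $ i)::real^'n)"
      unfolding linear_conv_bounded_linear[symmetric] by (rule linearI) (auto simp: vec_eq_iff)
    from bounded_linear.has_derivative[OF this *]
    show ?thesis unfolding f_def f'_def by (intro has_derivative_Pair) (auto intro!: derivative_eq_intros)
  qed
  have contf: "continuous_on UNIV f"
  proof (clarsimp simp: continuous_on_eq_continuous_at)
    fix x y
    obtain R b where "orthogonal_matrix R" "A (x, y) = spectral R b"
      using spectral_decomposition[OF As] by metis
    then show "isCont f (x, y)" using df has_derivative_continuous by blast
  qed
  \<comment> \<open>Two arguments with the same t differ in the logarithm only on the diagonal,
    where the exponentials agree; strict monotonicity applies again.\<close>
  have injf: "inj f"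
  proof (rule injI)
    fix p q assume eq: "f p = f q"
    then have s: "snd p = snd q" and d: "\<And>i. (mexp (A p) - mexp (A q)) $ i $ i = 0"
      by (auto simp: f_def vec_eq_iff)
    have diff: "A p - A q = diagm (fst p - fst q)" using s by (auto simp: A_def vec_eq_iff)
    then have "(mexp (A p) - mexp (A q)) \<bullet> (A p - A q) = 0"
      using diag_inner_0[OF d] by (simp add: inner_commute)
    then have "A q = A p" using mexp_strict_mono_eq[OF As As] by simp
    then have "fst p - fst q = 0" using diff by simp
    then show "p = q" using s by (simp add: prod_eq_iff)
  qed
  have A0: "A 0 = spectral Q a" by (simp add: A_def L vec_eq_iff)
  have A00: "A 0 = L" by (simp add: A0 L)
  have f0: "f 0 = (1, 0)" using C by (simp add: f_def A00 is_corr_def vec_eq_iff)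
  have linf': "linear (f' Q a)"
    using df[OF Q A0] has_derivative_linear by blast
  have "inj (f' Q a)"
  proof (rule linear_injective_0[OF linf', THEN iffD2], intro allI impI)
    fix p assume 0: "f' Q a p = 0"
    then have s: "snd p = 0" by (simp add: f'_def prod_eq_iff)
    then have "A' p = diagm (fst p)" by (simp add: A'_def)
    then have "\<And>i. dexp Q a (diagm (fst p)) $ i $ i = 0" using 0 by (auto simp: f'_def prod_eq_iff vec_eq_iff[of "\<chi> i. _ i"])
    then have "fst p = 0" using dexp_diag_injective[OF Q] by blast
    then show "p = 0" using s by (simp add: prod_eq_iff)
  qed
  then have "surj (f' Q a)" using linf' linear_injective_imp_surjective by blast
  then obtain g' where g': "linear g'" "f' Q a \<circ> g' = id"
    using linear_surjective_right_inverse[OF linf'] by blast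
  \<comment> \<open>Global injectivity makes \<open>inv f\<close> a left inverse everywhere, so
    continuity of f and its derivative at the single point 0 suffice for the derivative of
    g.\<close>
  define g where "g = inv f"
  have gf: "g (f p) = p" for p using injf by (simp add: g_def)
  have dg: "(g has_derivative g') (at (1, 0))"
    using has_derivative_inverse_strong[OF open_UNIV UNIV_I contf, where g=g and g'=g' and x=0 and f'="f' Q a"] gf df[OF Q A0] g' f0 by simp
  \<comment> \<open>\<open>inv f\<close> is a right inverse only on the range of f. Openness at f 0
    ensures that (1, t) lies in the range for all small t.\<close>
  have "f 0 \<in> interior (range f)"
    using sussmann_open_mapping[OF open_UNIV contf UNIV_I df[OF Q A0], of g' UNIV] g'
    by (simp add: linear_conv_bounded_linear)
  then have "(1, 0) \<in> interior (range f)" by (simp add: f0)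
  moreover have "((\<lambda>t. (1::real^'n, t::real)) \<longlongrightarrow> (1, 0)) (nhds 0)"
    by (auto intro!: tendsto_intros filterlim_ident)
  ultimately have "\<forall>\<^sub>F t in nhds 0. (1, t) \<in> interior (range f)"
    by (intro topological_tendstoD) auto
  then have ev: "\<forall>\<^sub>F t in nhds 0. (1, t) \<in> range f"
    by (rule eventually_mono) (use interior_subset in blast)
  define X where "X = (\<lambda>t. A (g (1, t)))"
  define x where "x = fst (g' (0, 1))"
  \<comment> \<open>The first component says that the diagonal of C is stationary, the second that t
    moves at unit speed.\<close>
  have fg': "f' Q a (g' (0, 1)) = (0, 1)" using fun_cong[OF g'(2), of "(0, 1)"] by simp
  then have s1: "snd (g' (0, 1)) = 1" by (simp add: f'_def)
  have Ag: "A' (g' (0, 1)) = H + diagm x" by (simp add: A'_def s1 x_def)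
  have "((\<lambda>t. (1::real^'n, t::real)) has_derivative (\<lambda>h. (0, h))) (at 0)"
    by (auto intro!: derivative_eq_intros)
  from has_derivative_compose[OF this dg]
  have "((\<lambda>t. g (1, t)) has_derivative (\<lambda>h. g' (0, h))) (at 0)" .
  from has_derivative_compose[OF this dA]
  have "(X has_derivative (\<lambda>h. A' (g' (0, h)))) (at 0)" by (simp add: X_def)
  moreover have "A' (g' (0, h)) = h *\<^sub>R (H + diagm x)" for h
  proof -
    have "g' (0, h) = h *\<^sub>R g' (0, 1)" using linear_scale[OF g'(1), of h "(0, 1)"] by simp
    then show ?thesis using linear_scale[OF bounded_linear.linear[OF blA'], of h "g' (0,1)"] Ag by simp
  qed
  ultimately have "(X has_vector_derivative H + diagm x) (at 0)" by (simp add: has_vector_derivative_def)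
  moreover have "X 0 = L" using gf[of 0] by (simp add: X_def f0 A00)
  moreover have "transpose (X t) = X t" for t by (simp add: X_def As)
  moreover have "\<forall>\<^sub>F t in nhds 0. is_corr (mexp (X t)) \<and> (\<forall>i j. i \<noteq> j \<longrightarrow> X t $ i $ j = L $ i $ j + t * H $ i $ j)"
    using ev
  proof (eventually_elim)
    case (elim t)
    then have fg: "f (g (1, t)) = (1, t)" by (simp add: g_def f_inv_into_f)
    then have s: "snd (g (1, t)) = t" and d: "\<And>i. mexp (X t) $ i $ i = 1"
      by (auto simp: f_def X_def vec_eq_iff)
    then show ?case by (auto simp: is_corr_def X_def As intro!: pos_def_mexp) (auto simp: A_def s)
  qed
  moreover have "dexp Q a (H + diagm x) $ i $ i = 0" for i
    using fg' by (auto simp: f'_def Ag vec_eq_iff)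
  ultimately show thesis by (rule that)
qed

section \<open>The matrices M and Omega\<close>

lemma sum_UNIV_prod: "(\<Sum>p\<in>(UNIV::('a::finite \<times> 'b::finite) set). f p) = (\<Sum>i\<in>UNIV. \<Sum>j\<in>UNIV. f (i, j))"
  by (simp add: sum.cartesian_product)

lemma vecm_nth [simp]: "vecm B $ p = B $ snd p $ fst p"
  by (simp add: vecm_def)

lemma inner_vecm: "vecm A \<bullet> vecm B = A \<bullet> B"
  unfolding inner_mat inner_vec_def[of "vecm A"] sum_UNIV_prod
  by (simp add: sum.swap[of "\<lambda>i j. A $ j $ i * B $ j $ i"])

text \<open>This identity lets every Kronecker operator below be studied as a map of matrices. The
  index order (column, row) of \<open>vecm\<close> is what makes A act from the right as A'.\<close>

lemma kron_mult_vecm: "kron A B *v vecm X = vecm (B ** X ** transpose A)"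
proof -
  have "(kron A B *v vecm X) $ (j, i) = vecm (B ** X ** transpose A) $ (j, i)" for i j
  proof -
    have "(kron A B *v vecm X) $ (j, i) = (\<Sum>l\<in>UNIV. \<Sum>k\<in>UNIV. A $ j $ l * B $ i $ k * X $ k $ l)"
      by (simp add: matrix_vector_mult_def kron_def sum_UNIV_prod)
    also have "\<dots> = (B ** X ** transpose A) $ i $ j"
      by (simp add: matrix_mult_nth transpose_nth sum_distrib_left mult_ac)
    finally show ?thesis by simp
  qed
  then show ?thesis by (simp add: vec_eq_iff del: vecm_nth)
qed

lemma transpose_kron: "transpose (kron A B) = kron (transpose A) (transpose B)"
  by (simp add: vec_eq_iff transpose_def kron_def)

lemma kron_mult_kron: "kron A B ** kron C D = kron (A ** C) (B ** D)"
  by (simp add: vec_eq_iff matrix_mult_nth kron_def sum_UNIV_prod sum_product mult_ac)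

lemma diagm_mult_vec_nth: "(diagm a *v v) $ i = a $ i * v $ i"
  by (simp add: matrix_vector_mult_def if_distrib[of "\<lambda>x. x * _"] cong: if_cong)

lemma Xi_vec_nth: "Xi_vec lam $ p = xi (lam $ snd p) (lam $ fst p)"
  by (subst xi_sym) (simp add: Xi_vec_def xi_def)

lemma kron_Xi_vecm:
  "(kron Q Q ** diagm (Xi_vec lam) ** transpose (kron Q Q)) *v vecm H = vecm (dexp Q lam H)"
proof -
  have "diagm (Xi_vec lam) *v vecm N = vecm (\<chi> i j. xi (lam $ i) (lam $ j) * N $ i $ j)" for N
    by (simp add: vec_eq_iff diagm_mult_vec_nth Xi_vec_nth)
  then show ?thesis
    by (simp only: matrix_vector_mul_assoc[symmetric] transpose_kron kron_mult_vecm dexp_def transpose_transpose)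
qed

text \<open>Opens the choice inside \<open>GammaM\<close> once. The decomposition found here is
  passed on to the later lemmas, so independence of \<open>GammaM\<close> from the choice never has
  to be proved.\<close>

lemma GammaM_mexp:
  fixes L :: "real^'n^'n"
  assumes "transpose L = L"
  obtains Q lam where "orthogonal_matrix Q" "L = spectral Q lam"
    "\<And>H. GammaM (mexp L) *v vecm H = vecm (dexp Q lam H)"
proof -
  obtain Q lam where Q: "orthogonal_matrix Q" "L = spectral Q lam"
    using spectral_decomposition[OF assms] .
  define P where "P = (\<lambda>(Q, lam). orthogonal_matrix Q \<and> matlog (mexp L) = spectral Q lam)"
  have "P (Q, lam)" unfolding P_def matlog_mexp[OF assms] using Q by simp
  then have "P (SOME x. P x)" by (rule someI)
  moreover obtain R b where Rb: "(SOME x. P x) = (R, b)" by fastforce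
  ultimately have R: "orthogonal_matrix R" "L = spectral R b"
    unfolding P_def matlog_mexp[OF assms] by auto
  have "GammaM (mexp L) = kron R R ** diagm (Xi_vec b) ** transpose (kron R R)"
    unfolding GammaM_def P_def[symmetric] Rb by simp
  then show thesis using R kron_Xi_vecm[of R b] by (intro that[of R b]) auto
qed

lemma transpose_Ed_mult: "transpose Ed *v x = vecm (diagm x)"
  by (simp add: vec_eq_iff matrix_vector_mult_def transpose_def Ed_def prod_eq_iff
      if_distrib[of "\<lambda>x. x * _"] cong: if_cong conj_cong) (auto simp: sum.delta' intro!: sum.neutral)

lemma Ed_mult_nth: "(Ed *v vecm A) $ i = A $ i $ i"
  by (simp add: matrix_vector_mult_def Ed_def if_distrib[of "\<lambda>x. x * _"] cong: if_cong)

lemma El_mult_nth: "(El *v w) $ p = (if p \<in> lowidx then w $ p else 0)"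
  by (cases "p \<in> lowidx") (simp_all add: matrix_vector_mult_def El_def if_distrib[of "\<lambda>x. x * _"] cong: if_cong)

lemma transpose_ElEu_mult_nth: "(transpose (El + Eu) *v w) $ p =
   (if p \<in> lowidx then w $ p else if (snd p, fst p) \<in> lowidx then w $ (snd p, fst p) else 0)"
proof -
  have e: "transpose (El + Eu) $ p $ q = (if q = p then (if p \<in> lowidx then 1 else 0) else 0)
      + (if q = (snd p, fst p) then (if (snd p, fst p) \<in> lowidx then 1 else 0) else 0)" for q
  proof -
    have "p = (snd q, fst q) \<longleftrightarrow> q = (snd p, fst p)" by (cases p, cases q) auto
    then have "Eu $ q $ p = (if q = (snd p, fst p) then (if (snd p, fst p) \<in> lowidx then 1 else 0) else 0)"
      by (simp add: Eu_def)
    moreover have "El $ q $ p = (if q = p then (if p \<in> lowidx then 1 else 0) else 0)"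
      by (simp add: El_def)
    ultimately show ?thesis unfolding transpose_nth by (simp only: vector_add_component)
  qed
  have "(transpose (El + Eu) *v w) $ p = (if p \<in> lowidx then w $ p else 0) + (if (snd p, fst p) \<in> lowidx then w $ (snd p, fst p) else 0)"
    unfolding matrix_vector_mult_def vec_lambda_beta e distrib_right sum.distrib
    by (simp add: if_distrib[of "\<lambda>x. x * _"] cong: if_cong)
  then show ?thesis by (auto simp: lowidx_def)
qed

text \<open>The derivative of a correlation matrix is symmetric with zero diagonal, so the outer
  factor (E_l + E_u)' E_l of M acts on it as the identity.\<close>

lemma symmetrize_strict_lower:
  assumes "transpose A = A" "\<And>i. A $ i $ i = 0"
  shows "transpose (El + Eu) *v (El *v vecm A) = vecm A"
proof -
  have "(transpose (El + Eu) *v (El *v vecm A)) $ p = vecm A $ p" for p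
    using assms(1) assms(2)[of "fst p"] transpose_nth[of A "fst p" "snd p"]
    by (cases "fst p" "snd p" rule: linorder_cases)
      (auto simp: transpose_ElEu_mult_nth El_mult_nth lowidx_def)
  then show ?thesis by (simp add: vec_eq_iff del: vecm_nth)
qed

text \<open>The direction in which the off-diagonal part of log C moves with coordinate k of gamma.
  As in \<open>vecm\<close>, k is a pair (column, row).\<close>

definition unit_sym :: "'n::finite \<times> 'n \<Rightarrow> real^'n^'n" where
  "unit_sym k = (\<chi> i j. if (i = snd k \<and> j = fst k) \<or> (i = fst k \<and> j = snd k) then 1 else 0)"

lemma transpose_unit_sym: "transpose (unit_sym k) = unit_sym k"
  by (auto simp: vec_eq_iff transpose_def unit_sym_def)

lemma transpose_ElEu_axis:
  assumes "k \<in> lowidx"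
  shows "transpose (El + Eu) *v axis k 1 = vecm (unit_sym k)"
proof -
  obtain a b where k: "k = (a, b)" "a < b" using assms by (cases k) (auto simp: lowidx_def)
  have "(transpose (El + Eu) *v axis (a, b) 1) $ (c, d) = vecm (unit_sym (a, b)) $ (c, d)" for c d
  proof -
    have e: "(transpose (El + Eu) *v axis (a,b) 1) $ (c, d) = (if c < d then if c = a \<and> d = b then 1 else 0
       else if d < c then if d = a \<and> c = b then 1 else 0 else 0)"
      unfolding transpose_ElEu_mult_nth axis_def lowidx_def vec_lambda_beta by simp
    have f: "vecm (unit_sym (a,b)) $ (c, d) = (if (d = b \<and> c = a) \<or> (d = a \<and> c = b) then 1 else 0)"
      by (simp add: vecm_def unit_sym_def)
    consider "c = a \<and> d = b" | "d = a \<and> c = b" | "\<not> (c = a \<and> d = b)" "\<not> (d = a \<and> c = b)" by blast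
    then show ?thesis
    proof cases
      case 1 then show ?thesis unfolding e f using k(2) by simp
    next
      case 2
      then have dc: "d = a" "c = b" by auto
      have n: "\<not> b < a" using k(2) by (rule less_not_sym)
      show ?thesis unfolding e f unfolding dc by (simp only: n k(2) if_True if_False simp_thms)
    next
      case 3 then show ?thesis unfolding e f by (simp only: if_False if_cancel conj_commute de_Morgan_disj simp_thms)
    qed
  qed
  then show ?thesis unfolding k(1) by (simp add: vec_eq_iff del: vecm_nth)
qed

lemma transpose_dexp:
  assumes "transpose H = H"
  shows "transpose (dexp Q lam H) = dexp Q lam H"
proof -
  let ?N = "\<chi> i j. xi (lam $ i) (lam $ j) * (transpose Q ** H ** Q) $ i $ j"
  have "transpose (transpose Q ** H ** Q) = transpose Q ** H ** Q"
    by (simp add: matrix_transpose_mul assms matrix_mul_assoc)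
  then have "(transpose Q ** H ** Q) $ i $ j = (transpose Q ** H ** Q) $ j $ i" for i j
    by (metis transpose_nth)
  then have "transpose ?N = ?N" by (simp add: vec_eq_iff transpose_nth) (metis xi_sym)
  then show ?thesis unfolding dexp_def by (simp add: matrix_transpose_mul matrix_mul_assoc)
qed

lemma matrix_vector_mult_minus: "A *v (- x) = - (A *v x)" for A :: "real^'n^'m"
  using matrix_vector_mult_diff_distrib[of A 0 x] by simp

text \<open>The middle factor of M computes the diagonal correction x by itself. If c = Gamma vec(H
  + diag x) has E_d c = 0, then Gamma vec(H) = c - Gamma E_d' x, and (E_d Gamma E_d')^{-1} E_d maps
  this to -x. Subtracting Gamma E_d' times -x restores c.\<close>

lemma Mmat_column:
  fixes L :: "((real, 'n::{finite,linorder}) vec, 'n) vec"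
  assumes Q: "orthogonal_matrix Q" "L = spectral Q lam"
    and Gam: "\<And>H. GammaM (mexp L) *v vecm H = vecm (dexp Q lam H)"
    and k: "k \<in> lowidx" and diag0: "\<And>i. dexp Q lam (unit_sym k + diagm x) $ i $ i = 0"
  shows "Mmat (mexp L) *v axis k 1 = vecm (dexp Q lam (unit_sym k + diagm x))"
proof -
  define Gm where "Gm = GammaM (mexp L)"
  define W where "W = matrix_inv (Ed ** Gm ** transpose Ed)"
  define c where "c = vecm (dexp Q lam (unit_sym k + diagm x))"
  \<comment> \<open>E_d Gamma E_d' sends y to the diagonal of \<open>dexp Q lam (diagm y)\<close>,
    hence is injective.\<close>
  have W: "W ** (Ed ** Gm ** transpose Ed) = mat 1"
    unfolding W_def
  proof (rule matrix_inv_injective)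
    fix y :: "(real, 'n) vec" assume y: "(Ed ** Gm ** transpose Ed) *v y = 0"
    have "dexp Q lam (diagm y) $ i $ i = ((Ed ** Gm ** transpose Ed) *v y) $ i" for i
      by (simp add: matrix_vector_mul_assoc[symmetric] transpose_Ed_mult Gm_def Gam Ed_mult_nth)
    then show "y = 0" using y by (intro dexp_diag_injective[OF Q(1), of lam]) simp
  qed
  have c: "Gm *v vecm (unit_sym k) = c - Gm *v (transpose Ed *v x)"
    unfolding c_def Gm_def Gam transpose_Ed_mult
    by (simp add: linear_add[OF linear_dexp] vec_eq_iff)
  have Edc: "Ed *v c = 0" unfolding c_def by (simp add: vec_eq_iff Ed_mult_nth diag0)
  have "(mat 1 - Gm ** transpose Ed ** W ** Ed) *v (Gm *v vecm (unit_sym k))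
      = (c - Gm *v (transpose Ed *v x)) - Gm *v (transpose Ed *v (W *v (Ed *v (c - Gm *v (transpose Ed *v x)))))"
    unfolding c by (simp add: matrix_vector_mult_diff_rdistrib matrix_vector_mul_assoc matrix_mul_assoc)
  also have "W *v (Ed *v (c - Gm *v (transpose Ed *v x))) = - ((W ** (Ed ** Gm ** transpose Ed)) *v x)"
    by (simp add: matrix_vector_mult_diff_distrib Edc matrix_vector_mul_assoc[symmetric] matrix_vector_mult_minus)
  also have "\<dots> = - x" unfolding W by simp
  finally have *: "(mat 1 - Gm ** transpose Ed ** W ** Ed) *v (Gm *v vecm (unit_sym k)) = c"
    by (simp add: matrix_vector_mult_minus)
  have "Mmat (mexp L) *v axis k 1
     = transpose (El + Eu) *v (El *v ((mat 1 - Gm ** transpose Ed ** W ** Ed) *v (Gm *v (transpose (El + Eu) *v axis k 1))))"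
    unfolding Mmat_def Let_def Gm_def W_def by (simp only: matrix_vector_mul_assoc matrix_mul_assoc)
  also have "\<dots> = transpose (El + Eu) *v (El *v c)"
    unfolding transpose_ElEu_axis[OF k] * ..
  also have "\<dots> = c"
    unfolding c_def using diag0
    by (intro symmetrize_strict_lower transpose_dexp) (simp_all add: transpose_add transpose_unit_sym)
  finally show ?thesis by (simp only: c_def)
qed

section \<open>The Kronecker sum of C^{1/2} with the identity, and Omega\<close>

lemma ksum_mult_vecm: "ksum A B *v vecm X = vecm (B ** X ** transpose A + A ** X ** transpose B)"
  unfolding ksum_def matrix_vector_mult_add_rdistrib kron_mult_vecm by (simp add: vec_eq_iff)

lemma transpose_matrix_inv:
  fixes A :: "real^'n^'n"
  assumes "A ** B = mat 1" "transpose A = A"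
  shows "transpose (matrix_inv A) = matrix_inv A"
proof -
  have BA: "B ** A = mat 1" using assms matrix_left_right_inverse by blast
  have "transpose (B ** A) = transpose (mat 1)" by (simp only: BA)
  then have "A ** transpose B = mat 1" by (simp only: matrix_transpose_mul assms(2) transpose_mat)
  then show ?thesis using matrix_inv_eqI assms(1) by metis
qed

text \<open>As a map of matrices this is the Sylvester operator X -> X S + S X. Pairing with X gives
  X' \<bullet> S X' + X \<bullet> S X, two nonnegative forms of which the second vanishes only at X
  = 0.\<close>

lemma ksum_msqrt_inverse:
  fixes S :: "real^'n^'n"
  assumes S: "pos_def_mat S"
  shows "matrix_inv (ksum S (mat 1)) ** ksum S (mat 1) = mat 1" "ksum S (mat 1) ** matrix_inv (ksum S (mat 1)) = mat 1"
proof -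
  have sym: "transpose S = S" using S by (simp add: pos_def_mat_def)
  have *: "x = 0" if x: "ksum S (mat 1) *v x = 0" for x
  proof -
    define X where "X = (\<chi> i j. x $ (j, i))"
    have xX: "x = vecm X" by (simp add: X_def vec_eq_iff)
    have 0: "X ** S + S ** X = 0"
      using x unfolding xX ksum_mult_vecm by (simp add: sym transpose_mat vec_eq_iff)
    have p: "Y \<bullet> (S ** Y) \<ge> 0" "Y \<bullet> (S ** Y) = 0 \<Longrightarrow> Y = 0" for Y
    proof -
      have eq: "Y \<bullet> (S ** Y) = (\<Sum>j\<in>UNIV. column j Y \<bullet> (S *v column j Y))"
      proof -
        have "Y \<bullet> (S ** Y) = transpose Y \<bullet> transpose (S ** Y)" by (simp only: inner_transpose)
        also have "\<dots> = (\<Sum>j\<in>UNIV. column j Y \<bullet> (S *v column j Y))"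
          by (simp add: inner_vec_def[of "transpose Y"] inner_vec_def column_def transpose_def matrix_vector_mult_def matrix_matrix_mult_def)
        finally show ?thesis .
      qed
      have nn: "column j Y \<bullet> (S *v column j Y) \<ge> 0" for j
        using S unfolding pos_def_mat_def by (cases "column j Y = 0") (auto intro: less_imp_le)
      show "Y \<bullet> (S ** Y) \<ge> 0" unfolding eq using nn by (intro sum_nonneg)
      assume "Y \<bullet> (S ** Y) = 0"
      then have "column j Y \<bullet> (S *v column j Y) = 0" for j
        unfolding eq using nn by (simp add: sum_nonneg_eq_0_iff)
      then have "column j Y = 0" for j using S unfolding pos_def_mat_def by (metis less_irrefl)
      then show "Y = 0" by (simp add: vec_eq_iff column_def)
    qed
    \<comment> \<open>Transposing turns the right multiplication X S into a left multiplication, to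
      which the positivity facts \<open>p\<close> apply.\<close>
    have "transpose X \<bullet> (S ** transpose X) = transpose X \<bullet> transpose (X ** S)" by (simp add: matrix_transpose_mul sym)
    also have "\<dots> = X \<bullet> (X ** S)" by (rule inner_transpose)
    finally have "transpose X \<bullet> (S ** transpose X) + X \<bullet> (S ** X) = X \<bullet> (X ** S + S ** X)" by (simp add: inner_add_right)
    then have "X \<bullet> (S ** X) = 0" using 0 p(1)[of X] p(1)[of "transpose X"] by simp
    then have "X = 0" by (rule p(2))
    then show ?thesis by (simp add: xX vec_eq_iff)
  qed
  from matrix_inv_injective[OF this]
  show "matrix_inv (ksum S (mat 1)) ** ksum S (mat 1) = mat 1" "ksum S (mat 1) ** matrix_inv (ksum S (mat 1)) = mat 1" by auto
qed

text \<open>Both factors of Omega are symmetric and they commute. Symmetry is what turns M' Omega w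
  into pairings with Omega M e_k, and M' Omega (...) Omega M into a bilinear form in these
  vectors.\<close>

lemma transpose_OmegaM:
  fixes C :: "real^'n^'n"
  assumes "pos_def_mat C"
  shows "transpose (OmegaM C) = OmegaM C"
proof -
  obtain L where L: "transpose L = L" "C = mexp L" using pos_def_mat_imp_mexp[OF assms] .
  define S where "S = msqrt C"
  have hs: "transpose ((1/2) *\<^sub>R L) = (1/2) *\<^sub>R L" using L by (simp add: transpose_scaleR)
  have S: "S = mexp ((1/2) *\<^sub>R L)" unfolding S_def L(2) by (rule msqrt_mexp[OF L(1)])
  have pd: "pos_def_mat S" unfolding S by (rule pos_def_mexp[OF hs])
  have sym: "transpose S = S" using pd by (simp add: pos_def_mat_def)
  define T where "T = matrix_inv S"
  have ST: "S ** T = mat 1" "T ** S = mat 1"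
    unfolding T_def S using mexp_uminus[OF hs] by simp_all
  have Ts: "transpose T = T" unfolding T_def using transpose_matrix_inv[OF ST(1) sym] .
  define K where "K = ksum S (mat 1)"
  define N where "N = kron (mat 1 :: real^'n^'n) T"
  define J where "J = matrix_inv K"
  have KJ: "J ** K = mat 1" "K ** J = mat 1" unfolding J_def K_def using ksum_msqrt_inverse[OF pd] by auto
  have Ks: "transpose K = K" unfolding K_def ksum_def by (simp add: transpose_add transpose_kron sym transpose_mat)
  have Js: "transpose J = J" unfolding J_def by (rule transpose_matrix_inv[OF KJ(2) Ks])
  have Ns: "transpose N = N" unfolding N_def by (simp add: transpose_kron Ts transpose_mat)
  have "N ** K = K ** N"
    unfolding N_def K_def ksum_def by (simp add: matrix_add_ldistrib matrix_add_rdist kron_mult_kron ST)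
  then have "J ** (N ** K) ** J = J ** (K ** N) ** J" by simp
  then have "J ** N ** (K ** J) = (J ** K) ** N ** J" by (simp only: matrix_mul_assoc)
  then have "J ** N = N ** J" by (simp add: KJ)
  then have "transpose (N ** J) = N ** J" by (simp add: matrix_transpose_mul Js Ns)
  then show ?thesis by (simp add: OmegaM_def N_def J_def K_def T_def S_def)
qed

text \<open>The hypothesis on D is the differential of C = S S with E = dS, so the conclusion reads
  Omega vec(dC) = vec(S^{-1} dS).\<close>

lemma OmegaM_mult_vecm:
  fixes S :: "real^'n^'n"
  assumes "pos_def_mat S" "S = msqrt C" "D = E ** S + S ** E"
  shows "OmegaM C *v vecm D = vecm (matrix_inv S ** E)"
proof -
  have sym: "transpose S = S" using assms(1) by (simp add: pos_def_mat_def)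
  have "vecm D = ksum S (mat 1) *v vecm E"
    unfolding ksum_mult_vecm by (simp add: assms(3) sym transpose_mat)
  then have "matrix_inv (ksum S (mat 1)) *v vecm D = vecm E"
    using ksum_msqrt_inverse(1)[OF assms(1)] by (simp add: matrix_vector_mul_assoc)
  then show ?thesis
    unfolding OmegaM_def assms(2)[symmetric] matrix_vector_mul_assoc[symmetric]
    by (simp add: kron_mult_vecm transpose_mat)
qed

section \<open>The score\<close>

lemma tstd_dens_pos:
  assumes "nu > 2" "q \<ge> 0"
  shows "tstd_dens nu m q > 0"
proof -
  have "1 + q / (nu - 2) > 0" using assms by (intro add_pos_nonneg) auto
  then show ?thesis unfolding tstd_dens_def using assms
    by (intro mult_pos_pos divide_pos_pos Gamma_real_pos) (auto simp: zero_less_mult_iff)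
qed

lemma ln_tstd_dens:
  assumes "nu > 2" "q \<ge> 0"
  shows "ln (tstd_dens nu m q) = ln (tstd_dens nu m 0) - (nu + real m) / 2 * ln (1 + q / (nu - 2))"
proof -
  have p: "1 + q / (nu - 2) > 0" using assms by (intro add_pos_nonneg) auto
  have "tstd_dens nu m q = tstd_dens nu m 0 * (1 + q / (nu - 2)) powr (- (nu + real m) / 2)"
    by (simp add: tstd_dens_def)
  moreover have "tstd_dens nu m 0 > 0" using assms by (intro tstd_dens_pos) auto
  ultimately show ?thesis using p by (simp add: ln_mult ln_powr) (simp add: algebra_simps)
qed

lemma bounded_bilinear_matrix_mult: "bounded_bilinear ((**) :: real^'n^'m \<Rightarrow> real^'k^'n \<Rightarrow> _)"
proof -
  have "bilinear ((**) :: real^'n^'m \<Rightarrow> real^'k^'n \<Rightarrow> _)"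
    unfolding bilinear_def
    by (auto intro!: linearI simp: matrix_add_ldistrib matrix_add_rdist matrix_mult_scaleR_left matrix_mult_scaleR_right)
  then show ?thesis by (simp add: bilinear_conv_bounded_bilinear)
qed

lemma has_vector_derivative_matrix_mult:
  fixes A :: "real \<Rightarrow> real^'n^'m" and B :: "real \<Rightarrow> real^'k^'n"
  assumes "(A has_vector_derivative A') (at t)" "(B has_vector_derivative B') (at t)"
  shows "((\<lambda>t. A t ** B t) has_vector_derivative A t ** B' + A' ** B t) (at t)"
  using bounded_bilinear.has_vector_derivative[OF bounded_bilinear_matrix_mult assms] .

text \<open>The factors c = 1, 1/2 and -1/2 give the derivatives of C, C^{1/2} and C^{-1/2} along
  one path, all in the same eigenbasis.\<close>

lemma mexp_has_vector_derivative:
  fixes X :: "real \<Rightarrow> real^'n^'n"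
  assumes "\<And>t. transpose (X t) = X t" "(X has_vector_derivative X') (at 0)"
    and Q: "orthogonal_matrix Q" "X 0 = spectral Q a"
  shows "((\<lambda>t. mexp (c *\<^sub>R X t)) has_vector_derivative dexp Q (c *\<^sub>R a) (c *\<^sub>R X')) (at 0)"
proof -
  have "((\<lambda>t. c *\<^sub>R X t) has_derivative (\<lambda>h. c *\<^sub>R (h *\<^sub>R X'))) (at 0)"
    using assms(2) unfolding has_vector_derivative_def by (auto intro!: derivative_eq_intros)
  moreover have "transpose (c *\<^sub>R X t) = c *\<^sub>R X t" for t using assms(1) by (simp add: transpose_scaleR)
  moreover have "c *\<^sub>R X 0 = spectral Q (c *\<^sub>R a)" unfolding Q(2) by (rule scaleR_spectral)
  ultimately have "((\<lambda>t. mexp (c *\<^sub>R X t)) has_derivative (\<lambda>h. dexp Q (c *\<^sub>R a) (c *\<^sub>R (h *\<^sub>R X')))) (at 0)"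
    using mexp_differentiable_path[of "\<lambda>t. c *\<^sub>R X t" _ 0 Q "c *\<^sub>R a"] Q(1) by blast
  moreover have "dexp Q (c *\<^sub>R a) (c *\<^sub>R (h *\<^sub>R X')) = h *\<^sub>R dexp Q (c *\<^sub>R a) (c *\<^sub>R X')" for h
    by (simp add: linear_scale[OF linear_dexp] mult.commute)
  ultimately show ?thesis by (simp add: has_vector_derivative_def)
qed

lemma unit_sym_lowidx:
  assumes "k \<in> lowidx" "p \<in> lowidx"
  shows "unit_sym k $ snd p $ fst p = axis k 1 $ p"
proof -
  have "vecm (unit_sym k) $ p = axis k 1 $ p"
    unfolding transpose_ElEu_axis[OF assms(1), symmetric] transpose_ElEu_mult_nth using assms(2) by simp
  then show ?thesis by simp
qed

lemma inner_outerv: "E \<bullet> outerv a u = a \<bullet> (E *v u)"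
  by (simp add: inner_mat outerv_def inner_vec_def matrix_vector_mult_def sum_distrib_left mult_ac)

lemma inner_mat_1: "E \<bullet> mat 1 = trace (E::real^'n^'n)"
  by (simp add: inner_mat mat_def trace_def if_distrib[of "\<lambda>x. _ * x"] cong: if_cong)

lemma group_inner: "(\<chi> i. \<Sum>j | grp j = g. P $ i $ j * v $ j) \<bullet> y = (\<Sum>j | grp j = g. v $ j * (transpose P *v y) $ j)"
proof -
  have "(\<chi> i. \<Sum>j | grp j = g. P $ i $ j * v $ j) \<bullet> y = (\<Sum>i\<in>UNIV. \<Sum>j | grp j = g. P $ i $ j * v $ j * y $ i)"
    by (simp add: inner_vec_def sum_distrib_right)
  also have "\<dots> = (\<Sum>j | grp j = g. \<Sum>i\<in>UNIV. P $ i $ j * v $ j * y $ i)" by (rule sum.swap)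
  finally show ?thesis by (simp add: matrix_vector_mult_def transpose_nth sum_distrib_left mult_ac)
qed

text \<open>Moving M' and Omega to the other side of the pairing isolates the vector Omega M e_k,
  the only place where the dependence on k enters.\<close>

lemma score_eq_inner:
  fixes P C :: "((real, 'n::{finite,linorder}) vec, 'n) vec"
  assumes C: "pos_def_mat C" and u: "u = matrix_inv (msqrt C) *v z" and v: "v = transpose P *v u"
  shows "score nu grp G C P z $ k = (OmegaM C *v (Mmat C *v axis k 1)) \<bullet>
     ((\<Sum>g\<in>{1..G}. Wg nu grp v g *\<^sub>R vecm (outerv (\<chi> i. \<Sum>j | grp j = g. P $ i $ j * v $ j) u)) - vecm (mat 1))"
proof -
  define w where "w = (\<Sum>g\<in>{1..G}. Wg nu grp v g *\<^sub>R vecm (outerv (\<chi> i. \<Sum>j | grp j = g. P $ i $ j * v $ j) u)) - vecm (mat 1)"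
  have "score nu grp G C P z $ k = axis k 1 \<bullet> (transpose (Mmat C) *v (OmegaM C *v w))"
    unfolding score_def Let_def w_def u v by (simp add: inner_axis')
  also have "\<dots> = (Mmat C *v axis k 1) \<bullet> (OmegaM C *v w)"
    by (simp only: inner_matrix_vector transpose_transpose)
  also have "\<dots> = (OmegaM C *v (Mmat C *v axis k 1)) \<bullet> w"
    by (simp only: inner_matrix_vector transpose_OmegaM[OF C])
  finally show ?thesis unfolding w_def .
qed

lemma score_eq:
  fixes P C :: "((real, 'n::{finite,linorder}) vec, 'n) vec"
  assumes "pos_def_mat C" "u = matrix_inv (msqrt C) *v z" "v = transpose P *v u"
    and E: "OmegaM C *v (Mmat C *v axis k 1) = vecm E"
  shows "score nu grp G C P z $ k
    = (\<Sum>g\<in>{1..G}. Wg nu grp v g * (\<Sum>j | grp j = g. v $ j * (transpose P *v (E *v u)) $ j)) - trace E"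
  unfolding score_eq_inner[OF assms(1-3)] E inner_diff_right inner_sum_right inner_scaleR_right inner_vecm
    inner_outerv inner_mat_1 group_inner ..

text \<open>In the logarithm X the determinant contributes exactly trace X / 2, as P has determinant
  of modulus 1, and C^{-1/2} is \<open>mexp ((-1/2) *\<^sub>R X)\<close>. Everything left is
  explicit in X.\<close>

lemma ln_ct_density_mexp:
  fixes P X :: "real^'n^'n"
  assumes nu: "\<forall>g\<in>{1..G}. nu g > 2" and P: "orthogonal_matrix P" and X: "transpose X = X"
    and v: "v = transpose P *v (mexp ((-1/2) *\<^sub>R X) *v z)"
  shows "ln (ct_density nu grp G (mexp X) P z)
    = (\<Sum>g\<in>{1..G}. ln (tstd_dens (nu g) (gsize grp g) 0)
        - (nu g + real (gsize grp g)) / 2 * ln (1 + (\<Sum>j | grp j = g. (v $ j)\<^sup>2) / (nu g - 2))) - trace X / 2"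
proof -
  let ?p = "(\<Prod>g\<in>{1..G}. tstd_dens (nu g) (gsize grp g) (\<Sum>j | grp j = g. (v $ j)\<^sup>2))"
  define Y where "Y = (1/2) *\<^sub>R X"
  have Y: "transpose Y = Y" "- Y = (-1/2) *\<^sub>R X" using X by (simp_all add: Y_def transpose_scaleR)
  have ms: "msqrt (mexp X) = mexp Y" unfolding Y_def by (rule msqrt_mexp[OF X])
  have "(mexp Y ** P) ** (transpose P ** mexp (- Y)) = mexp Y ** (P ** transpose P) ** mexp (- Y)"
    by (simp only: matrix_mul_assoc)
  also have "\<dots> = mat 1" using P mexp_uminus(1)[OF Y(1)] by (simp add: orthogonal_matrixD)
  finally have inv: "matrix_inv (mexp Y ** P) = transpose P ** mexp (- Y)" by (rule matrix_inv_eqI)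
  have vv: "matrix_inv (msqrt (mexp X) ** P) *v z = v"
    unfolding ms inv v Y(2) by (simp add: matrix_vector_mul_assoc)
  have "\<bar>det (msqrt (mexp X) ** P)\<bar> = exp (trace Y)"
    unfolding ms det_mul det_mexp[OF Y(1)] using det_orthogonal_matrix[OF P] by (auto simp: abs_mult)
  also have "trace Y = trace X / 2" unfolding Y_def by (simp add: trace_def sum_divide_distrib)
  finally have det: "\<bar>det (msqrt (mexp X) ** P)\<bar> = exp (trace X / 2)" .
  have q: "(\<Sum>j | grp j = g. (v $ j)\<^sup>2) \<ge> 0" for g by (intro sum_nonneg) auto
  have pos: "tstd_dens (nu g) (gsize grp g) (\<Sum>j | grp j = g. (v $ j)\<^sup>2) > 0" if "g \<in> {1..G}" for g
    using nu q that by (intro tstd_dens_pos) auto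
  have pp: "?p > 0"
    by (intro prod_pos pos)
  then have ne: "?p \<noteq> 0"
    by linarith
  have "ln (ct_density nu grp G (mexp X) P z)
     = ln ?p - trace X / 2"
    unfolding ct_density_def Let_def vv det
    by (simp only: ln_div ne exp_not_eq_zero ln_exp simp_thms if_True not_False_eq_True)
  also have "ln ?p
     = (\<Sum>g\<in>{1..G}. ln (tstd_dens (nu g) (gsize grp g) (\<Sum>j | grp j = g. (v $ j)\<^sup>2)))"
    by (rule ln_prod) (use pos in force)+
  also have "\<dots> = (\<Sum>g\<in>{1..G}. ln (tstd_dens (nu g) (gsize grp g) 0)
        - (nu g + real (gsize grp g)) / 2 * ln (1 + (\<Sum>j | grp j = g. (v $ j)\<^sup>2) / (nu g - 2)))"
    by (intro sum.cong refl ln_tstd_dens) (use nu q in auto)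
  finally show ?thesis .
qed

text \<open>With S = C^{1/2} and T = C^{-1/2} along the path, only two identities are
  differentiated, S S = C and S T = I. They identify Omega M e_k with vec(S^{-1} dS) and give the
  velocity of V.\<close>

lemma score_has_derivative:
  fixes P C :: "((real, 'n::{finite,linorder}) vec, 'n) vec" and grp :: "'n \<Rightarrow> nat"
  assumes nu: "\<forall>g\<in>{1..G}. nu g > 2" and P: "orthogonal_matrix P" and C: "is_corr C" and k: "k \<in> lowidx"
  shows "((\<lambda>t. ln (ct_density nu grp G (corr_of (vecm (matlog C) + t *\<^sub>R axis k 1)) P z))
     has_real_derivative (score nu grp G C P z $ k)) (at 0)"
proof -
  have pdC: "pos_def_mat C" using C by (simp add: is_corr_def)
  obtain L where L: "transpose L = L" and CL: "C = mexp L" using pos_def_mat_imp_mexp[OF pdC] .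
  obtain Q lam where Q: "orthogonal_matrix Q" "L = spectral Q lam"
    and Gam: "\<And>H. GammaM (mexp L) *v vecm H = vecm (dexp Q lam H)"
    using GammaM_mexp[OF L] by blast
  obtain X x where X: "(X has_vector_derivative unit_sym k + diagm x) (at 0)" "X 0 = L" "\<And>t. transpose (X t) = X t"
    and ev: "\<forall>\<^sub>F t in nhds 0. is_corr (mexp (X t)) \<and> (\<forall>i j. i \<noteq> j \<longrightarrow> X t $ i $ j = L $ i $ j + t * unit_sym k $ i $ j)"
    and diag0: "\<And>i. dexp Q lam (unit_sym k + diagm x) $ i $ i = 0"
    by (rule correlation_log_path[OF Q C[unfolded CL] transpose_unit_sym[of k]]) (rule that)
  define X' where "X' = unit_sym k + diagm x"
  define D where "D = dexp Q lam X'"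
  have MD: "Mmat C *v axis k 1 = vecm D"
    unfolding CL D_def X'_def by (rule Mmat_column[OF Q Gam k diag0])
  have Xd: "(X has_vector_derivative X') (at 0)" using X(1) by (simp add: X'_def)
  have X0: "X 0 = spectral Q lam" using X(2) Q(2) by simp
  define S where "S = (\<lambda>t. mexp ((1/2) *\<^sub>R X t))"
  define T where "T = (\<lambda>t. mexp ((-1/2) *\<^sub>R X t))"
  define S' where "S' = dexp Q ((1/2) *\<^sub>R lam) ((1/2) *\<^sub>R X')"
  define T' where "T' = dexp Q ((-1/2) *\<^sub>R lam) ((-1/2) *\<^sub>R X')"
  have Sd: "(S has_vector_derivative S') (at 0)"
    unfolding S_def S'_def by (rule mexp_has_vector_derivative[OF X(3) Xd Q(1) X0])
  have Td: "(T has_vector_derivative T') (at 0)"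
    unfolding T_def T'_def by (rule mexp_has_vector_derivative[OF X(3) Xd Q(1) X0])
  have Cd: "((\<lambda>t. mexp (X t)) has_vector_derivative D) (at 0)"
    using mexp_has_vector_derivative[OF X(3) Xd Q(1) X0, of 1] by (simp add: D_def)
  have SS: "S t ** S t = mexp (X t)" for t unfolding S_def by (rule mexp_half[OF X(3)])
  have ST: "S t ** T t = mat 1" "T t ** S t = mat 1" for t
    using mexp_scaleR_mult[OF X(3), of "1/2" t "-1/2"] mexp_scaleR_mult[OF X(3), of "-1/2" t "1/2"]
    by (simp_all add: S_def T_def mexp_0)
  \<comment> \<open>Two derivatives of the same curve S S = C; this is the Sylvester equation that
    Omega solves.\<close>
  have DS: "D = S' ** S 0 + S 0 ** S'"
    using vector_derivative_unique_at[OF Cd] has_vector_derivative_matrix_mult[OF Sd Sd] by (simp add: SS add.commute)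
  have "S 0 ** T' + S' ** T 0 = 0"
    using vector_derivative_unique_at[OF has_vector_derivative_matrix_mult[OF Sd Td]] by (simp add: ST)
  then have "T 0 ** (S 0 ** T' + S' ** T 0) = 0" by simp
  then have "(T 0 ** S 0) ** T' + T 0 ** S' ** T 0 = 0" by (simp only: matrix_add_ldistrib matrix_mul_assoc)
  then have T'eq: "T' = - (T 0 ** S' ** T 0)" by (simp add: ST add_eq_0_iff2)
  have hs: "transpose ((1/2) *\<^sub>R X t) = (1/2) *\<^sub>R X t" for t using X(3) by (simp add: transpose_scaleR)
  have S0: "S 0 = msqrt C" unfolding S_def CL X(2)[symmetric] by (rule msqrt_mexp[OF X(3), symmetric])
  have pdS: "pos_def_mat (S 0)" unfolding S_def by (rule pos_def_mexp[OF hs])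
  have T0: "matrix_inv (S 0) = T 0" by (rule matrix_inv_eqI[OF ST(1)])
  define E where "E = T 0 ** S'"
  have OE: "OmegaM C *v (Mmat C *v axis k 1) = vecm E"
    unfolding MD E_def T0[symmetric] by (rule OmegaM_mult_vecm[OF pdS S0 DS])
  define u where "u = T 0 *v z"
  define v where "v = (\<lambda>t. transpose P *v (T t *v z))"
  have v0: "v 0 = transpose P *v u" by (simp add: v_def u_def)
  let ?y = "\<lambda>g. \<Sum>j | grp j = g. v 0 $ j * (transpose P *v (E *v u)) $ j"
  have score: "score nu grp G C P z $ k
    = (\<Sum>g\<in>{1..G}. Wg nu grp (v 0) g * ?y g) - trace E"
    by (rule score_eq[OF pdC _ v0 OE]) (simp add: u_def S0[symmetric] T0)
  \<comment> \<open>Half the derivative of log det C: this matches the term trace X / 2 of the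
    log-density with the -vec(I) of the score.\<close>
  have trE: "trace E = trace X' / 2"
  proof -
    have Ts: "transpose (T 0) = T 0"
      unfolding T_def by (intro transpose_mexp) (simp only: transpose_scaleR X(3))
    have "trace E = transpose (T 0) \<bullet> S'"
      unfolding E_def inner_mat by (simp add: trace_def matrix_mult_nth transpose_nth) (rule sum.swap)
    also have "\<dots> = mexp (- (spectral Q ((1/2) *\<^sub>R lam))) \<bullet> S'"
      unfolding Ts unfolding T_def X0 scaleR_spectral[symmetric] by simp
    also have "\<dots> = trace ((1/2) *\<^sub>R X')" unfolding S'_def by (rule inner_mexp_uminus_dexp[OF Q(1)])
    also have "\<dots> = trace X' / 2" by (simp add: trace_def sum_divide_distrib)
    finally show ?thesis .
  qed
  have vd: "((\<lambda>t. v t $ j) has_real_derivative - (transpose P *v (E *v u)) $ j) (at 0)" for j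
  proof -
    have "linear (\<lambda>A::((real, 'n) vec, 'n) vec. (transpose P *v (A *v z)) $ j)"
      by (rule linearI) (simp_all add: matrix_vector_mult_add_rdistrib matrix_vector_right_distrib
          scaleR_matrix_vector_assoc[symmetric] matrix_vector_mult_scaleR)
    then have bl: "bounded_linear (\<lambda>A::((real, 'n) vec, 'n) vec. (transpose P *v (A *v z)) $ j)"
      by (simp add: linear_conv_bounded_linear)
    have "((\<lambda>t. v t $ j) has_vector_derivative (transpose P *v (T' *v z)) $ j) (at 0)"
      unfolding v_def by (rule bounded_linear.has_vector_derivative[OF bl Td])
    \<comment> \<open>From T' = -T S' T with T z = u and T S' = E.\<close>
    moreover have "T' *v z = - (E *v u)"
    proof -
      have "T' = (- 1) *\<^sub>R (T 0 ** S' ** T 0)" by (simp add: T'eq)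
      then show ?thesis unfolding E_def u_def
        by (simp only: scaleR_matrix_vector_assoc[symmetric] matrix_vector_mul_assoc) simp
    qed
    ultimately show ?thesis by (simp add: has_real_derivative_iff_has_vector_derivative matrix_vector_mult_minus)
  qed
  define q where "q = (\<lambda>g t. \<Sum>j | grp j = g. (v t $ j)\<^sup>2)"
  have qd: "((\<lambda>t. q g t) has_real_derivative - 2 * ?y g) (at 0)" for g
    unfolding q_def by (rule derivative_eq_intros vd refl)+ (simp add: sum_distrib_left sum_negf mult_ac)
  have td: "((\<lambda>t. trace (X t)) has_real_derivative trace X') (at 0)"
  proof -
    have "linear (trace :: ((real, 'n) vec, 'n) vec \<Rightarrow> real)"
      by (rule linearI) (simp_all add: trace_def sum.distrib sum_distrib_left)
    then have "bounded_linear (trace :: ((real, 'n) vec, 'n) vec \<Rightarrow> real)" by (simp add: linear_conv_bounded_linear)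
    from bounded_linear.has_vector_derivative[OF this Xd]
    show ?thesis by (simp add: has_real_derivative_iff_has_vector_derivative)
  qed
  define F where "F = (\<lambda>t. (\<Sum>g\<in>{1..G}. ln (tstd_dens (nu g) (gsize grp g) 0)
        - (nu g + real (gsize grp g)) / 2 * ln (1 + q g t / (nu g - 2))) - trace (X t) / 2)"
  have q0: "q g t \<ge> 0" for g t unfolding q_def by (intro sum_nonneg) auto
  have "(F has_real_derivative (\<Sum>g\<in>{1..G}. Wg nu grp (v 0) g * ?y g) - trace X' / 2) (at 0)"
    unfolding F_def
  proof (intro DERIV_diff DERIV_sum DERIV_cdivide td)
    fix g assume g: "g \<in> {1..G}"
    let ?F = "\<lambda>t. ln (tstd_dens (nu g) (gsize grp g) 0) - (nu g + real (gsize grp g)) / 2 * ln (1 + q g t / (nu g - 2))"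
    define y where "y = ?y g"
    have nug: "nu g - 2 > 0" using nu g by auto
    then have pos: "1 + q g 0 / (nu g - 2) > 0" using q0[of g 0] by (intro add_pos_nonneg) auto
    have qdy: "((\<lambda>t. q g t) has_real_derivative - 2 * y) (at 0)" unfolding y_def by (rule qd)
    have "((\<lambda>t. ?F t)
       has_real_derivative 0 - (nu g + real (gsize grp g)) / 2 * ((1 / (1 + q g 0 / (nu g - 2))) * (0 + (- 2 * y) / (nu g - 2)))) (at 0)"
      by (intro DERIV_diff DERIV_const DERIV_cmult DERIV_chain2[OF DERIV_ln_divide] DERIV_add DERIV_cdivide qdy pos)
    moreover have "0 - (nu g + real (gsize grp g)) / 2 * ((1 / (1 + q g 0 / (nu g - 2))) * (0 + (- 2 * y) / (nu g - 2))) = Wg nu grp (v 0) g * y"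
    proof -
      have e: "1 + q g 0 / (nu g - 2) = (nu g - 2 + q g 0) / (nu g - 2)" using nug by (simp add: add_divide_distrib)
      have "nu g - 2 + q g 0 > 0" using nug q0[of g 0] by simp
      moreover have W: "Wg nu grp (v 0) g = (nu g + real (gsize grp g)) / (nu g - 2 + q g 0)"
        by (simp add: Wg_def q_def)
      moreover have "0 - K / 2 * ((1 / (d / c)) * (0 + (- 2 * y) / c)) = K / d * y" if "c > 0" "d > 0" for K c d :: real
        using that by (simp add: field_simps)
      ultimately show ?thesis unfolding e W using nug by blast
    qed
    ultimately show "((\<lambda>t. ?F t)
       has_real_derivative Wg nu grp (v 0) g * ?y g) (at 0)"
      by (simp add: y_def)
  qed
  then have "(F has_real_derivative score nu grp G C P z $ k) (at 0)" by (simp only: score trE)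
  \<comment> \<open>The path is known to consist of correlation matrices with the prescribed gamma
    only near t = 0, which is enough for a derivative at 0.\<close>
  moreover have "\<forall>\<^sub>F t in nhds 0. ln (ct_density nu grp G (corr_of (vecm (matlog C) + t *\<^sub>R axis k 1)) P z) = F t"
    using ev
  proof eventually_elim
    case (elim t)
    have "corr_of (vecm (matlog C) + t *\<^sub>R axis k 1) = mexp (X t)"
    proof (rule corr_of_mexp[OF X(3)])
      show "is_corr (mexp (X t))" using elim by blast
      fix p :: "'n \<times> 'n" assume p: "p \<in> lowidx"
      then have "snd p \<noteq> fst p" by (auto simp: lowidx_def)
      then have "X t $ snd p $ fst p = L $ snd p $ fst p + t * unit_sym k $ snd p $ fst p" using elim by blast
      then show "vecm (X t) $ p = (vecm (matlog C) + t *\<^sub>R axis k 1) $ p"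
        unfolding unit_sym_lowidx[OF k p] CL matlog_mexp[OF L] by simp
    qed
    then show ?case
      unfolding F_def q_def v_def T_def using ln_ct_density_mexp[OF nu P X(3) refl] by simp
  qed
  ultimately show ?thesis by (rule DERIV_cong_ev[OF refl _ refl, THEN iffD2, rotated])
qed

section \<open>Linear change of variables\<close>

lemma Basis_cart: "(Basis :: (real^'n) set) = range (\<lambda>i. axis i 1)"
  by (auto simp: Basis_vec_def)

lemma prod_Basis_cart: "(\<Prod>b\<in>(Basis :: (real^'n) set). f b) = (\<Prod>i\<in>UNIV. f (axis i 1))"
  unfolding Basis_cart by (subst prod.reindex) (auto simp: inj_on_def axis_eq_axis)

lemma sum_Basis_cart: "(\<Sum>b\<in>(Basis :: (real^'n) set). f b) = (\<Sum>i\<in>UNIV. f (axis i 1))"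
  unfolding Basis_cart by (subst sum.reindex) (auto simp: inj_on_def axis_eq_axis)

text \<open>With the other coordinates fixed, the shear translates coordinate m by the constant x_n.
  Fubini and translation invariance on the line then give the claim.\<close>

lemma nn_integral_shear:
  fixes h :: "real^'n \<Rightarrow> ennreal"
  assumes mn: "m \<noteq> n" and h [measurable]: "h \<in> borel_measurable borel"
  shows "(\<integral>\<^sup>+x. h (\<chi> i. if i = m then x $ m + x $ n else x $ i) \<partial>lborel) = (\<integral>\<^sup>+x. h x \<partial>lborel)"
proof -
  define f where "f = (\<lambda>x::real^'n. (\<chi> i. if i = m then x $ m + x $ n else x $ i))"
  have fe: "f x = x + (x $ n) *\<^sub>R axis m 1" for x by (simp add: f_def vec_eq_iff axis_def)
  have [measurable]: "f \<in> borel \<rightarrow>\<^sub>M borel"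
    unfolding fe by measurable
  let ?e = "axis m 1 :: real^'n" and ?d = "axis n 1 :: real^'n"
  let ?\<Sigma> = "\<lambda>y::real^'n \<Rightarrow> real. \<Sum>b\<in>Basis. y b *\<^sub>R b"
  interpret product_sigma_finite "\<lambda>_::real^'n. lborel::real measure" ..
  have ins: "Basis = insert ?e (Basis - {?e})" by auto
  have cart: "?\<Sigma> y $ i = y (axis i 1)" for y i
    by (simp add: sum_Basis_cart axis_def if_distrib[of "\<lambda>x. _ * x"] cong: if_cong)
  have main: "(\<integral>\<^sup>+x. k x \<partial>lborel) = (\<integral>\<^sup>+y. (\<integral>\<^sup>+t. k (?\<Sigma> (y(?e := t))) \<partial>lborel) \<partial>(\<Pi>\<^sub>M b\<in>Basis - {?e}. lborel))"
    if [measurable]: "k \<in> borel_measurable borel" for k :: "real^'n \<Rightarrow> ennreal"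
  proof -
    have "(\<integral>\<^sup>+x. k x \<partial>lborel) = (\<integral>\<^sup>+y. k (?\<Sigma> y) \<partial>(\<Pi>\<^sub>M b\<in>Basis. lborel))"
      by (subst lborel_eq) (simp add: nn_integral_distr)
    also have "\<dots> = (\<integral>\<^sup>+y. k (?\<Sigma> y) \<partial>(\<Pi>\<^sub>M b\<in>insert ?e (Basis - {?e}). lborel))"
      using ins by simp
    also have "\<dots> = (\<integral>\<^sup>+y. (\<integral>\<^sup>+t. k (?\<Sigma> (y(?e := t))) \<partial>lborel) \<partial>(\<Pi>\<^sub>M b\<in>Basis - {?e}. lborel))"
    proof (rule product_nn_integral_insert)
      show "(\<lambda>y. k (?\<Sigma> y)) \<in> borel_measurable (\<Pi>\<^sub>M b\<in>insert ?e (Basis - {?e}). lborel)"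
        unfolding ins[symmetric] by measurable
    qed auto
    finally show ?thesis .
  qed
  have "(\<integral>\<^sup>+x. h (f x) \<partial>lborel) = (\<integral>\<^sup>+y. (\<integral>\<^sup>+t. h (f (?\<Sigma> (y(?e := t)))) \<partial>lborel) \<partial>(\<Pi>\<^sub>M b\<in>Basis - {?e}. lborel))"
    by (rule main) simp
  also have "\<dots> = (\<integral>\<^sup>+y. (\<integral>\<^sup>+t. h (?\<Sigma> (y(?e := t))) \<partial>lborel) \<partial>(\<Pi>\<^sub>M b\<in>Basis - {?e}. lborel))"
  proof (rule nn_integral_cong)
    fix y :: "real^'n \<Rightarrow> real"
    have "f (?\<Sigma> (y(?e := t))) = ?\<Sigma> (y(?e := y ?d + 1 * t))" for t
      unfolding f_def vec_eq_iff vec_lambda_beta cart using mn by (auto simp: axis_eq_axis)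
    moreover have "(\<lambda>t. h (?\<Sigma> (y(?e := t)))) \<in> borel_measurable borel"
    proof -
      have "?\<Sigma> (y(?e := t)) = (\<chi> i. if i = m then t else y (axis i 1))" for t
        unfolding vec_eq_iff cart by (auto simp: axis_eq_axis)
      moreover have "continuous_on UNIV (\<lambda>t. (\<chi> i. if i = m then t else y (axis i 1)) :: real^'n)"
      proof (intro continuous_on_vec_lambda)
        show "continuous_on UNIV (\<lambda>t. if i = m then t else y (axis i 1))" for i by (cases "i = m") auto
      qed
      then have [measurable]: "(\<lambda>t. (\<chi> i. if i = m then t else y (axis i 1)) :: real^'n) \<in> borel_measurable borel"
        by (rule borel_measurable_continuous_onI)
      ultimately show ?thesis by simp
    qed
    ultimately show "(\<integral>\<^sup>+t. h (f (?\<Sigma> (y(?e := t)))) \<partial>lborel) = (\<integral>\<^sup>+t. h (?\<Sigma> (y(?e := t))) \<partial>lborel)"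
      using nn_integral_real_affine[of "\<lambda>t. h (?\<Sigma> (y(?e := t)))" 1 "y ?d"] by simp
  qed
  also have "\<dots> = (\<integral>\<^sup>+x. h x \<partial>lborel)" by (rule main[symmetric]) simp
  finally show ?thesis by (simp add: f_def)
qed

text \<open>Lebesgue measure is determined by its values on boxes, and permuting coordinates maps
  boxes to boxes with the same side lengths.\<close>

lemma nn_integral_swap:
  fixes h :: "real^'n \<Rightarrow> ennreal" and m n :: 'n
  assumes h [measurable]: "h \<in> borel_measurable borel"
  shows "(\<integral>\<^sup>+x. h (\<chi> i. x $ Transposition.transpose m n i) \<partial>lborel) = (\<integral>\<^sup>+x. h x \<partial>lborel)"
proof -
  let ?\<tau> = "Transposition.transpose m n"
  define f where "f = (\<lambda>x::real^'n. (\<chi> i. x $ ?\<tau> i) :: real^'n)"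
  have "continuous_on UNIV f" unfolding f_def by (intro continuous_on_vec_lambda continuous_intros)
  then have [measurable]: "f \<in> borel_measurable borel" by (rule borel_measurable_continuous_onI)
  have bij: "bij ?\<tau>" by simp
  have "lborel = distr lborel borel f"
  proof (rule lborel_eqI)
    fix l u :: "real^'n" assume le: "\<And>b. b \<in> Basis \<Longrightarrow> l \<bullet> b \<le> u \<bullet> b"
    have le': "l $ i \<le> u $ i" for i using le[of "axis i 1"] by (simp add: inner_axis)
    have eq: "f -` box l u = box (f l) (f u)"
    proof -
      have "x \<in> f -` box l u \<longleftrightarrow> x \<in> box (f l) (f u)" for x
      proof -
        have "x \<in> f -` box l u \<longleftrightarrow> (\<forall>i. l $ i < x $ ?\<tau> i \<and> x $ ?\<tau> i < u $ i)"
          by (simp add: f_def mem_box_cart)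
        also have "\<dots> \<longleftrightarrow> (\<forall>i. l $ ?\<tau> i < x $ i \<and> x $ i < u $ ?\<tau> i)"
        proof -
          have "(\<forall>i. R i) \<longleftrightarrow> (\<forall>i. R (?\<tau> i))" for R :: "'n \<Rightarrow> bool" by (metis transpose_involutory)
          from this[of "\<lambda>i. l $ i < x $ ?\<tau> i \<and> x $ ?\<tau> i < u $ i"] show ?thesis by simp
        qed
        finally show ?thesis by (simp add: f_def mem_box_cart)
      qed
      then show ?thesis by blast
    qed
    have "emeasure (distr lborel borel f) (box l u) = emeasure lborel (box (f l) (f u))"
      by (subst emeasure_distr) (auto simp: eq)
    also have "\<dots> = (\<Prod>b\<in>Basis. (f u - f l) \<bullet> b)"
      by (rule emeasure_lborel_box) (use le' in \<open>auto simp: Basis_cart inner_axis f_def\<close>)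
    also have "(\<Prod>b\<in>Basis. (f u - f l) \<bullet> b) = (\<Prod>i\<in>UNIV. (u - l) $ ?\<tau> i)"
      by (simp add: prod_Basis_cart inner_axis f_def)
    also have "\<dots> = (\<Prod>i\<in>UNIV. (u - l) $ i)"
      using prod.reindex_bij_betw[OF bij, of "\<lambda>i. (u - l) $ i"] by simp
    also have "\<dots> = (\<Prod>b\<in>Basis. (u - l) \<bullet> b)" by (simp add: prod_Basis_cart inner_axis)
    finally show "emeasure (distr lborel borel f) (box l u) = (\<Prod>b\<in>Basis. (u - l) \<bullet> b)" .
  qed simp
  then have "(\<integral>\<^sup>+x. h x \<partial>lborel) = (\<integral>\<^sup>+x. h x \<partial>distr lborel borel f)" by simp
  also have "\<dots> = (\<integral>\<^sup>+x. h (f x) \<partial>lborel)" by (simp add: nn_integral_distr)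
  finally show ?thesis by (simp add: f_def)
qed

lemma nn_integral_stretch:
  fixes h :: "real^'n \<Rightarrow> ennreal" and c :: "'n \<Rightarrow> real"
  assumes h [measurable]: "h \<in> borel_measurable borel" and c: "\<And>i. c i \<noteq> 0"
  shows "(\<integral>\<^sup>+x. h x \<partial>lborel) = \<bar>\<Prod>i\<in>UNIV. c i\<bar> * (\<integral>\<^sup>+x. h (\<chi> i. c i * x $ i) \<partial>lborel)"
proof -
  define c' where "c' = (\<lambda>b::real^'n. \<Sum>i\<in>UNIV. c i * b $ i)"
  have c'a: "c' (axis i 1) = c i" for i
    by (simp add: c'_def axis_def if_distrib[of "\<lambda>x. _ * x"] cong: if_cong)
  define T where "T = (\<lambda>x::real^'n. 0 + (\<Sum>j\<in>Basis. (c' j * (x \<bullet> j)) *\<^sub>R j))"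
  have T: "T x = (\<chi> i. c i * x $ i)" for x
    unfolding T_def vec_eq_iff sum_Basis_cart c'a
    by (simp add: inner_axis) (simp add: axis_def if_distrib[of "\<lambda>x. _ * x"] cong: if_cong)
  have [measurable]: "T \<in> borel_measurable borel" unfolding T_def by measurable
  have "lborel = density (distr lborel borel T) (\<lambda>_. (\<Prod>j\<in>Basis. \<bar>c' j\<bar>))"
    unfolding T_def by (rule lborel_affine_euclidean) (auto simp: Basis_cart c'a c)
  also have "(\<Prod>j\<in>Basis. \<bar>c' j\<bar>) = \<bar>\<Prod>i\<in>UNIV. c i\<bar>" by (simp add: prod_Basis_cart c'a abs_prod)
  finally have eq: "lborel = density (distr lborel borel T) (\<lambda>_. ennreal \<bar>\<Prod>i\<in>UNIV. c i\<bar>)" .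
  show ?thesis
    by (subst eq) (simp add: nn_integral_density nn_integral_distr nn_integral_cmult T)
qed

lemma borel_measurable_linear: "linear f \<Longrightarrow> f \<in> borel_measurable borel" for f :: "real^'n \<Rightarrow> real^'m"
  by (intro borel_measurable_continuous_onI linear_continuous_on) (simp add: linear_conv_bounded_linear)

text \<open>Induction over products of elementary linear maps. The condition det \<noteq> 0 is put
  inside the induction predicate, which makes the degenerate generators (a coordinate identically 0)
  hold vacuously.\<close>

lemma nn_integral_linear_image:
  fixes f :: "real^'n \<Rightarrow> real^'n" and h :: "real^'n \<Rightarrow> ennreal"
  assumes "linear f" "det (matrix f) \<noteq> 0" "h \<in> borel_measurable borel"
  shows "(\<integral>\<^sup>+x. h x \<partial>lborel) = \<bar>det (matrix f)\<bar> * (\<integral>\<^sup>+x. h (f x) \<partial>lborel)"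
proof -
  have "det (matrix f) \<noteq> 0 \<longrightarrow> (\<forall>h\<in>borel_measurable borel. (\<integral>\<^sup>+x. h x \<partial>lborel) = \<bar>det (matrix f)\<bar> * (\<integral>\<^sup>+x. h (f x) \<partial>lborel))"
    (is "?P f")
  proof (rule induct_linear_elementary[of f ?P, OF assms(1)])
    fix f g :: "real^'n \<Rightarrow> real^'n"
    assume lin: "linear f" "linear g" and f: "?P f" and g: "?P g"
    have det: "det (matrix (f \<circ> g)) = det (matrix f) * det (matrix g)"
      using lin by (simp add: matrix_compose det_mul)
    note [measurable] = borel_measurable_linear[OF lin(1)] borel_measurable_linear[OF lin(2)]
    show "?P (f \<circ> g)"
    proof (intro impI ballI)
      fix h :: "real^'n \<Rightarrow> ennreal" assume [measurable]: "h \<in> borel_measurable borel" and "det (matrix (f \<circ> g)) \<noteq> 0"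
      then have nz: "det (matrix f) \<noteq> 0" "det (matrix g) \<noteq> 0" by (auto simp: det)
      have "(\<integral>\<^sup>+x. h x \<partial>lborel) = \<bar>det (matrix f)\<bar> * (\<integral>\<^sup>+x. h (f x) \<partial>lborel)"
        by (rule bspec[OF mp[OF f nz(1)]]) simp
      also have "(\<integral>\<^sup>+x. h (f x) \<partial>lborel) = \<bar>det (matrix g)\<bar> * (\<integral>\<^sup>+x. h (f (g x)) \<partial>lborel)"
        by (rule bspec[OF mp[OF g nz(2)], of "\<lambda>x. h (f x)"]) simp
      finally show "(\<integral>\<^sup>+x. h x \<partial>lborel) = \<bar>det (matrix (f \<circ> g))\<bar> * (\<integral>\<^sup>+x. h ((f \<circ> g) x) \<partial>lborel)"
        by (simp add: det abs_mult ennreal_mult mult.assoc)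
    qed
  next
    fix f :: "real^'n \<Rightarrow> real^'n" and i
    assume "linear f" "\<And>x. f x $ i = 0"
    then have "row i (matrix f) = 0" by (simp add: row_def matrix_def vec_eq_iff)
    then show "?P f" by (simp add: det_zero_row)
  next
    fix c :: "'n \<Rightarrow> real"
    have det: "det (matrix (\<lambda>x. \<chi> i. c i * x $ i)) = (\<Prod>i\<in>UNIV. c i)"
      by (subst det_diagonal) (auto simp: matrix_def axis_def)
    show "?P (\<lambda>x. \<chi> i. c i * x $ i)"
      unfolding det by (intro impI ballI nn_integral_stretch) auto
  next
    fix m n :: 'n assume "m \<noteq> n"
    let ?f = "\<lambda>x::real^'n. (\<chi> i. x $ Transposition.transpose m n i) :: real^'n"
    have lin: "linear ?f" by (rule linearI) (auto simp: vec_eq_iff)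
    have "?f \<circ> ?f = id" by (auto simp: fun_eq_iff vec_eq_iff)
    then have "matrix ?f ** matrix ?f = mat 1"
      using matrix_compose[OF lin lin] by (simp add: matrix_id_mat_1)
    then have "det (matrix ?f) * det (matrix ?f) = 1"
      by (metis det_mul det_I)
    then have "\<bar>det (matrix ?f)\<bar> = 1" by (simp add: power2_eq_square abs_square_eq_1[symmetric])
    then show "?P ?f" using nn_integral_swap[of _ m n] by simp
  next
    fix m n :: 'n assume mn: "m \<noteq> n"
    let ?f = "\<lambda>x::real^'n. (\<chi> i. if i = m then x $ m + x $ n else x $ i) :: real^'n"
    have "matrix ?f = (\<chi> k. if k = m then row m (mat 1) + 1 *s row n (mat 1) else row k (mat 1))"
      by (auto simp: matrix_def vec_eq_iff row_def mat_def axis_def)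
    then have "det (matrix ?f) = 1" using det_row_operation[OF mn, of "mat 1" 1] by simp
    then show "?P ?f" using nn_integral_shear[OF mn] by simp
  qed
  then show ?thesis using assms by blast
qed

lemma lborel_eq_density_distr_linear:
  fixes f :: "real^'n \<Rightarrow> real^'n"
  assumes "linear f" "det (matrix f) \<noteq> 0"
  shows "lborel = density (distr lborel borel f) (\<lambda>_. ennreal \<bar>det (matrix f)\<bar>)"
proof (rule measure_eqI)
  have [measurable]: "f \<in> borel_measurable borel"
    using assms(1) by (rule borel_measurable_linear)
  fix A :: "(real^'n) set" assume "A \<in> sets lborel"
  then have [measurable]: "A \<in> sets borel" by simp
  have "emeasure lborel A = (\<integral>\<^sup>+x. indicator A x \<partial>lborel)" by simp
  also have "\<dots> = \<bar>det (matrix f)\<bar> * (\<integral>\<^sup>+x. indicator A (f x) \<partial>lborel)"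
    by (rule nn_integral_linear_image[OF assms]) simp
  also have "\<dots> = (\<integral>\<^sup>+x. ennreal \<bar>det (matrix f)\<bar> * indicator A x \<partial>distr lborel borel f)"
    by (subst nn_integral_distr) (simp_all add: nn_integral_cmult del: nn_integral_indicator)
  also have "\<dots> = emeasure (density (distr lborel borel f) (\<lambda>_. ennreal \<bar>det (matrix f)\<bar>)) A"
    by (subst emeasure_density) auto
  finally show "emeasure lborel A = emeasure (density (distr lborel borel f) (\<lambda>_. ennreal \<bar>det (matrix f)\<bar>)) A" .
qed simp

lemma has_bochner_integral_linear_image:
  fixes f :: "real^'n \<Rightarrow> real^'n" and h :: "real^'n \<Rightarrow> real"
  assumes "linear f" "det (matrix f) \<noteq> 0" "h \<in> borel_measurable borel"
    and "has_bochner_integral lborel (\<lambda>x. \<bar>det (matrix f)\<bar> * h (f x)) I"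
  shows "has_bochner_integral lborel h I"
proof -
  have [measurable]: "f \<in> borel_measurable borel"
    using assms(1) by (rule borel_measurable_linear)
  note [measurable] = assms(3)
  show ?thesis
    by (subst lborel_eq_density_distr_linear[OF assms(1,2)], rule has_bochner_integral_density,
        simp, simp, simp, rule has_bochner_integral_distr) (use assms(4) in simp_all)
qed

section \<open>Gamma mixtures of Gaussians\<close>

text \<open>Gamma(k + 1/2) / Gamma(1/2), the moment of order 2k of a centered normal variable with
  variance 1/2; this matches the kernel exp(-x^2).\<close>

definition gauss_mom :: "nat \<Rightarrow> real" where
  "gauss_mom k = fact (2 * k) / (2 ^ (2 * k) * fact k)"

lemma gauss_mom_pos: "gauss_mom k > 0"
  by (simp add: gauss_mom_def)

lemma nn_integral_gaussian_moment:
  fixes s :: real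
  assumes s: "s > 0"
  shows "(\<integral>\<^sup>+x. ennreal (exp (- (s * x\<^sup>2)) * x ^ (2 * k)) \<partial>lborel)
    = ennreal (sqrt pi * gauss_mom k * s powr (- (real k + 1/2)))"
proof -
  let ?J = "\<integral>\<^sup>+x. ennreal (exp (- (s * x\<^sup>2)) * x ^ (2 * k)) \<partial>lborel"
  define f where "f = (\<lambda>x::real. exp (- x\<^sup>2) * x ^ (2 * k))"
  have fnn: "f x \<ge> 0" for x by (simp add: f_def)
  have [measurable]: "f \<in> borel_measurable borel" unfolding f_def by measurable
  have "has_bochner_integral lborel f (sqrt pi * gauss_mom k)"
    unfolding f_def gauss_mom_def using has_bochner_integral_even_function[OF gaussian_moment_even_pos[where k=k]] by simp
  then have V: "(\<integral>\<^sup>+x. ennreal (f x) \<partial>lborel) = ennreal (sqrt pi * gauss_mom k)"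
    using fnn by (simp add: has_bochner_integral_iff nn_integral_eq_integral)
  define w where "w = s powr (real k + 1/2)"
  have w: "w > 0" using s by (simp add: w_def)
  have weq: "w = sqrt s * s ^ k" using s by (simp add: w_def powr_add powr_half_sqrt powr_realpow)
  have sc: "f (0 + sqrt s * x) = s ^ k * (exp (- (s * x\<^sup>2)) * x ^ (2 * k))" for x
    using s by (simp add: f_def power_mult_distrib power_mult)
  have "ennreal (sqrt pi * gauss_mom k) = ennreal \<bar>sqrt s\<bar> * (\<integral>\<^sup>+x. ennreal (f (0 + sqrt s * x)) \<partial>lborel)"
    unfolding V[symmetric] by (rule nn_integral_real_affine) (use s in auto)
  also have "(\<integral>\<^sup>+x. ennreal (f (0 + sqrt s * x)) \<partial>lborel) = ennreal (s ^ k) * ?J"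
    unfolding sc using s by (subst nn_integral_cmult[symmetric]) (auto simp: ennreal_mult)
  also have "ennreal \<bar>sqrt s\<bar> * (ennreal (s ^ k) * ?J)
     = ennreal w * ?J"
    using s unfolding weq by (simp add: ennreal_mult mult.assoc)
  finally have *: "ennreal w * ?J = ennreal (sqrt pi * gauss_mom k)" by simp
  have "?J
     = ennreal (1 / w) * (ennreal w * ?J)"
    using w by (simp add: mult.assoc[symmetric] ennreal_mult[symmetric])
  also have "\<dots> = ennreal (1 / w * (sqrt pi * gauss_mom k))"
    unfolding * using w gauss_mom_pos[of k] by (intro ennreal_mult[symmetric]) auto
  also have "1 / w * (sqrt pi * gauss_mom k) = sqrt pi * gauss_mom k * s powr (- (real k + 1/2))"
  proof -
    have "s powr (- (real k + 1/2)) = 1 / w" by (simp only: w_def powr_minus_divide)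
    then show ?thesis by simp
  qed
  finally show ?thesis .
qed

definition gamma_ker :: "real \<Rightarrow> real \<Rightarrow> real" where
  "gamma_ker a t = indicator {0..} t * t powr (a - 1) * exp (- t)"

lemma gamma_ker_nonneg: "gamma_ker a t \<ge> 0"
  by (simp add: gamma_ker_def)

lemma measurable_gamma_ker [measurable]: "gamma_ker a \<in> borel_measurable borel"
  unfolding gamma_ker_def by measurable

lemma nn_integral_gamma_ker:
  assumes "a > 0"
  shows "(\<integral>\<^sup>+t. ennreal (gamma_ker a t) \<partial>lborel) = ennreal (Gamma a)"
  using Gamma_conv_nn_integral_real[OF assms] by (simp add: gamma_ker_def exp_minus divide_inverse)

text \<open>Substitute (1 + y) t in the Gamma integral. With y proportional to V_g'V_g the
  exponential factors over coordinates, which the power itself does not.\<close>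

lemma powr_minus_gamma_mixture:
  assumes a: "a > 0" and y: "y \<ge> 0"
  shows "ennreal ((1 + y) powr (- a)) = (\<integral>\<^sup>+t. ennreal (gamma_ker a t / Gamma a) * ennreal (exp (- (t * y))) \<partial>lborel)"
proof -
  have G: "Gamma a > 0" using a by (rule Gamma_real_pos)
  define b where "b = 1 + y"
  have b: "b > 0" using y by (simp add: b_def)
  define J where "J = (\<integral>\<^sup>+t. ennreal (gamma_ker a t / Gamma a) * ennreal (exp (- (t * y))) \<partial>lborel)"
  have "ennreal (Gamma a) = ennreal \<bar>b\<bar> * (\<integral>\<^sup>+t. ennreal (gamma_ker a (0 + b * t)) \<partial>lborel)"
    unfolding nn_integral_gamma_ker[OF a, symmetric] by (rule nn_integral_real_affine) (use b in auto)
  also have "(\<integral>\<^sup>+t. ennreal (gamma_ker a (0 + b * t)) \<partial>lborel) = (\<integral>\<^sup>+t. ennreal (b powr (a - 1) * Gamma a) * (ennreal (gamma_ker a t / Gamma a) * ennreal (exp (- (t * y)))) \<partial>lborel)"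
  proof (intro nn_integral_cong, goal_cases)
    case (1 t)
    have "gamma_ker a (0 + b * t) = (b powr (a - 1) * Gamma a) * ((gamma_ker a t / Gamma a) * exp (- (t * y)))"
    proof (cases "t \<ge> 0")
      case True
      have "exp (- (b * t)) = exp (- t) * exp (- (t * y))" by (simp add: b_def exp_add[symmetric] algebra_simps)
      then show ?thesis using True b G by (simp add: gamma_ker_def powr_mult)
    next
      case False
      then have "b * t < 0" using b by (simp add: mult_pos_neg)
      then show ?thesis using False by (simp add: gamma_ker_def)
    qed
    then show ?case
      using G gamma_ker_nonneg[of a t] by (simp add: ennreal_mult[symmetric])
  qed
  also have "\<dots> = ennreal (b powr (a - 1) * Gamma a) * J"
    unfolding J_def by (rule nn_integral_cmult) measurable
  finally have "ennreal (Gamma a) = ennreal (b * (b powr (a - 1) * Gamma a)) * J"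
    using b G by (simp add: ennreal_mult mult.assoc)
  also have "b * (b powr (a - 1) * Gamma a) = b powr a * Gamma a" using b by (simp add: powr_diff)
  finally have eq: "ennreal (Gamma a) = ennreal (b powr a * Gamma a) * J" .
  have "J = ennreal (1 / (b powr a * Gamma a)) * (ennreal (b powr a * Gamma a) * J)"
    using b G by (simp add: mult.assoc[symmetric] ennreal_mult[symmetric])
  also have "\<dots> = ennreal (1 / (b powr a * Gamma a) * Gamma a)"
    unfolding eq[symmetric] using b G by (intro ennreal_mult[symmetric]) auto
  also have "1 / (b powr a * Gamma a) * Gamma a = b powr (- a)" using b G by (simp add: powr_minus divide_inverse)
  finally show ?thesis by (simp add: J_def b_def)
qed

lemma prod_group_split:
  fixes X Y :: "'n::finite \<Rightarrow> real"
  assumes "g \<notin> T"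
  shows "(\<Prod>j\<in>UNIV. if grp j \<in> T then 1 else if grp j = g then X j else Y j)
    = (\<Prod>j | grp j = g. X j) * (\<Prod>j\<in>UNIV. if grp j \<in> insert g T then 1 else Y j)"
proof -
  have "(\<Prod>j\<in>UNIV. if grp j \<in> T then 1 else if grp j = g then X j else Y j)
     = (\<Prod>j\<in>UNIV. (if grp j = g then X j else 1) * (if grp j \<in> insert g T then 1 else Y j))"
    by (intro prod.cong) (use assms in auto)
  also have "\<dots> = (\<Prod>j\<in>UNIV. if grp j = g then X j else 1) * (\<Prod>j\<in>UNIV. if grp j \<in> insert g T then 1 else Y j)"
    by (rule prod.distrib)
  also have "(\<Prod>j\<in>UNIV. if grp j = g then X j else 1) = (\<Prod>j | grp j = g. X j)"
    by (simp add: prod.If_cases)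
  finally show ?thesis .
qed

lemma nn_integral_gaussian_product:
  fixes s :: "'n::finite \<Rightarrow> real"
  assumes s: "\<And>j. s j > 0"
  shows "(\<integral>\<^sup>+(v::real^'n). ennreal (\<Prod>j\<in>UNIV. exp (- (s j * (v $ j)\<^sup>2)) * (v $ j) ^ (2 * k j)) \<partial>lborel)
    = ennreal (\<Prod>j\<in>UNIV. sqrt pi * gauss_mom (k j) * s j powr (- (real (k j) + 1/2)))"
proof -
  define f where "f = (\<lambda>j x::real. exp (- (s j * x\<^sup>2)) * x ^ (2 * k j))"
  have fnn: "f j x \<ge> 0" for j x by (simp add: f_def)
  define F where "F = (\<lambda>(b::real^'n) x. ennreal (f (axis_index b) x))"
  have [measurable]: "f j \<in> borel_measurable borel" for j unfolding f_def by measurable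
  have "(\<integral>\<^sup>+(v::real^'n). ennreal (\<Prod>j\<in>UNIV. f j (v $ j)) \<partial>lborel) = (\<integral>\<^sup>+v. (\<Prod>b\<in>Basis. F b (v \<bullet> b)) \<partial>lborel)"
    unfolding F_def prod_Basis_cart using fnn by (simp add: prod_ennreal inner_axis)
  also have "\<dots> = (\<Prod>b\<in>Basis. (\<integral>\<^sup>+x. F b x \<partial>lborel))"
    by (rule nn_integral_lborel_prod) (auto simp: F_def)
  also have "\<dots> = (\<Prod>j\<in>UNIV. ennreal (sqrt pi * gauss_mom (k j) * s j powr (- (real (k j) + 1/2))))"
    unfolding prod_Basis_cart F_def axis_index_axis f_def using s by (simp add: nn_integral_gaussian_moment)
  also have "\<dots> = ennreal (\<Prod>j\<in>UNIV. sqrt pi * gauss_mom (k j) * s j powr (- (real (k j) + 1/2)))"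
    using gauss_mom_pos by (intro prod_ennreal) (simp add: less_imp_le)
  finally show ?thesis by (simp add: f_def)
qed

text \<open>Induction over the set T of groups carrying a power factor, while coordinates in all
  other groups carry Gaussian factors of arbitrary rate s. Adding g to T writes its power as a Gamma
  mixture; for fixed t this is a Gaussian of rate t / c g, covered by the induction hypothesis for
  another s. Integrating t powr (a g - kap g - 1) exp(-t) over t produces Gamma (a g - kap g),
  whence the condition a g > kap g.\<close>

lemma nn_integral_group_moment_aux:
  fixes grp :: "'n::finite \<Rightarrow> nat" and k :: "'n \<Rightarrow> nat" and a c s :: "nat \<Rightarrow> real"
  defines "kap \<equiv> \<lambda>g. \<Sum>j | grp j = g. real (k j) + 1/2"
    and "m \<equiv> \<lambda>j. sqrt pi * gauss_mom (k j)"
  assumes "finite T" "\<And>g. g \<in> T \<Longrightarrow> c g > 0" "\<And>g. g \<in> T \<Longrightarrow> a g > kap g" "\<And>g. s g > 0"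
  shows "(\<integral>\<^sup>+(v::real^'n). ennreal ((\<Prod>g\<in>T. (1 + (\<Sum>j | grp j = g. (v $ j)\<^sup>2) / c g) powr (- a g))
      * (\<Prod>j\<in>UNIV. if grp j \<in> T then 1 else exp (- (s (grp j) * (v $ j)\<^sup>2))) * (\<Prod>j\<in>UNIV. (v $ j) ^ (2 * k j))) \<partial>lborel)
    = ennreal ((\<Prod>g\<in>T. Gamma (a g - kap g) / Gamma (a g) * c g powr kap g * (\<Prod>j | grp j = g. m j))
      * (\<Prod>j\<in>UNIV. if grp j \<in> T then 1 else m j * s (grp j) powr (- (real (k j) + 1/2))))"
  using assms(3-6)
proof (induction T arbitrary: s rule: finite_induct)
  case empty
  then show ?case using nn_integral_gaussian_product[of "\<lambda>j. s (grp j)" k]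
    by (simp add: prod.distrib m_def)
next
  case (insert g T)
  define Pr where "Pr = (\<lambda>v::real^'n. (\<Prod>g\<in>T. (1 + (\<Sum>j | grp j = g. (v $ j)\<^sup>2) / c g) powr (- a g)) * (\<Prod>j\<in>UNIV. (v $ j) ^ (2 * k j)))"
  define A where "A = (\<Prod>g\<in>T. Gamma (a g - kap g) / Gamma (a g) * c g powr kap g * (\<Prod>j | grp j = g. m j))"
  define Ex where "Ex = (\<lambda>v::real^'n. \<Prod>j\<in>UNIV. if grp j \<in> insert g T then 1 else exp (- (s (grp j) * (v $ j)\<^sup>2)))"
  define S where "S = (\<Prod>j\<in>UNIV. if grp j \<in> insert g T then 1 else m j * s (grp j) powr (- (real (k j) + 1/2)))"
  define M where "M = (\<Prod>j | grp j = g. m j)"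
  define q where "q = (\<lambda>v::real^'n. (\<Sum>j | grp j = g. (v $ j)\<^sup>2) / c g)"
  let ?L = "\<lambda>v. \<Prod>g\<in>insert g T. (1 + (\<Sum>j | grp j = g. (v $ j)\<^sup>2) / c g) powr (- a g)"
  let ?A = "A * S * M * c g powr kap g"
  let ?K = "\<lambda>t v. ennreal (gamma_ker (a g) t / Gamma (a g)) * ennreal (Pr v * Ex v * exp (- (t * q v)))"
  have cg: "c g > 0" and ag: "a g > kap g" using insert.prems by auto
  have kap0: "kap g \<ge> 0" for g unfolding kap_def by (intro sum_nonneg) auto
  have ag0: "a g > 0" using ag kap0[of g] by linarith
  have G: "Gamma (a g) > 0" using ag0 by (rule Gamma_real_pos)
  have m0: "m j \<ge> 0" for j unfolding m_def using gauss_mom_pos[of "k j"] by simp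
  have q0: "q v \<ge> 0" for v unfolding q_def using cg by (intro divide_nonneg_pos sum_nonneg) auto
  have Pr0: "Pr v \<ge> 0" for v unfolding Pr_def by (intro mult_nonneg_nonneg prod_nonneg) auto
  have Ex0: "Ex v \<ge> 0" for v unfolding Ex_def by (intro prod_nonneg) auto
  have S0: "S \<ge> 0" unfolding S_def using m0 by (intro prod_nonneg) auto
  have M0: "M \<ge> 0" unfolding M_def using m0 by (intro prod_nonneg) auto
  have A0: "A \<ge> 0" unfolding A_def using m0 kap0 insert.prems(2)
    by (intro prod_nonneg mult_nonneg_nonneg divide_nonneg_nonneg)
       (auto intro!: prod_nonneg less_imp_le[OF Gamma_real_pos] intro: le_less_trans)
  have [measurable]: "Pr \<in> borel_measurable borel" "Ex \<in> borel_measurable borel" "q \<in> borel_measurable borel"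
    unfolding Pr_def Ex_def q_def by measurable
  have IH: "(\<integral>\<^sup>+v. ennreal (Pr v * Ex v * exp (- (t * q v))) \<partial>lborel)
      = ennreal (?A * t powr (- kap g))" if t: "t > 0" for t
  proof -
    \<comment> \<open>The mixing variable t becomes the Gaussian rate of group g, which is outside
      T, so the hypothesis for T applies.\<close>
    define s' where "s' = s(g := t / c g)"
    have s': "s' h > 0" for h using insert.prems(3) t cg by (simp add: s'_def)
    have e1: "(\<Prod>j\<in>UNIV. if grp j \<in> T then 1 else exp (- (s' (grp j) * (v $ j)\<^sup>2))) = exp (- (t * q v)) * Ex v" for v :: "real^'n"
    proof -
      have "(\<Prod>j\<in>UNIV. if grp j \<in> T then 1 else exp (- (s' (grp j) * (v $ j)\<^sup>2)))
         = (\<Prod>j\<in>UNIV. if grp j \<in> T then 1 else if grp j = g then exp (- (t / c g * (v $ j)\<^sup>2)) else exp (- (s (grp j) * (v $ j)\<^sup>2)))"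
        by (intro prod.cong) (auto simp: s'_def)
      also have "\<dots> = (\<Prod>j | grp j = g. exp (- (t / c g * (v $ j)\<^sup>2))) * Ex v"
        unfolding Ex_def by (rule prod_group_split[OF insert.hyps(2)])
      also have "(\<Prod>j | grp j = g. exp (- (t / c g * (v $ j)\<^sup>2))) = exp (- (t * q v))"
        by (simp add: exp_sum[symmetric] q_def sum_negf sum_distrib_left sum_divide_distrib)
      finally show ?thesis .
    qed
    have e2: "(\<Prod>j\<in>UNIV. if grp j \<in> T then 1 else m j * s' (grp j) powr (- (real (k j) + 1/2))) = M * c g powr kap g * t powr (- kap g) * S"
    proof -
      have "(\<Prod>j\<in>UNIV. if grp j \<in> T then 1 else m j * s' (grp j) powr (- (real (k j) + 1/2)))
         = (\<Prod>j\<in>UNIV. if grp j \<in> T then 1 else if grp j = g then m j * (t / c g) powr (- (real (k j) + 1/2)) else m j * s (grp j) powr (- (real (k j) + 1/2)))"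
        by (intro prod.cong) (auto simp: s'_def)
      also have "\<dots> = (\<Prod>j | grp j = g. m j * (t / c g) powr (- (real (k j) + 1/2))) * S"
        unfolding S_def by (rule prod_group_split[OF insert.hyps(2)])
      also have "(\<Prod>j | grp j = g. m j * (t / c g) powr (- (real (k j) + 1/2))) = M * (\<Prod>j | grp j = g. (t / c g) powr (- (real (k j) + 1/2)))"
        unfolding M_def by (rule prod.distrib)
      also have "(\<Prod>j | grp j = g. (t / c g) powr (- (real (k j) + 1/2))) = (t / c g) powr (- kap g)"
      proof -
        have "(t / c g) powr (- kap g) = (t / c g) powr (\<Sum>j | grp j = g. - (real (k j) + 1/2))"
          by (simp only: kap_def sum_negf)
        also have "\<dots> = (\<Prod>j | grp j = g. (t / c g) powr (- (real (k j) + 1/2)))"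
          by (rule powr_sum) (use t cg in auto)
        finally show ?thesis ..
      qed
      also have "(t / c g) powr (- kap g) = c g powr kap g * t powr (- kap g)"
        using t cg by (simp add: powr_divide powr_minus_divide)
      finally show ?thesis by (simp add: mult_ac)
    qed
    have "(\<integral>\<^sup>+v. ennreal (Pr v * Ex v * exp (- (t * q v))) \<partial>lborel)
      = (\<integral>\<^sup>+(v::real^'n). ennreal ((\<Prod>g\<in>T. (1 + (\<Sum>j | grp j = g. (v $ j)\<^sup>2) / c g) powr (- a g))
      * (\<Prod>j\<in>UNIV. if grp j \<in> T then 1 else exp (- (s' (grp j) * (v $ j)\<^sup>2))) * (\<Prod>j\<in>UNIV. (v $ j) ^ (2 * k j))) \<partial>lborel)"
      unfolding e1 Pr_def by (simp only: mult_ac)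
    also have "\<dots> = ennreal (A * (\<Prod>j\<in>UNIV. if grp j \<in> T then 1 else m j * s' (grp j) powr (- (real (k j) + 1/2))))"
      unfolding A_def by (rule insert.IH) (use insert.prems s' in auto)
    finally show ?thesis unfolding e2 by (simp add: mult_ac)
  qed
  have "(\<integral>\<^sup>+(v::real^'n). ennreal (?L v
      * (\<Prod>j\<in>UNIV. if grp j \<in> insert g T then 1 else exp (- (s (grp j) * (v $ j)\<^sup>2))) * (\<Prod>j\<in>UNIV. (v $ j) ^ (2 * k j))) \<partial>lborel)
     = (\<integral>\<^sup>+v. ennreal (Pr v * Ex v) * ennreal ((1 + q v) powr (- a g)) \<partial>lborel)"
  proof (intro nn_integral_cong, goal_cases)
    case (1 v)
    have eq: "?L v * Ex v * (\<Prod>j\<in>UNIV. (v $ j) ^ (2 * k j))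
        = (Pr v * Ex v) * (1 + q v) powr (- a g)"
      unfolding prod.insert[OF insert.hyps(1,2)] Pr_def q_def by (simp only: mult_ac)
    show ?case
      unfolding fun_cong[OF Ex_def, of v, symmetric] eq using Pr0[of v] Ex0[of v] by (intro ennreal_mult) auto
  qed
  also have "\<dots> = (\<integral>\<^sup>+v. (\<integral>\<^sup>+t. ?K t v \<partial>lborel) \<partial>lborel)"
  proof (intro nn_integral_cong, goal_cases)
    case (1 v)
    have "ennreal (Pr v * Ex v) * ennreal ((1 + q v) powr (- a g))
       = (\<integral>\<^sup>+t. ennreal (Pr v * Ex v) * (ennreal (gamma_ker (a g) t / Gamma (a g)) * ennreal (exp (- (t * q v)))) \<partial>lborel)"
      unfolding powr_minus_gamma_mixture[OF ag0 q0] by (rule nn_integral_cmult[symmetric]) measurable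
    also have "\<dots> = (\<integral>\<^sup>+t. ?K t v \<partial>lborel)"
      using Pr0[of v] Ex0[of v] by (intro nn_integral_cong) (simp add: ennreal_mult mult_ac)
    finally show ?case .
  qed
  also have "\<dots> = (\<integral>\<^sup>+t. (\<integral>\<^sup>+v. ?K t v \<partial>lborel) \<partial>lborel)"
    by (rule lborel_pair.Fubini') measurable
  also have "\<dots> = (\<integral>\<^sup>+t. ennreal (?A / Gamma (a g)) * ennreal (gamma_ker (a g - kap g) t) \<partial>lborel)"
  proof (intro nn_integral_cong, goal_cases)
    case (1 t)
    have "(\<integral>\<^sup>+v. ?K t v \<partial>lborel)
       = ennreal (gamma_ker (a g) t / Gamma (a g)) * (\<integral>\<^sup>+v. ennreal (Pr v * Ex v * exp (- (t * q v))) \<partial>lborel)"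
      by (rule nn_integral_cmult) measurable
    also have "\<dots> = ennreal (?A / Gamma (a g)) * ennreal (gamma_ker (a g - kap g) t)"
    proof (cases "t > 0")
      case True
      have "gamma_ker (a g) t / Gamma (a g) * (?A * t powr (- kap g))
         = ?A / Gamma (a g) * gamma_ker (a g - kap g) t"
      proof -
        have "t powr (a g - 1) * t powr (- kap g) = t powr (a g - kap g - 1)"
          by (simp add: powr_add[symmetric] algebra_simps)
        then show ?thesis using True by (simp add: gamma_ker_def mult_ac)
      qed
      then show ?thesis unfolding IH[OF True] using gamma_ker_nonneg A0 S0 M0 G
        by (simp add: ennreal_mult[symmetric])
    next
      case False
      \<comment> \<open>At t = 0 this relies on \<open>0 powr x = 0\<close>; below 0 the indicator
        vanishes.\<close>
      then have "gamma_ker b t = 0" for b by (cases "t = 0") (auto simp: gamma_ker_def)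
      then show ?thesis by simp
    qed
    finally show ?case .
  qed
  also have "\<dots> = ennreal (?A / Gamma (a g)) * ennreal (Gamma (a g - kap g))"
    using ag by (subst nn_integral_cmult) (auto simp: nn_integral_gamma_ker)
  also have "\<dots> = ennreal ((\<Prod>g\<in>insert g T. Gamma (a g - kap g) / Gamma (a g) * c g powr kap g * (\<Prod>j | grp j = g. m j)) * S)"
  proof -
    have "(\<Prod>g\<in>insert g T. Gamma (a g - kap g) / Gamma (a g) * c g powr kap g * (\<Prod>j | grp j = g. m j)) * S
        = ?A / Gamma (a g) * Gamma (a g - kap g)"
      unfolding prod.insert[OF insert.hyps(1,2)] A_def M_def by (simp add: mult_ac)
    then show ?thesis using A0 S0 M0 G ag by (simp add: ennreal_mult[symmetric] less_imp_le[OF Gamma_real_pos])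
  qed
  finally show ?case unfolding S_def .
qed

section \<open>Moments of independent t blocks\<close>

definition tdens :: "(nat \<Rightarrow> real) \<Rightarrow> ('n::finite \<Rightarrow> nat) \<Rightarrow> nat \<Rightarrow> real^'n \<Rightarrow> real" where
  "tdens nu grp G v = (\<Prod>g\<in>{1..G}. tstd_dens (nu g) (gsize grp g) (\<Sum>j | grp j = g. (v $ j)\<^sup>2))"

lemma measurable_tdens [measurable]: "tdens nu grp G \<in> borel_measurable borel"
  unfolding tdens_def tstd_dens_def by measurable

lemma measurable_Wg [measurable]: "(\<lambda>v. Wg nu grp v g) \<in> borel_measurable borel"
  unfolding Wg_def by measurable

lemma tdens_nonneg:
  assumes "\<forall>g\<in>{1..G}. nu g > 2"
  shows "tdens nu grp G v \<ge> 0"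
  unfolding tdens_def tstd_dens_def
  by (intro prod_nonneg ballI mult_nonneg_nonneg divide_nonneg_nonneg less_imp_le[OF Gamma_real_pos]) (use assms in force)+

text \<open>The factor contributed by a group of size \<open>m\<close> to a moment of total order \<open>2K\<close> weighted by the
  \<open>r\<close>-th power of its \<open>W\<close>, up to the Gaussian moments of its coordinates.\<close>
definition tmom :: "real \<Rightarrow> nat \<Rightarrow> nat \<Rightarrow> nat \<Rightarrow> real" where
  "tmom nu m r K = (nu + real m) ^ r * (nu - 2) powr (real K - real r) * (Gamma (nu / 2 + real r - real K) / Gamma (nu / 2))
     * (Gamma ((nu + real m) / 2) / Gamma ((nu + real m) / 2 + real r))"

text \<open>W is a constant divided by 1 + q / (nu - 2), so the weight W^r only raises the decay
  exponent by r. Weighted moments therefore have the same form as plain ones and exist under weaker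
  conditions.\<close>

lemma tstd_dens_mult_W_power:
  assumes nu: "nu > 2" and q: "q \<ge> 0"
  shows "tstd_dens nu m q * ((nu + real m) / (nu - 2 + q)) ^ r
    = Gamma ((nu + real m) / 2) / Gamma (nu / 2) * ((nu - 2) * pi) powr (- real m / 2) * ((nu + real m) / (nu - 2)) ^ r
      * (1 + q / (nu - 2)) powr (- ((nu + real m) / 2 + real r))"
proof -
  define c where "c = nu - 2"
  have c: "c > 0" using nu by (simp add: c_def)
  have y: "1 + q / c > 0" using c q by (intro add_pos_nonneg) auto
  have "(nu + real m) / (c + q) = (nu + real m) / c / (1 + q / c)"
  proof -
    have "c + q = c * (1 + q / c)" using c by (simp add: distrib_left)
    then show ?thesis by (simp only: divide_divide_eq_left)
  qed
  then have "((nu + real m) / (c + q)) ^ r = ((nu + real m) / c) ^ r * (1 + q / c) powr (- real r)"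
    using powr_realpow[OF y, of r] by (simp only: power_divide powr_minus_divide) simp
  moreover have "(1 + q / c) powr (- ((nu + real m) / 2 + real r)) = (1 + q / c) powr (- (nu + real m) / 2) * (1 + q / c) powr (- real r)"
  proof -
    have "- ((nu + real m) / 2 + real r) = - (nu + real m) / 2 + - real r" by (simp add: diff_divide_distrib add_divide_distrib)
    then show ?thesis by (simp only: powr_add)
  qed
  ultimately show ?thesis unfolding tstd_dens_def c_def[symmetric] by (simp only: mult_ac)
qed

text \<open>The hypothesis \<open>cond\<close> is a g > kap g for a g = (nu + m)/2 + r and kap g = K
  + m/2, where 2K is the total order in group g: the size m of the group cancels.\<close>

lemma tmoment:
  fixes grp :: "'n::finite \<Rightarrow> nat" and k :: "'n \<Rightarrow> nat" and r :: "nat \<Rightarrow> nat"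
  assumes grp: "range grp = {1..G}" and nu: "\<forall>g\<in>{1..G}. nu g > 2"
    and cond: "\<And>g. g \<in> {1..G} \<Longrightarrow> nu g / 2 + real (r g) > real (\<Sum>j | grp j = g. k j)"
  shows "has_bochner_integral lborel
    (\<lambda>v. tdens nu grp G v * ((\<Prod>g\<in>{1..G}. Wg nu grp v g ^ r g) * (\<Prod>j\<in>UNIV. (v $ j) ^ (2 * k j))))
    (\<Prod>g\<in>{1..G}. tmom (nu g) (gsize grp g) (r g) (\<Sum>j | grp j = g. k j) * (\<Prod>j | grp j = g. gauss_mom (k j)))"
    (is "has_bochner_integral lborel ?F ?I")
proof -
  define q where "q = (\<lambda>(v::real^'n) g. \<Sum>j | grp j = g. (v $ j)\<^sup>2)"
  define c where "c = (\<lambda>g. nu g - 2)"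
  define m where "m = gsize grp"
  define K where "K = (\<lambda>g. \<Sum>j | grp j = g. k j)"
  define a where "a = (\<lambda>g. (nu g + real (m g)) / 2 + real (r g))"
  define kap where "kap = (\<lambda>g. \<Sum>j | grp j = g. real (k j) + 1/2)"
  define N where "N = (\<lambda>g. Gamma ((nu g + real (m g)) / 2) / Gamma (nu g / 2) * ((nu g - 2) * pi) powr (- real (m g) / 2) * ((nu g + real (m g)) / (nu g - 2)) ^ r g)"
  let ?t = "\<lambda>g. Gamma (a g - kap g) / Gamma (a g) * c g powr kap g * (\<Prod>j | grp j = g. sqrt pi * gauss_mom (k j))"
  let ?Q = "\<lambda>v. (\<Prod>g\<in>{1..G}. (1 + q v g / c g) powr (- a g)) * (\<Prod>j\<in>UNIV. (v $ j) ^ (2 * k j))"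
  have kap: "kap g = real (K g) + real (m g) / 2" for g
    by (simp add: kap_def K_def m_def gsize_def sum.distrib)
  have q0: "q v g \<ge> 0" for v g unfolding q_def by (intro sum_nonneg) auto
  have N0: "N g \<ge> 0" if "g \<in> {1..G}" for g
  proof -
    have "nu g > 2" using nu that by blast
    then show ?thesis unfolding N_def
      by (intro mult_nonneg_nonneg divide_nonneg_nonneg less_imp_le[OF Gamma_real_pos] zero_le_power) auto
  qed
  have Feq: "?F v = (\<Prod>g\<in>{1..G}. N g) * (?Q v)" for v
  proof -
    have "tdens nu grp G v * (\<Prod>g\<in>{1..G}. Wg nu grp v g ^ r g)
       = (\<Prod>g\<in>{1..G}. tstd_dens (nu g) (m g) (q v g) * ((nu g + real (m g)) / (nu g - 2 + q v g)) ^ r g)"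
      by (simp add: tdens_def Wg_def q_def m_def prod.distrib)
    also have "\<dots> = (\<Prod>g\<in>{1..G}. N g * (1 + q v g / c g) powr (- a g))"
      unfolding N_def c_def a_def using nu q0 by (intro prod.cong refl tstd_dens_mult_W_power) auto
    finally have "tdens nu grp G v * (\<Prod>g\<in>{1..G}. Wg nu grp v g ^ r g) = (\<Prod>g\<in>{1..G}. N g) * (\<Prod>g\<in>{1..G}. (1 + q v g / c g) powr (- a g))"
      by (simp add: prod.distrib)
    then show ?thesis by (simp add: mult.assoc[symmetric])
  qed
  have inT: "grp j \<in> {1..G}" for j using grp by auto
  have aux: "(\<integral>\<^sup>+v. ennreal (?Q v) \<partial>lborel)
    = ennreal (\<Prod>g\<in>{1..G}. ?t g)"
  proof -
    have ca: "c g > 0" "a g > (\<Sum>j | grp j = g. real (k j) + 1/2)" if "g \<in> {1..G}" for g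
    proof -
      show "c g > 0" using nu that by (auto simp: c_def)
      have "a g > kap g" using cond[OF that] kap[of g] unfolding a_def K_def by (simp add: add_divide_distrib)
      then show "a g > (\<Sum>j | grp j = g. real (k j) + 1/2)" by (simp only: kap_def)
    qed
    show ?thesis
      using nn_integral_group_moment_aux[of "{1..G}" c k grp a "\<lambda>_. 1", OF _ ca] inT
      by (simp add: q_def kap_def)
  qed
  define I where "I = (\<Prod>g\<in>{1..G}. N g * (?t g))"
  have ag: "a g > kap g" "a g > 0" if "g \<in> {1..G}" for g
  proof -
    show "a g > kap g" using cond[OF that] kap[of g] unfolding a_def K_def by (simp add: add_divide_distrib)
    then show "a g > 0" using kap[of g] by simp
  qed
  have I0: "I \<ge> 0"
    unfolding I_def using N0 ag gauss_mom_pos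
    by (intro prod_nonneg mult_nonneg_nonneg divide_nonneg_nonneg ballI) (auto intro!: less_imp_le[OF Gamma_real_pos] prod_nonneg simp: less_imp_le)
  have NN0: "(\<Prod>g\<in>{1..G}. N g) \<ge> 0" using N0 by (intro prod_nonneg) auto
  have "(\<integral>\<^sup>+v. ennreal (?F v) \<partial>lborel)
     = (\<integral>\<^sup>+v. ennreal (\<Prod>g\<in>{1..G}. N g) * ennreal (?Q v) \<partial>lborel)"
    unfolding Feq using N0 by (intro nn_integral_cong ennreal_mult mult_nonneg_nonneg prod_nonneg) auto
  also have "\<dots> = ennreal (\<Prod>g\<in>{1..G}. N g) * (\<integral>\<^sup>+v. ennreal (?Q v) \<partial>lborel)"
    unfolding q_def by (rule nn_integral_cmult) measurable
  also have "\<dots> = ennreal I"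
    unfolding aux I_def prod.distrib[of N]
    by (rule ennreal_mult[symmetric]) (use N0 ag gauss_mom_pos in \<open>auto intro!: less_imp_le[OF Gamma_real_pos] prod_nonneg mult_nonneg_nonneg divide_nonneg_nonneg simp: less_imp_le\<close>)
  finally have nn: "(\<integral>\<^sup>+v. ennreal (?F v) \<partial>lborel) = ennreal I" .
  have Fnn: "?F v \<ge> 0" for v
    unfolding Feq using N0 by (intro mult_nonneg_nonneg prod_nonneg) auto
  have hb: "has_bochner_integral lborel ?F I"
    by (rule has_bochner_integral_nn_integral[OF _ _ I0 nn]) (use Fnn in auto)
  have "I = ?I"
    unfolding I_def
  proof (rule prod.cong[OF refl], goal_cases)
    case g: (1 g)
    have c: "c g > 0" using nu g by (auto simp: c_def)
    have p: "(\<Prod>j | grp j = g. sqrt pi * gauss_mom (k j)) = pi powr (real (m g) / 2) * (\<Prod>j | grp j = g. gauss_mom (k j))"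
    proof -
      have "(\<Prod>j | grp j = g. sqrt pi) = pi powr (real (m g) / 2)"
        by (simp add: m_def gsize_def powr_half_sqrt[symmetric] powr_realpow[symmetric] powr_powr)
      then show ?thesis by (simp add: prod.distrib)
    qed
    \<comment> \<open>The powers of pi and of nu - 2 in the normalization of the density cancel
      those produced by the m one-dimensional Gaussian integrals, leaving only (nu - 2)^K.\<close>
    have e1: "(c g * pi) powr (- real (m g) / 2) * c g powr kap g * pi powr (real (m g) / 2) = c g powr real (K g)"
    proof -
      have "(c g * pi) powr (- real (m g) / 2) = c g powr (- real (m g) / 2) * pi powr (- real (m g) / 2)"
        using c by (intro powr_mult)
      then have "(c g * pi) powr (- real (m g) / 2) * c g powr kap g * pi powr (real (m g) / 2)
         = (c g powr (- real (m g) / 2) * c g powr kap g) * (pi powr (- real (m g) / 2) * pi powr (real (m g) / 2))"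
        by (simp only: mult_ac)
      also have "\<dots> = c g powr real (K g)" by (simp add: powr_add[symmetric] kap)
      finally show ?thesis .
    qed
    have e2: "((nu g + real (m g)) / c g) ^ r g * c g powr real (K g) = (nu g + real (m g)) ^ r g * c g powr (real (K g) - real (r g))"
      using c by (simp add: power_divide powr_diff powr_realpow)
    have e3: "a g - kap g = nu g / 2 + real (r g) - real (K g)" unfolding a_def kap by (simp add: add_divide_distrib)
    have "N g * (?t g)
       = Gamma ((nu g + real (m g)) / 2) / Gamma (nu g / 2) * (((nu g + real (m g)) / c g) ^ r g *
          ((c g * pi) powr (- real (m g) / 2) * c g powr kap g * pi powr (real (m g) / 2))) * (Gamma (a g - kap g) / Gamma (a g)) * (\<Prod>j | grp j = g. gauss_mom (k j))"
      unfolding N_def p fun_cong[OF c_def, of g, symmetric] by (simp only: mult_ac)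
    also have "\<dots> = tmom (nu g) (m g) (r g) (K g) * (\<Prod>j | grp j = g. gauss_mom (k j))"
      unfolding e1 e2 e3 unfolding tmom_def a_def c_def by (simp add: mult_ac)
    finally show ?case
      by (simp only: m_def K_def)
  qed
  then show ?thesis using hb by simp
qed

section \<open>Explicit values of the group factors of order at most four\<close>

lemma Gamma_real_plus1: "x > 0 \<Longrightarrow> Gamma (x + 1) = x * Gamma (x::real)"
  by (rule Gamma_plus1) auto

lemma Gamma_real_plus2:
  assumes "x > 0" shows "Gamma (x + 2) = x * (x + 1) * Gamma (x::real)"
proof -
  have "Gamma (x + 2) = Gamma ((x + 1) + 1)" by (simp add: add.assoc)
  then show ?thesis using Gamma_real_plus1[of x] Gamma_real_plus1[of "x + 1"] assms by (simp add: mult_ac)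
qed

lemma Gamma_real_nonzero: "x > 0 \<Longrightarrow> Gamma (x::real) \<noteq> 0"
  using Gamma_real_pos[of x] by linarith

lemma tmom_0_0:
  assumes "nu > 2"
  shows "tmom nu m 0 0 = 1"
proof -
  have "Gamma (nu / 2) \<noteq> 0" "Gamma ((nu + real m) / 2) \<noteq> 0" using assms by (auto intro!: Gamma_real_nonzero)
  then show ?thesis using assms by (simp add: tmom_def)
qed

text \<open>With the Gaussian factor 1/2 this is the unit variance for which t^std is
  standardized.\<close>

lemma tmom_0_1:
  assumes "nu > 2"
  shows "tmom nu m 0 1 = 2"
proof -
  define x where "x = nu / 2 - 1"
  have x: "x > 0" "nu = 2 * x + 2" using assms by (simp_all add: x_def)
  have n: "Gamma x \<noteq> 0" "Gamma ((nu + real m) / 2) \<noteq> 0" using assms x by (auto intro!: Gamma_real_nonzero)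
  have "nu / 2 = x + 1" by (simp add: x_def)
  then have G: "Gamma (nu / 2) = x * Gamma x" using Gamma_real_plus1[OF x(1)] by (simp only:)
  have "tmom nu m 0 1 = (nu - 2) * (Gamma x / Gamma (nu / 2))"
    using assms n(2) by (simp add: tmom_def x_def)
  also have "\<dots> = (nu - 2) / x" unfolding G using n(1) by simp
  also have "\<dots> = 2" using x by simp
  finally show ?thesis .
qed

text \<open>With the Gaussian factor 1/2 this gives E[W v_i^2] = 1, the identity that centers the
  score.\<close>

lemma tmom_1_1:
  assumes "nu > 2"
  shows "tmom nu m 1 1 = 2"
proof -
  define A where "A = (nu + real m) / 2"
  have A: "A > 0" "nu + real m = 2 * A" using assms by (simp_all add: A_def)
  have n: "Gamma (nu / 2) \<noteq> 0" "Gamma A \<noteq> 0" using assms A by (auto intro!: Gamma_real_nonzero)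
  have "tmom nu m 1 1 = (2 * A) * (Gamma A / Gamma (A + 1))"
    using assms n(1) by (simp add: tmom_def A)
  also have "\<dots> = 2" unfolding Gamma_real_plus1[OF A(1)] using n(2) A(1) by simp
  finally show ?thesis .
qed

text \<open>Twice psi: the factor of E[W^2 v_i^2], where the other squared coordinate lies in a
  different group.\<close>

lemma tmom_2_1:
  assumes "nu > 2"
  shows "tmom nu m 2 1 = 2 * ((nu + real m) / (nu + real m + 2) * nu / (nu - 2))"
proof -
  define A where "A = (nu + real m) / 2"
  have A: "A > 0" "nu + real m = 2 * A" using assms by (simp_all add: A_def)
  have n: "Gamma (nu / 2) \<noteq> 0" "Gamma A \<noteq> 0" using assms A by (auto intro!: Gamma_real_nonzero)
  have "nu / 2 + real 2 - real 1 = nu / 2 + 1" by simp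
  then have G: "Gamma (nu / 2 + real 2 - real 1) = nu / 2 * Gamma (nu / 2)"
    using Gamma_real_plus1[of "nu / 2"] assms by (simp only: half_gt_zero_iff)
  have c: "(nu - 2) powr (real 1 - real 2) = 1 / (nu - 2)" using assms by (simp add: powr_minus divide_inverse)
  have "tmom nu m 2 1 = (2 * A)\<^sup>2 * (1 / (nu - 2)) * (nu / 2) * (Gamma A / Gamma (A + 2))"
    unfolding tmom_def G c A(2) using n(1) by simp
  also have "Gamma A / Gamma (A + 2) = 1 / (A * (A + 1))" unfolding Gamma_real_plus2[OF A(1)] using n(2) A(1) by simp
  also have "(2 * A)\<^sup>2 * (1 / (nu - 2)) * (nu / 2) * (1 / (A * (A + 1))) = 2 * (2 * A / (2 * A + 2) * nu / (nu - 2))"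
    using A(1) assms by (simp add: divide_simps) (simp add: power2_eq_square algebra_simps)
  finally show ?thesis unfolding A(2) .
qed

text \<open>Four times phi: multiplied by 1/4 for two distinct coordinates of the group it gives
  phi, and by 3/4 for a fourth power it gives 3 phi.\<close>

lemma tmom_2_2:
  assumes "nu > 2"
  shows "tmom nu m 2 2 = 4 * ((nu + real m) / (nu + real m + 2))"
proof -
  define A where "A = (nu + real m) / 2"
  have A: "A > 0" "nu + real m = 2 * A" using assms by (simp_all add: A_def)
  have n: "Gamma (nu / 2) \<noteq> 0" "Gamma A \<noteq> 0" using assms A by (auto intro!: Gamma_real_nonzero)
  have "tmom nu m 2 2 = (2 * A)\<^sup>2 * (Gamma A / Gamma (A + 2))"
    unfolding tmom_def A(2) using n(1) assms by simp
  also have "Gamma A / Gamma (A + 2) = 1 / (A * (A + 1))" unfolding Gamma_real_plus2[OF A(1)] using n(2) A(1) by simp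
  also have "(2 * A)\<^sup>2 * (1 / (A * (A + 1))) = 4 * (2 * A / (2 * A + 2))"
    using A(1) by (simp add: divide_simps) (simp add: power2_eq_square algebra_simps)
  finally show ?thesis unfolding A(2) .
qed

lemma gauss_mom_simps: "gauss_mom 0 = 1" "gauss_mom (Suc 0) = 1/2" "gauss_mom (Suc (Suc 0)) = 3/4"
  by (simp_all add: gauss_mom_def fact_numeral eval_nat_numeral)

lemma prod_power_of_bool:
  fixes x :: "'a \<Rightarrow> real"
  assumes "finite A" "i \<in> A"
  shows "(\<Prod>g\<in>A. x g ^ (n * of_bool (g = i))) = x i ^ n"
proof -
  have "(\<Prod>g\<in>A. x g ^ (n * of_bool (g = i))) = (\<Prod>g\<in>A. if g = i then x g ^ n else 1)"
    by (intro prod.cong) auto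
  then show ?thesis using assms by simp
qed

lemma sum_group_of_bool:
  fixes grp :: "'n::finite \<Rightarrow> nat"
  shows "(\<Sum>x | grp x = g. of_bool (x = i)) = (of_bool (g = grp i) :: nat)"
proof -
  have "(\<Sum>x | grp x = g. of_bool (x = i)) = (\<Sum>x | grp x = g. if x = i then 1 else (0::nat))"
    by (intro sum.cong) auto
  then show ?thesis by (auto simp: sum.delta)
qed

lemma prod_group_delta:
  fixes grp :: "'n::finite \<Rightarrow> nat"
  shows "(\<Prod>x | grp x = g. if x = i then c else (1::real)) = (if g = grp i then c else 1)"
  by (auto simp: prod.delta)

text \<open>The exponents \<open>of_bool (x = i) + of_bool (x = j)\<close> encode v_i^2 v_j^2 and,
  for i = j, v_i^4 in one expression. Here 1/2 and 3/4 are \<open>gauss_mom\<close> at 1 and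
  2.\<close>

lemma prod_group_gauss_mom:
  fixes grp :: "'n::finite \<Rightarrow> nat"
  shows "(\<Prod>x | grp x = g. gauss_mom (of_bool (x = i) + of_bool (x = j)))
    = (if i = j then (if g = grp i then 3/4 else 1) else (if g = grp i then 1/2 else 1) * (if g = grp j then 1/2 else 1))"
proof (cases "i = j")
  case True
  have "(\<Prod>x | grp x = g. gauss_mom (of_bool (x = i) + of_bool (x = j))) = (\<Prod>x | grp x = g. if x = i then 3/4 else 1)"
    by (intro prod.cong) (auto simp: True gauss_mom_simps)
  then show ?thesis using True by (simp only: prod_group_delta if_True simp_thms)
next
  case False
  have "(\<Prod>x | grp x = g. gauss_mom (of_bool (x = i) + of_bool (x = j)))
     = (\<Prod>x | grp x = g. (if x = i then 1/2 else 1) * (if x = j then 1/2 else 1))"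
    by (intro prod.cong) (use False in \<open>auto simp: gauss_mom_simps\<close>)
  then show ?thesis using False by (simp only: prod.distrib prod_group_delta if_False simp_thms)
qed

lemma prod_group_gauss_mom_single:
  fixes grp :: "'n::finite \<Rightarrow> nat"
  shows "(\<Prod>x | grp x = g. gauss_mom (of_bool (x = i))) = (if g = grp i then 1/2 else 1)"
proof -
  have "(\<Prod>x | grp x = g. gauss_mom (of_bool (x = i))) = (\<Prod>x | grp x = g. if x = i then 1/2 else 1)"
    by (intro prod.cong) (auto simp: gauss_mom_simps)
  then show ?thesis by (simp only: prod_group_delta)
qed

lemma prod_square_pair:
  fixes v :: "real^'n"
  shows "(\<Prod>x\<in>UNIV. (v $ x) ^ (2 * (of_bool (x = i) + of_bool (x = j)))) = (v $ i)\<^sup>2 * (v $ j)\<^sup>2"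
proof -
  have "(\<Prod>x\<in>UNIV. (v $ x) ^ (2 * (of_bool (x = i) + of_bool (x = j))))
     = (\<Prod>x\<in>UNIV. (v $ x) ^ (2 * of_bool (x = i)) * (v $ x) ^ (2 * of_bool (x = j)))"
    by (simp only: distrib_left power_add)
  then show ?thesis by (simp only: prod.distrib prod_power_of_bool finite UNIV_I)
qed

text \<open>The covariance of the entries \<open>(i, j)\<close> and \<open>(k, l)\<close> of \<open>P' A P\<close>, where \<open>A = \<Sum>\<^sub>g W\<^sub>g P\<^sub>g V\<^sub>g U' - I\<close>.\<close>
definition score_cov :: "(nat \<Rightarrow> real) \<Rightarrow> ('n::finite \<Rightarrow> nat) \<Rightarrow> 'n \<Rightarrow> 'n \<Rightarrow> 'n \<Rightarrow> 'n \<Rightarrow> real" where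
  "score_cov nu grp i j k l = of_bool (i = l \<and> j = k)
     + of_bool (i = k \<and> j = l) * (psig nu grp (grp i) + of_bool (grp i = grp j) * (phig nu grp (grp i) - psig nu grp (grp i)))
     + (phig nu grp (grp i) - 1) * (of_bool (grp i = grp j) * of_bool (i = l \<and> j = k) + of_bool (grp i = grp k) * of_bool (i = j \<and> k = l))"

context
  fixes grp :: "'n::finite \<Rightarrow> nat" and G :: nat and nu :: "nat \<Rightarrow> real"
  assumes grp: "range grp = {1..G}" and nu: "\<forall>g\<in>{1..G}. nu g > 2"
begin

private abbreviation "dens \<equiv> tdens nu grp G"
private abbreviation "wgt v i \<equiv> Wg nu grp v (grp i)"

lemma grp_mem: "grp j \<in> {1..G}"
  using grp by auto

lemma tdens_integral: "has_bochner_integral lborel dens 1"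
proof -
  have "has_bochner_integral lborel
    (\<lambda>v. dens v * ((\<Prod>g\<in>{1..G}. Wg nu grp v g ^ 0) * (\<Prod>j\<in>UNIV. (v $ j) ^ (2 * 0))))
    (\<Prod>g\<in>{1..G}. tmom (nu g) (gsize grp g) 0 (\<Sum>j | grp j = g. 0) * (\<Prod>j | grp j = g. gauss_mom 0))"
    by (rule tmoment[OF grp nu]) (use nu in force)
  moreover have "(\<Prod>g\<in>{1..G}. tmom (nu g) (gsize grp g) 0 (\<Sum>j | grp j = g. 0) * (\<Prod>j | grp j = g. gauss_mom 0)) = 1"
    by (intro prod.neutral ballI) (use nu in \<open>simp add: gauss_mom_simps tmom_0_0\<close>)
  ultimately show ?thesis by simp
qed

lemma tdens_W_moment: "has_bochner_integral lborel (\<lambda>v. dens v * (wgt v i * (v $ i)\<^sup>2)) 1"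
proof -
  let ?r = "\<lambda>g. 1 * of_bool (g = grp i) :: nat" and ?k = "\<lambda>x. of_bool (x = i) :: nat"
  let ?m = "\<lambda>g. tmom (nu g) (gsize grp g) (?r g) (\<Sum>j | grp j = g. ?k j) * (\<Prod>j | grp j = g. gauss_mom (?k j))"
  have "has_bochner_integral lborel
    (\<lambda>v. dens v * ((\<Prod>g\<in>{1..G}. Wg nu grp v g ^ ?r g) * (\<Prod>j\<in>UNIV. (v $ j) ^ (2 * ?k j))))
    (\<Prod>g\<in>{1..G}. ?m g)"
  proof (rule tmoment[OF grp nu])
    fix g assume "g \<in> {1..G}"
    then have "nu g > 2" using nu by blast
    then show "real (\<Sum>j | grp j = g. ?k j) < nu g / 2 + real (?r g)" unfolding sum_group_of_bool by simp
  qed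
  moreover have "(\<Prod>g\<in>{1..G}. ?m g) = 1"
  proof (intro prod.neutral ballI)
    fix g assume "g \<in> {1..G}"
    then have "nu g > 2" using nu by blast
    then show "?m g = 1"
      unfolding sum_group_of_bool prod_group_gauss_mom_single
      using tmom_0_0[of "nu g" "gsize grp g"] tmom_1_1[of "nu g" "gsize grp g"] by (cases "g = grp i") auto
  qed
  moreover have "(\<Prod>g\<in>{1..G}. Wg nu grp v g ^ ?r g) * (\<Prod>j\<in>UNIV. (v $ j) ^ (2 * ?k j)) = wgt v i * (v $ i)\<^sup>2" for v
    by (simp only: prod_power_of_bool finite UNIV_I finite_atLeastAtMost grp_mem power_one_right)
  ultimately show ?thesis by simp
qed

text \<open>The hypothesis \<open>factor\<close> books the whole value I on the group of i and asks
  every other group, including that of j if different, to contribute 1. The product over groups then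
  collapses.\<close>

lemma tdens_pair_moment:
  fixes r :: "nat \<Rightarrow> nat"
  assumes cond: "\<And>g. nu g > 2 \<Longrightarrow> of_bool (g = grp i) + of_bool (g = grp j) < nu g / 2 + real (r g)"
    and factor: "\<And>g. nu g > 2 \<Longrightarrow> tmom (nu g) (gsize grp g) (r g) (of_bool (g = grp i) + of_bool (g = grp j))
      * (if i = j then (if g = grp i then 3/4 else 1) else (if g = grp i then 1/2 else 1) * (if g = grp j then 1/2 else 1))
      = (if g = grp i then I else 1)"
  shows "has_bochner_integral lborel (\<lambda>v. dens v * ((\<Prod>g\<in>{1..G}. Wg nu grp v g ^ r g) * ((v $ i)\<^sup>2 * (v $ j)\<^sup>2))) I"
proof -
  let ?k = "\<lambda>x. of_bool (x = i) + of_bool (x = j) :: nat"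
  let ?m = "\<lambda>g. tmom (nu g) (gsize grp g) (r g) (\<Sum>j | grp j = g. ?k j) * (\<Prod>j | grp j = g. gauss_mom (?k j))"
  have "has_bochner_integral lborel
    (\<lambda>v. dens v * ((\<Prod>g\<in>{1..G}. Wg nu grp v g ^ r g) * (\<Prod>j\<in>UNIV. (v $ j) ^ (2 * ?k j)))) (\<Prod>g\<in>{1..G}. ?m g)"
  proof (rule tmoment[OF grp nu])
    fix g assume "g \<in> {1..G}"
    then have "nu g > 2" using nu by blast
    then show "real (\<Sum>j | grp j = g. ?k j) < nu g / 2 + real (r g)"
      unfolding sum.distrib sum_group_of_bool using cond[of g] by simp
  qed
  moreover have "(\<Prod>g\<in>{1..G}. ?m g) = (\<Prod>g\<in>{1..G}. if g = grp i then I else 1)"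
    unfolding sum.distrib sum_group_of_bool prod_group_gauss_mom using nu by (intro prod.cong refl factor) blast
  moreover have "(\<Prod>g\<in>{1..G}. if g = grp i then I else 1) = I" using grp_mem[of i] by (simp only: prod.delta finite_atLeastAtMost if_True)
  ultimately show ?thesis by (simp only: prod_square_pair)
qed

lemma tdens_WW_moment:
  "has_bochner_integral lborel (\<lambda>v. dens v * (wgt v i * wgt v j * ((v $ i)\<^sup>2 * (v $ j)\<^sup>2)))
    (if i = j then 3 * phig nu grp (grp i) else if grp i = grp j then phig nu grp (grp i) else 1)"
    (is "has_bochner_integral _ _ ?I")
proof -
  let ?r = "\<lambda>g. 1 * of_bool (g = grp i) + 1 * of_bool (g = grp j) :: nat"
  have "(\<Prod>g\<in>{1..G}. Wg nu grp v g ^ ?r g) = wgt v i * wgt v j" for v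
    by (simp only: power_add prod.distrib prod_power_of_bool finite UNIV_I finite_atLeastAtMost grp_mem power_one_right)
  moreover have "has_bochner_integral lborel (\<lambda>v. dens v * ((\<Prod>g\<in>{1..G}. Wg nu grp v g ^ ?r g) * ((v $ i)\<^sup>2 * (v $ j)\<^sup>2))) ?I"
  proof (rule tdens_pair_moment, goal_cases)
    case (2 g)
    note t = tmom_0_0[OF this, of "gsize grp g"] tmom_1_1[OF this, of "gsize grp g"]
      tmom_2_2[OF this, of "gsize grp g", folded phig_def[of nu grp g]]
    show ?case
      by (cases "i = j"; cases "g = grp i"; cases "g = grp j") (use t in \<open>auto simp: numeral_2_eq_2\<close>)
  qed auto
  ultimately show ?thesis by (simp only:)
qed

lemma tdens_W2_moment:
  "has_bochner_integral lborel (\<lambda>v. dens v * ((wgt v i)\<^sup>2 * ((v $ i)\<^sup>2 * (v $ j)\<^sup>2)))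
    (if i = j then 3 * phig nu grp (grp i) else if grp i = grp j then phig nu grp (grp i) else psig nu grp (grp i))"
    (is "has_bochner_integral _ _ ?I")
proof -
  let ?r = "\<lambda>g. 2 * of_bool (g = grp i) :: nat"
  have "(\<Prod>g\<in>{1..G}. Wg nu grp v g ^ ?r g) = (wgt v i)\<^sup>2" for v
    by (simp only: prod_power_of_bool finite UNIV_I finite_atLeastAtMost grp_mem)
  moreover have "has_bochner_integral lborel (\<lambda>v. dens v * ((\<Prod>g\<in>{1..G}. Wg nu grp v g ^ ?r g) * ((v $ i)\<^sup>2 * (v $ j)\<^sup>2))) ?I"
  proof (rule tdens_pair_moment, goal_cases)
    case (2 g)
    note t = tmom_0_0[OF this, of "gsize grp g"] tmom_0_1[OF this, of "gsize grp g"]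
      tmom_2_1[OF this, of "gsize grp g", folded phig_def[of nu grp g] psig_def[of nu grp g]]
      tmom_2_2[OF this, of "gsize grp g", folded phig_def[of nu grp g]]
    show ?case
      by (cases "i = j"; cases "g = grp i"; cases "g = grp j") (use t in \<open>auto simp: numeral_2_eq_2\<close>)
  qed auto
  ultimately show ?thesis by (simp only:)
qed

lemma has_bochner_integral_odd_coordinate:
  fixes F :: "real^'n \<Rightarrow> real"
  assumes F: "integrable lborel F" and odd: "\<And>v. F (\<chi> i. if i = x then - v $ i else v $ i) = - F v"
  shows "has_bochner_integral lborel F 0"
proof -
  define f where "f = (\<lambda>v::real^'n. (\<chi> i. (if i = x then -1 else 1) * v $ i) :: real^'n)"
  have lin: "linear f" unfolding f_def by (rule linearI) (auto simp: vec_eq_iff algebra_simps)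
  have "det (matrix f) = (\<Prod>i\<in>UNIV. if i = x then -1 else 1)"
    unfolding f_def by (subst det_diagonal) (auto simp: matrix_def axis_def)
  then have det: "det (matrix f) = -1" by simp
  have Ff: "F (f v) = - F v" for v
  proof -
    have "f v = (\<chi> i. if i = x then - v $ i else v $ i)" by (auto simp: f_def vec_eq_iff)
    then show ?thesis using odd by simp
  qed
  have 1: "has_bochner_integral lborel F (integral\<^sup>L lborel F)" using F by (rule has_bochner_integral_integrable)
  have 2: "has_bochner_integral lborel F (- integral\<^sup>L lborel F)"
  proof (rule has_bochner_integral_linear_image[OF lin])
    show "F \<in> borel_measurable borel" using F by (simp add: borel_measurable_integrable)
    show "has_bochner_integral lborel (\<lambda>x. \<bar>det (matrix f)\<bar> * F (f x)) (- integral\<^sup>L lborel F)"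
      using has_bochner_integral_minus[OF has_bochner_integral_integrable[OF F]] by (simp add: det Ff)
  qed (simp add: det)
  have "integral\<^sup>L lborel F = - integral\<^sup>L lborel F" by (rule has_bochner_integral_eq[OF 1 2])
  then have "integral\<^sup>L lborel F = 0" by simp
  with 1 show ?thesis by (simp only:)
qed

lemma square_flip: "((\<chi> i. if i = x then - v $ i else v $ i) $ j)\<^sup>2 = (v $ j)\<^sup>2" for v :: "real^'n"
  by simp

lemma tdens_flip: "dens (\<chi> i. if i = x then - v $ i else v $ i) = dens v"
  unfolding tdens_def square_flip ..

lemma Wg_flip: "Wg nu grp (\<chi> i. if i = x then - v $ i else v $ i) g = Wg nu grp v g"
  unfolding Wg_def square_flip ..

text \<open>From |y z| \<le> y^2 + z^2. Integrability of all mixed products is thus reduced to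
  squares, which the even moments supply.\<close>

lemma integrable_tdens_mult:
  assumes [measurable]: "y \<in> borel_measurable borel" "z \<in> borel_measurable borel"
    and "integrable lborel (\<lambda>v. dens v * (y v)\<^sup>2)" "integrable lborel (\<lambda>v. dens v * (z v)\<^sup>2)"
  shows "integrable lborel (\<lambda>v. dens v * (y v * z v))"
proof (rule Bochner_Integration.integrable_bound)
  show "integrable lborel (\<lambda>v. dens v * (y v)\<^sup>2 + dens v * (z v)\<^sup>2)"
    using assms by (intro Bochner_Integration.integrable_add)
  show "AE v in lborel. norm (dens v * (y v * z v)) \<le> norm (dens v * (y v)\<^sup>2 + dens v * (z v)\<^sup>2)"
  proof (intro AE_I2)
    fix v
    have d: "dens v \<ge> 0" by (rule tdens_nonneg[OF nu])
    have "0 \<le> (\<bar>y v\<bar> - \<bar>z v\<bar>)\<^sup>2" by simp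
    then have "2 * \<bar>y v * z v\<bar> \<le> (y v)\<^sup>2 + (z v)\<^sup>2" by (simp add: power2_diff abs_mult)
    then have "\<bar>y v * z v\<bar> \<le> (y v)\<^sup>2 + (z v)\<^sup>2" by linarith
    then have "dens v * \<bar>y v * z v\<bar> \<le> dens v * ((y v)\<^sup>2 + (z v)\<^sup>2)" using d by (rule mult_left_mono)
    then show "norm (dens v * (y v * z v)) \<le> norm (dens v * (y v)\<^sup>2 + dens v * (z v)\<^sup>2)"
      using d by (simp add: abs_mult distrib_left)
  qed
qed measurable

lemma integrable_tdens_W_square: "integrable lborel (\<lambda>v. dens v * (wgt v i * (v $ i * v $ j))\<^sup>2)"
  using tdens_W2_moment[of i j] by (simp add: has_bochner_integral_iff power_mult_distrib)

lemma integrable_tdens_W: "integrable lborel (\<lambda>v. dens v * (wgt v i * (v $ i * v $ j)))"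
  \<comment> \<open>The partner 1 is square integrable against \<open>dens\<close> because
    \<open>dens\<close> has total mass 1.\<close>
  using integrable_tdens_mult[of "\<lambda>v. wgt v i * (v $ i * v $ j)" "\<lambda>_. 1"] tdens_integral integrable_tdens_W_square
  by (simp add: has_bochner_integral_iff)

lemma integrable_tdens_WW:
  "integrable lborel (\<lambda>v. dens v * ((wgt v i * (v $ i * v $ j)) * (wgt v k * (v $ k * v $ l))))"
  by (rule integrable_tdens_mult) (measurable, auto intro: integrable_tdens_W_square)

lemma tdens_W_cross_moment:
  "has_bochner_integral lborel (\<lambda>v. dens v * (wgt v i * (v $ i * v $ j))) (of_bool (i = j))"
proof (cases "i = j")
  case True
  then show ?thesis using tdens_W_moment[of i] by (simp add: power2_eq_square)
next
  case False
  have "has_bochner_integral lborel (\<lambda>v. dens v * (wgt v i * (v $ i * v $ j))) 0"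
    by (rule has_bochner_integral_odd_coordinate[OF integrable_tdens_W, where x=i])
      (use False in \<open>simp add: tdens_flip Wg_flip\<close>)
  then show ?thesis using False by simp
qed

text \<open>Unless the four indices can be matched in pairs, some index x occurs an odd number of
  times, and flipping the sign of coordinate x reverses the product.\<close>

lemma odd_index_exists:
  fixes i j k l :: 'n
  assumes "\<not> (i = j \<and> k = l)" "\<not> (i = l \<and> j = k)" "\<not> (i = k \<and> j = l)"
  shows "\<exists>x. (if i = x then -1 else 1) * (if j = x then -1 else 1) * ((if k = x then -1 else 1) * (if l = x then -1 else 1)) = (-1::real)"
proof -
  consider "i = j" | "i \<noteq> j" "i = k" | "i \<noteq> j" "i \<noteq> k" "i = l" | "i \<noteq> j" "i \<noteq> k" "i \<noteq> l" by blast
  then show ?thesis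
  proof cases
    case 1 then show ?thesis using assms by (intro exI[of _ k]) auto
  next
    case 2 then show ?thesis using assms by (intro exI[of _ j]) auto
  next
    case 3 then show ?thesis using assms by (intro exI[of _ j]) auto
  next
    case 4 then show ?thesis by (intro exI[of _ i]) auto
  qed
qed

text \<open>One term for each way of pairing the four indices, with group-dependent weights, so that
  a single formula covers overlapping cases. If all indices agree, it gives 1 + 1 + phi + 2 (phi -
  1) = 3 phi.\<close>

lemma tdens_quartic_moment:
  "has_bochner_integral lborel
    (\<lambda>v. dens v * ((wgt v i * (v $ i * v $ j)) * (wgt v k * (v $ k * v $ l))))
    (of_bool (i = j \<and> k = l) + of_bool (i = l \<and> j = k)
     + of_bool (i = k \<and> j = l) * (psig nu grp (grp i) + of_bool (grp i = grp j) * (phig nu grp (grp i) - psig nu grp (grp i)))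
     + (phig nu grp (grp i) - 1) * (of_bool (grp i = grp j) * of_bool (i = l \<and> j = k) + of_bool (grp i = grp k) * of_bool (i = j \<and> k = l)))"
    (is "has_bochner_integral lborel ?F ?I")
proof -
  consider "i = j" "k = l" | "i = l" "j = k" | "i = k" "j = l"
    | "\<not> (i = j \<and> k = l)" "\<not> (i = l \<and> j = k)" "\<not> (i = k \<and> j = l)" by blast
  then show ?thesis
  proof cases
    case 1
    have "?F = (\<lambda>v. dens v * (wgt v i * wgt v k * ((v $ i)\<^sup>2 * (v $ k)\<^sup>2)))"
      by (simp add: 1 power2_eq_square mult_ac)
    moreover have "?I = (if i = k then 3 * phig nu grp (grp i) else if grp i = grp k then phig nu grp (grp i) else 1)"
      using 1 by (cases "i = k") auto
    ultimately show ?thesis using tdens_WW_moment[of i k] by (simp only:)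
  next
    case 2
    have "?F = (\<lambda>v. dens v * (wgt v i * wgt v j * ((v $ i)\<^sup>2 * (v $ j)\<^sup>2)))"
      by (simp add: 2 power2_eq_square mult_ac)
    moreover have "?I = (if i = j then 3 * phig nu grp (grp i) else if grp i = grp j then phig nu grp (grp i) else 1)"
      using 2 by (cases "i = j") auto
    ultimately show ?thesis using tdens_WW_moment[of i j] by (simp only:)
  next
    case 3
    have "?F = (\<lambda>v. dens v * ((wgt v i)\<^sup>2 * ((v $ i)\<^sup>2 * (v $ j)\<^sup>2)))"
      by (simp add: 3 power2_eq_square mult_ac)
    moreover have "?I = (if i = j then 3 * phig nu grp (grp i) else if grp i = grp j then phig nu grp (grp i) else psig nu grp (grp i))"
      using 3 by (cases "i = j") auto
    ultimately show ?thesis using tdens_W2_moment[of i j] by (simp only:)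
  next
    case 4
    obtain x where x: "(if i = x then -1 else 1) * (if j = x then -1 else 1) * ((if k = x then -1 else 1) * (if l = x then -1 else 1)) = (-1::real)"
      using odd_index_exists[OF 4] by blast
    have "has_bochner_integral lborel ?F 0"
    proof (rule has_bochner_integral_odd_coordinate[OF integrable_tdens_WW, where x=x])
      fix v :: "real^'n"
      have s: "(\<chi> i. if i = x then - v $ i else v $ i) $ y = (if y = x then -1 else 1) * v $ y" for y by simp
      have "?F (\<chi> i. if i = x then - v $ i else v $ i)
         = ((if i = x then -1 else 1) * (if j = x then -1 else 1) * ((if k = x then -1 else 1) * (if l = x then -1 else 1))) * ?F v"
        unfolding s tdens_flip Wg_flip by (simp only: mult_ac)
      then show "?F (\<chi> i. if i = x then - v $ i else v $ i) = - ?F v" unfolding x by simp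
    qed
    moreover have "of_bool (i = j \<and> k = l) = (0::real)" "of_bool (i = l \<and> j = k) = (0::real)" "of_bool (i = k \<and> j = l) = (0::real)"
      using 4 by simp_all
    then have "?I = 0" by (simp only: mult_zero_left mult_zero_right add_0_right)
    ultimately show ?thesis by (simp only:)
  qed
qed

text \<open>The entries W v_i v_j have mean 1 or 0 according to whether i = j. Centering removes
  exactly the term for i = j and k = l of weight 1 from the quartic moment; what is left is
  \<open>score_cov\<close>.\<close>

lemma tdens_score_moment:
  "has_bochner_integral lborel
    (\<lambda>v. dens v * ((wgt v i * (v $ i * v $ j) - of_bool (i = j)) * (wgt v k * (v $ k * v $ l) - of_bool (k = l))))
    (score_cov nu grp i j k l)"
proof -
  let ?W = "\<lambda>i j v. wgt v i * (v $ i * v $ j)"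
  have *: "dens v * ((?W i j v - of_bool (i = j)) * (?W k l v - of_bool (k = l)))
     = dens v * (?W i j v * ?W k l v) - of_bool (k = l) * (dens v * ?W i j v)
       - of_bool (i = j) * (dens v * ?W k l v) + of_bool (i = j) * of_bool (k = l) * dens v" for v
    by (simp add: algebra_simps)
  have "has_bochner_integral lborel (\<lambda>v. dens v * ((?W i j v - of_bool (i = j)) * (?W k l v - of_bool (k = l))))
    ((of_bool (i = j \<and> k = l) + of_bool (i = l \<and> j = k)
     + of_bool (i = k \<and> j = l) * (psig nu grp (grp i) + of_bool (grp i = grp j) * (phig nu grp (grp i) - psig nu grp (grp i)))
     + (phig nu grp (grp i) - 1) * (of_bool (grp i = grp j) * of_bool (i = l \<and> j = k) + of_bool (grp i = grp k) * of_bool (i = j \<and> k = l)))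
     - of_bool (k = l) * of_bool (i = j) - of_bool (i = j) * of_bool (k = l) + of_bool (i = j) * of_bool (k = l) * 1)"
    unfolding *
    by (intro has_bochner_integral_add has_bochner_integral_diff has_bochner_integral_mult_right
        tdens_quartic_moment tdens_W_cross_moment tdens_integral)
  moreover have "(d + x + y + z) - b * a - a * b + a * b * 1 = x + y + z" if "d = a * b" for d x y z a b :: real
    using that by simp
  ultimately show ?thesis by (simp only: score_cov_def of_bool_conj)
qed

end

section \<open>The information matrix\<close>

lemma sum_delta_pair:
  fixes f :: "'n::finite \<Rightarrow> 'n \<Rightarrow> real"
  shows "(\<Sum>k\<in>UNIV. \<Sum>l\<in>UNIV. f k l * of_bool (a = k \<and> b = l)) = f a b"
    and "(\<Sum>k\<in>UNIV. \<Sum>l\<in>UNIV. f k l * of_bool (a = l \<and> b = k)) = f b a"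
proof -
  have 1: "(\<Sum>k\<in>UNIV. \<Sum>l\<in>UNIV. f k l * of_bool (a = k \<and> b = l)) = f a b" for a b
  proof -
    have "(\<Sum>l\<in>UNIV. f k l * of_bool (a = k \<and> b = l)) = (if a = k then f k b else 0)" for k
      by (cases "a = k") (simp_all add: of_bool_def if_distrib[of "\<lambda>x. _ * x"] cong: if_cong)
    then show ?thesis by simp
  qed
  show "(\<Sum>k\<in>UNIV. \<Sum>l\<in>UNIV. f k l * of_bool (a = k \<and> b = l)) = f a b" by (rule 1)
  have "(\<Sum>k\<in>UNIV. \<Sum>l\<in>UNIV. f k l * of_bool (a = l \<and> b = k)) = (\<Sum>k\<in>UNIV. \<Sum>l\<in>UNIV. f k l * of_bool (b = k \<and> a = l))"
    by (simp only: conj_commute)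
  then show "(\<Sum>k\<in>UNIV. \<Sum>l\<in>UNIV. f k l * of_bool (a = l \<and> b = k)) = f b a" by (simp only: 1)
qed

lemma sum_groups:
  fixes grp :: "'n::finite \<Rightarrow> nat" and f :: "nat \<Rightarrow> 'n \<Rightarrow> real"
  assumes "range grp = {1..G}"
  shows "(\<Sum>g\<in>{1..G}. \<Sum>j | grp j = g. f g j) = (\<Sum>j\<in>UNIV. f (grp j) j)"
proof -
  have "(\<Sum>g\<in>{1..G}. \<Sum>j | grp j = g. f g j) = (\<Sum>g\<in>{1..G}. \<Sum>j | j \<in> UNIV \<and> grp j = g. f (grp j) j)"
    by (intro sum.cong) auto
  also have "\<dots> = (\<Sum>j\<in>UNIV. f (grp j) j)" using assms by (intro sum.group) auto
  finally show ?thesis .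
qed

lemma sum_groups_of_bool:
  fixes grp :: "'n::finite \<Rightarrow> nat" and f :: "nat \<Rightarrow> real"
  assumes "range grp = {1..G}"
  shows "(\<Sum>g\<in>{1..G}. f g * of_bool (grp i = g)) = f (grp i)"
proof -
  have "(\<Sum>g\<in>{1..G}. f g * of_bool (grp i = g)) = (\<Sum>g\<in>{1..G}. if grp i = g then f g else 0)"
    by (intro sum.cong) auto
  also have "\<dots> = f (grp i)" using assms by (subst sum.delta') (auto simp: image_def)
  finally show ?thesis .
qed

text \<open>The projector J_g in the basis given by the columns of P, where it is diagonal.\<close>

definition group_diag :: "('n::finite \<Rightarrow> nat) \<Rightarrow> nat \<Rightarrow> real^'n^'n" where
  "group_diag grp g = diagm (\<chi> j. of_bool (grp j = g))"

lemma Jg_eq: "Jg P grp g = P ** group_diag grp g ** transpose P"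
proof -
  have "Jg P grp g $ a $ b = (P ** group_diag grp g ** transpose P) $ a $ b" for a b
  proof -
    have "Jg P grp g $ a $ b = (\<Sum>j | grp j = g. P $ a $ j * P $ b $ j)" by (simp add: Jg_def)
    also have "\<dots> = (\<Sum>j\<in>UNIV. if grp j = g then P $ a $ j * P $ b $ j else 0)"
      by (simp add: sum.If_cases)
    also have "\<dots> = (\<Sum>j\<in>UNIV. P $ a $ j * of_bool (grp j = g) * P $ b $ j)"
      by (intro sum.cong) auto
    also have "\<dots> = (P ** group_diag grp g ** transpose P) $ a $ b"
      unfolding group_diag_def matrix_mult_nth[of _ "transpose P"] mult_diagm_nth transpose_nth by simp
    finally show ?thesis .
  qed
  then show ?thesis by (simp add: vec_eq_iff)
qed

lemma commat_mult_vecm: "commat *v vecm B = vecm (transpose B)"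
proof -
  have "(commat *v vecm B) $ p = vecm (transpose B) $ p" for p
    by (simp add: commat_def matrix_vector_mult_def if_distrib[of "\<lambda>x. x * _"] transpose_nth cong: if_cong)
  then show ?thesis by (simp add: vec_eq_iff del: vecm_nth)
qed

lemma outerv_mult: "outerv x y *v w = (y \<bullet> w) *\<^sub>R x"
  by (simp add: vec_eq_iff outerv_def matrix_vector_mult_def inner_vec_def sum_distrib_left mult_ac)

text \<open>Through \<open>vecm\<close> the four parts of Psi_g send B' to J B', J B' J, J B'' J
  with B'' the transpose of B', and (J \<bullet> B') J. Conjugation by P preserves inner products
  and replaces J by the diagonal matrix D.\<close>

lemma Psig_quadratic_form:
  fixes P B B' :: "real^'n^'n"
  assumes P: "orthogonal_matrix P"
    and H: "H = transpose P ** B ** P" "H' = transpose P ** B' ** P" and D: "D = group_diag grp g"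
  shows "vecm B \<bullet> (Psig nu grp P g *v vecm B')
    = psig nu grp g * (H \<bullet> (D ** H')) + (phig nu grp g - psig nu grp g) * (H \<bullet> (D ** H' ** D))
     + (phig nu grp g - 1) * (H \<bullet> (D ** transpose H' ** D) + (D \<bullet> H') * (H \<bullet> D))"
proof -
  define J where "J = Jg P grp g"
  have J: "J = P ** D ** transpose P" unfolding J_def D by (rule Jg_eq)
  have Js: "transpose J = J" unfolding J D group_diag_def by (simp add: matrix_transpose_mul matrix_mul_assoc)
  have P': "orthogonal_matrix (transpose P)" using P by (simp add: orthogonal_matrix_transpose)
  note PP = orthogonal_matrixD[OF P]
  have conj: "X \<bullet> Y = (transpose P ** X ** P) \<bullet> (transpose P ** Y ** P)" for X Y :: "real^'n^'n"
    by (rule inner_conj_orthogonal[OF P' P, symmetric])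
  have c1: "transpose P ** (J ** B') ** P = D ** H'"
  proof -
    have "transpose P ** (J ** B') ** P = (transpose P ** P) ** D ** (transpose P ** B' ** P)"
      unfolding J by (simp only: matrix_mul_assoc)
    then show ?thesis by (simp add: PP H)
  qed
  have c2: "transpose P ** (J ** X ** J) ** P = D ** (transpose P ** X ** P) ** D" for X
  proof -
    have "transpose P ** (J ** X ** J) ** P = (transpose P ** P) ** D ** (transpose P ** X ** P) ** D ** (transpose P ** P)"
      unfolding J by (simp only: matrix_mul_assoc)
    then show ?thesis by (simp add: PP)
  qed
  have c3: "transpose P ** J ** P = D"
  proof -
    have "transpose P ** J ** P = (transpose P ** P) ** D ** (transpose P ** P)"
      unfolding J by (simp only: matrix_mul_assoc)
    then show ?thesis by (simp add: PP)
  qed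
  have t: "transpose P ** transpose B' ** P = transpose H'"
    unfolding H by (simp add: matrix_transpose_mul matrix_mul_assoc)
  have "Psig nu grp P g *v vecm B' = psig nu grp g *\<^sub>R vecm (J ** B') + (phig nu grp g - psig nu grp g) *\<^sub>R vecm (J ** B' ** J)
      + (phig nu grp g - 1) *\<^sub>R (vecm (J ** transpose B' ** J) + (J \<bullet> B') *\<^sub>R vecm J)"
    unfolding Psig_def Let_def J_def[symmetric] matrix_vector_mult_add_rdistrib scaleR_matrix_vector_assoc[symmetric]
      outerv_mult matrix_vector_mul_assoc[symmetric] commat_mult_vecm kron_mult_vecm inner_vecm Js
    by (simp add: transpose_mat)
  then have "vecm B \<bullet> (Psig nu grp P g *v vecm B') = psig nu grp g * (B \<bullet> (J ** B')) + (phig nu grp g - psig nu grp g) * (B \<bullet> (J ** B' ** J))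
      + (phig nu grp g - 1) * (B \<bullet> (J ** transpose B' ** J) + (J \<bullet> B') * (B \<bullet> J))"
    by (simp only: inner_add_right inner_scaleR_right inner_vecm)
  also have "B \<bullet> (J ** B') = H \<bullet> (D ** H')" by (subst conj) (simp only: c1 H[symmetric])
  also have "B \<bullet> (J ** B' ** J) = H \<bullet> (D ** H' ** D)" by (subst conj) (simp only: c2 H[symmetric])
  also have "B \<bullet> (J ** transpose B' ** J) = H \<bullet> (D ** transpose H' ** D)" by (subst conj) (simp only: c2 t H[symmetric])
  also have "J \<bullet> B' = D \<bullet> H'" by (subst conj) (simp only: c3 H[symmetric])
  also have "B \<bullet> J = H \<bullet> D" by (subst conj) (simp only: c3 H[symmetric])
  finally show ?thesis .
qed

text \<open>Identifies \<open>score_cov\<close> as the coefficient tensor of the bilinear form K_n +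
  Upsilon_G in the basis of the columns of P. The moments of V have the same tensor, so no further
  matching of the two sides is needed.\<close>

lemma info_quadratic_form:
  fixes P B B' :: "real^'n^'n"
  assumes P: "orthogonal_matrix P" and grp: "range grp = {1..G}"
    and H: "H = transpose P ** B ** P" "H' = transpose P ** B' ** P"
  shows "vecm B \<bullet> ((commat + UpsilonG nu grp G P) *v vecm B')
    = (\<Sum>i\<in>UNIV. \<Sum>j\<in>UNIV. \<Sum>k\<in>UNIV. \<Sum>l\<in>UNIV. H $ i $ j * H' $ k $ l *
        score_cov nu grp i j k l)"
proof -
  define ps where "ps = psig nu grp"
  define ph where "ph = phig nu grp"
  define D where "D = group_diag grp"
  let ?e = "\<lambda>i j k l. of_bool (i = l \<and> j = k) + of_bool (i = k \<and> j = l) * (ps (grp i) + of_bool (grp i = grp j) * (ph (grp i) - ps (grp i)))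
     + (ph (grp i) - 1) * (of_bool (grp i = grp j) * of_bool (i = l \<and> j = k) + of_bool (grp i = grp k) * of_bool (i = j \<and> k = l))"
  let ?h = "\<lambda>g i. (\<Sum>j\<in>UNIV. ps g * (H $ i $ j * H' $ i $ j)
         + (ph g - ps g) * (of_bool (grp j = g) * (H $ i $ j * H' $ i $ j)) + (ph g - 1) * (of_bool (grp j = g) * (H $ i $ j * H' $ j $ i)))
         + (\<Sum>k\<in>UNIV. (ph g - 1) * (of_bool (grp k = g) * (H $ i $ i * H' $ k $ k)))"
  \<comment> \<open>r collects the terms in which (k, l) is (i, j) or (j, i), so that no sum over k
    and l remains.\<close>
  define r where "r = (\<lambda>i j. H $ i $ j * H' $ j $ i + (ps (grp i) + of_bool (grp i = grp j) * (ph (grp i) - ps (grp i))) * (H $ i $ j * H' $ i $ j)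
      + (ph (grp i) - 1) * of_bool (grp i = grp j) * (H $ i $ j * H' $ j $ i))"
  \<comment> \<open>t collects the terms from vec(J_g) vec(J_g)', which couple diagonal entries i
    and k of one group.\<close>
  define t where "t = (\<lambda>i k. (ph (grp i) - 1) * of_bool (grp i = grp k) * (H $ i $ i * H' $ k $ k))"
  have P': "orthogonal_matrix (transpose P)" using P by (simp add: orthogonal_matrix_transpose)
  have "vecm B \<bullet> ((commat + UpsilonG nu grp G P) *v vecm B') = B \<bullet> transpose B' + (\<Sum>g\<in>{1..G}. vecm B \<bullet> (Psig nu grp P g *v vecm B'))"
  proof -
    have "(\<Sum>g\<in>A. Psig nu grp P g) *v vecm B' = (\<Sum>g\<in>A. Psig nu grp P g *v vecm B')" for A
      by (induction A rule: infinite_finite_induct) (auto simp: matrix_vector_mult_add_rdistrib)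
    then show ?thesis
      unfolding matrix_vector_mult_add_rdistrib commat_mult_vecm UpsilonG_def inner_add_right inner_vecm
      by (simp only: inner_sum_right)
  qed
  also have "B \<bullet> transpose B' = H \<bullet> transpose H'"
  proof -
    have "transpose H' = transpose P ** transpose B' ** P" unfolding H by (simp add: matrix_transpose_mul matrix_mul_assoc)
    then show ?thesis unfolding H(1) using inner_conj_orthogonal[OF P' P, of B "transpose B'"] by simp
  qed
  also have "\<dots> = (\<Sum>i\<in>UNIV. \<Sum>j\<in>UNIV. H $ i $ j * H' $ j $ i)"
    by (simp add: inner_mat transpose_nth)
  also have "(\<Sum>g\<in>{1..G}. vecm B \<bullet> (Psig nu grp P g *v vecm B'))
     = (\<Sum>g\<in>{1..G}. \<Sum>i\<in>UNIV. of_bool (grp i = g) * ?h g i)"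
  proof (rule sum.cong[OF refl], goal_cases)
    case (1 g)
    have Dl: "(D g ** X) $ i $ j = of_bool (grp i = g) * X $ i $ j" for X :: "real^'n^'n" and i j
      by (simp add: D_def group_diag_def diagm_mult_nth)
    have Dr: "(X ** D g) $ i $ j = X $ i $ j * of_bool (grp j = g)" for X :: "real^'n^'n" and i j
      by (simp add: D_def group_diag_def mult_diagm_nth)
    have 1: "H \<bullet> (D g ** H') = (\<Sum>i\<in>UNIV. of_bool (grp i = g) * (\<Sum>j\<in>UNIV. H $ i $ j * H' $ i $ j))"
      unfolding inner_mat Dl by (simp add: sum_distrib_left mult_ac)
    have 2: "H \<bullet> (D g ** X ** D g) = (\<Sum>i\<in>UNIV. of_bool (grp i = g) * (\<Sum>j\<in>UNIV. of_bool (grp j = g) * (H $ i $ j * X $ i $ j)))" for X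
      unfolding inner_mat Dr Dl by (simp add: sum_distrib_left mult_ac)
    have dg: "D g $ i $ j = (if i = j then of_bool (grp i = g) else 0)" for i j by (simp add: D_def group_diag_def)
    have 3: "D g \<bullet> H' = (\<Sum>k\<in>UNIV. of_bool (grp k = g) * H' $ k $ k)"
      unfolding inner_mat dg by (simp add: if_distrib[of "\<lambda>x. x * _"] cong: if_cong)
    have 4: "H \<bullet> D g = (\<Sum>i\<in>UNIV. of_bool (grp i = g) * H $ i $ i)"
      unfolding inner_mat dg by (simp add: if_distrib[of "\<lambda>x. _ * x"] mult.commute cong: if_cong)
    have 5: "(D g \<bullet> H') * (H \<bullet> D g) = (\<Sum>i\<in>UNIV. of_bool (grp i = g) * (\<Sum>k\<in>UNIV. of_bool (grp k = g) * (H $ i $ i * H' $ k $ k)))"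
    proof -
      have g: "(e * y) * (\<Sum>k\<in>UNIV. w k * x k) = e * (\<Sum>k\<in>UNIV. w k * (y * x k))" for e y :: real and w x :: "'n \<Rightarrow> real"
        by (simp add: sum_distrib_left mult_ac)
      have "(D g \<bullet> H') * (H \<bullet> D g) = (H \<bullet> D g) * (D g \<bullet> H')" by (rule mult.commute)
      then show ?thesis unfolding 3 4 sum_distrib_right g .
    qed
    have "vecm B \<bullet> (Psig nu grp P g *v vecm B')
      = ps g * (H \<bullet> (D g ** H')) + (ph g - ps g) * (H \<bullet> (D g ** H' ** D g))
       + (ph g - 1) * (H \<bullet> (D g ** transpose H' ** D g) + (D g \<bullet> H') * (H \<bullet> D g))"
      unfolding ps_def ph_def D_def by (rule Psig_quadratic_form[OF P H refl])
    also have "\<dots> = (\<Sum>i\<in>UNIV. of_bool (grp i = g) * ?h g i)"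
      unfolding 1 2 5 transpose_nth sum.distrib distrib_left sum_distrib_left by (simp add: mult_ac)
    finally show ?case .
  qed
  \<comment> \<open>Each coordinate belongs to exactly one group, so the sum over g only selects g =
    \<open>grp i\<close>.\<close>
  also have "\<dots> = (\<Sum>i\<in>UNIV. ?h (grp i) i)"
    by (subst sum.swap, subst mult.commute, subst sum_groups_of_bool[OF grp]) (rule refl)
  also have "(\<Sum>i\<in>UNIV. \<Sum>j\<in>UNIV. H $ i $ j * H' $ j $ i) + \<dots> = (\<Sum>i\<in>UNIV. (\<Sum>j\<in>UNIV. r i j) + (\<Sum>k\<in>UNIV. t i k))"
  proof (subst sum.distrib[symmetric], rule sum.cong[OF refl], goal_cases)
    case (1 i)
    show ?case
      unfolding add.assoc[symmetric] sum.distrib[symmetric]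
      by (rule sum.cong[OF refl]) (simp add: r_def t_def eq_commute[of "grp i"] algebra_simps)
  qed
  also have "\<dots> = (\<Sum>i\<in>UNIV. \<Sum>j\<in>UNIV. \<Sum>k\<in>UNIV. \<Sum>l\<in>UNIV. H $ i $ j * H' $ k $ l *
        ?e i j k l)"
  proof (rule sum.cong[OF refl], goal_cases)
    case (1 i)
    \<comment> \<open>The t-sum depends on i alone and is attached to j = i by
      \<open>of_bool (i = j)\<close>, so the later sum over j counts it once.\<close>
    have e: "(\<Sum>k\<in>UNIV. \<Sum>l\<in>UNIV. H $ i $ j * H' $ k $ l *
        ?e i j k l)
       = r i j + of_bool (i = j) * (\<Sum>k\<in>UNIV. t i k)" for j
    proof -
      define p where "p = ps (grp i) + of_bool (grp i = grp j) * (ph (grp i) - ps (grp i))"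
      define c where "c = (ph (grp i) - 1) * of_bool (grp i = grp j)"
      let ?d = "\<lambda>k l. (of_bool (i = j) * ((ph (grp i) - 1) * of_bool (grp i = grp k) * (H $ i $ i * H' $ k $ l))) * of_bool (k = l)"
      have "(\<Sum>k\<in>UNIV. \<Sum>l\<in>UNIV. H $ i $ j * H' $ k $ l *
        ?e i j k l)
        = (\<Sum>k\<in>UNIV. \<Sum>l\<in>UNIV. (H $ i $ j * H' $ k $ l * (1 + c)) * of_bool (i = l \<and> j = k) + (H $ i $ j * H' $ k $ l * p) * of_bool (i = k \<and> j = l)
            + ?d k l)"
        by (intro sum.cong refl) (auto simp: p_def c_def algebra_simps)
      also have "\<dots> = H $ i $ j * H' $ j $ i * (1 + c) + H $ i $ j * H' $ i $ j * p
           + (\<Sum>k\<in>UNIV. \<Sum>l\<in>UNIV. ?d k l)"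
        unfolding sum.distrib sum_delta_pair ..
      also have "(\<Sum>k\<in>UNIV. \<Sum>l\<in>UNIV. ?d k l)
          = of_bool (i = j) * (\<Sum>k\<in>UNIV. t i k)"
        by (simp add: of_bool_def[of "_ = _"] t_def sum_distrib_left if_distrib[of "\<lambda>x. _ * x"] cong: if_cong)
      also have "H $ i $ j * H' $ j $ i * (1 + c) + H $ i $ j * H' $ i $ j * p = r i j"
        by (simp add: r_def p_def c_def algebra_simps)
      finally show ?thesis .
    qed
    show ?case
      unfolding e sum.distrib by (simp add: of_bool_def[of "i = _"] if_distrib[of "\<lambda>x. x * _"] cong: if_cong)
  qed
  finally show ?thesis unfolding score_cov_def ps_def ph_def .
qed

text \<open>At z = C^{1/2} P v the score is a linear combination of the centered variables W v_i v_j
  - delta_ij, with coefficients the matrix of Omega M e_k in the basis P. Its covariances then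
  follow from those of these variables.\<close>

lemma score_at_image:
  fixes P C :: "((real, 'n::{finite,linorder}) vec, 'n) vec" and grp :: "'n \<Rightarrow> nat"
  assumes C: "pos_def_mat C" and P: "orthogonal_matrix P" and grp: "range grp = {1..G}"
    and S: "matrix_inv (msqrt C) ** msqrt C = mat 1"
    and B: "OmegaM C *v (Mmat C *v axis k 1) = vecm B" and H: "H = transpose P ** B ** P"
  shows "score nu grp G C P ((msqrt C ** P) *v v) $ k
    = (\<Sum>i\<in>UNIV. \<Sum>j\<in>UNIV. H $ i $ j * (Wg nu grp v (grp i) * (v $ i * v $ j) - of_bool (i = j)))"
proof -
  have "P *v v = (matrix_inv (msqrt C) ** msqrt C ** P) *v v" unfolding S by simp
  then have u: "P *v v = matrix_inv (msqrt C) *v ((msqrt C ** P) *v v)"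
    by (simp only: matrix_vector_mul_assoc matrix_mul_assoc)
  have v: "v = transpose P *v (P *v v)" using P by (simp add: matrix_vector_mul_assoc orthogonal_matrixD)
  have "trace B = trace H"
  proof -
    have "trace H = trace (P ** (transpose P ** B))" unfolding H by (rule trace_mul_sym)
    then show ?thesis using P by (simp add: orthogonal_matrixD)
  qed
  moreover have "transpose P *v (B *v (P *v v)) = H *v v"
    unfolding H by (simp only: matrix_vector_mul_assoc matrix_mul_assoc)
  ultimately have "score nu grp G C P ((msqrt C ** P) *v v) $ k
     = (\<Sum>g\<in>{1..G}. Wg nu grp v g * (\<Sum>j | grp j = g. v $ j * (H *v v) $ j)) - trace H"
    using score_eq[OF C u v B, of nu grp G] by simp
  also have "(\<Sum>g\<in>{1..G}. Wg nu grp v g * (\<Sum>j | grp j = g. v $ j * (H *v v) $ j))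
     = (\<Sum>i\<in>UNIV. Wg nu grp v (grp i) * (v $ i * (H *v v) $ i))"
    unfolding sum_distrib_left by (rule sum_groups[OF grp])
  also have "\<dots> = (\<Sum>i\<in>UNIV. \<Sum>j\<in>UNIV. H $ i $ j * (Wg nu grp v (grp i) * (v $ i * v $ j)))"
    by (simp add: matrix_vector_mult_def sum_distrib_left mult_ac)
  also have "trace H = (\<Sum>i\<in>UNIV. \<Sum>j\<in>UNIV. H $ i $ j * of_bool (i = j))"
    by (simp add: trace_def of_bool_def if_distrib[of "\<lambda>x. _ * x"] cong: if_cong)
  finally show ?thesis by (simp add: right_diff_distrib sum_subtractf)
qed

text \<open>The moment side and the matrix side are both quadruple sums over the same coefficients
  H_k and H_l with kernel \<open>score_cov\<close>. What remains is the passage from v to z.\<close>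

lemma information_matrix:
  fixes P C :: "((real, 'n::{finite,linorder}) vec, 'n) vec" and grp :: "'n \<Rightarrow> nat"
  assumes grp: "range grp = {1..G}" and nu: "\<forall>g\<in>{1..G}. nu g > 2"
    and P: "orthogonal_matrix P" and C: "pos_def_mat C"
  shows "has_bochner_integral lborel
    (\<lambda>z. ct_density nu grp G C P z * (score nu grp G C P z $ k * score nu grp G C P z $ l)) (infomat nu grp G C P $ k $ l)"
    (is "has_bochner_integral lborel ?f _")
proof -
  obtain L where L: "transpose L = L" and CL: "C = mexp L" using pos_def_mat_imp_mexp[OF C] .
  have hs: "transpose ((1/2) *\<^sub>R L) = (1/2) *\<^sub>R L" using L by (simp add: transpose_scaleR)
  define S where "S = msqrt C"
  have Se: "S = mexp ((1/2) *\<^sub>R L)" unfolding S_def CL by (rule msqrt_mexp[OF L])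
  have SS: "matrix_inv S ** S = mat 1" "S ** matrix_inv S = mat 1" unfolding Se using mexp_uminus[OF hs] by simp_all
  define A where "A = S ** P"
  define R where "R = transpose P ** matrix_inv S"
  have AR: "A ** R = mat 1"
  proof -
    have "A ** R = S ** (P ** transpose P) ** matrix_inv S" unfolding A_def R_def by (simp only: matrix_mul_assoc)
    then show ?thesis using P SS by (simp add: orthogonal_matrixD)
  qed
  have RA: "R ** A = mat 1" using AR matrix_left_right_inverse by blast
  have invA: "matrix_inv A = R" by (rule matrix_inv_eqI[OF AR])
  have detA: "det A \<noteq> 0" using AR det_mul[of A R] by auto
  define b where "b = (\<lambda>k. OmegaM C *v (Mmat C *v axis k 1))"
  define B where "B = (\<lambda>k. (\<chi> i j. b k $ (j, i)) :: ((real, 'n) vec, 'n) vec)"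
  have bB: "b k = vecm (B k)" for k by (simp add: B_def vec_eq_iff)
  define H where "H = (\<lambda>k. transpose P ** B k ** P)"
  define a where "a = (\<lambda>(v::(real, 'n) vec) i j. Wg nu grp v (grp i) * (v $ i * v $ j) - of_bool (i = j))"
  define sc where "sc = (\<lambda>k v. \<Sum>i\<in>UNIV. \<Sum>j\<in>UNIV. H k $ i $ j * a v i j)"
  have score: "score nu grp G C P (A *v v) $ k = sc k v" for k v
    unfolding sc_def a_def A_def S_def
    by (rule score_at_image[OF C P grp SS(1)[unfolded S_def] bB[unfolded b_def]]) (simp add: H_def)
  have dens: "ct_density nu grp G C P z = tdens nu grp G (R *v z) / \<bar>det A\<bar>" for z
    unfolding ct_density_def Let_def S_def[symmetric] A_def[symmetric] invA tdens_def ..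
  have ARz: "A *v (R *v z) = z" for z by (simp add: matrix_vector_mul_assoc AR)
  have RAv: "R *v (A *v v) = v" for v by (simp add: matrix_vector_mul_assoc RA)
  \<comment> \<open>Symmetry of Omega makes the entry (k, l) a bilinear form in b_k = Omega M e_k
    and b_l.\<close>
  have infok: "infomat nu grp G C P $ k $ l = b k \<bullet> ((commat + UpsilonG nu grp G P) *v b l)"
  proof -
    have "infomat nu grp G C P $ k $ l = axis k 1 \<bullet> (infomat nu grp G C P *v axis l 1)"
      by (simp add: inner_axis' matrix_vector_mul_component inner_axis)
    also have "infomat nu grp G C P *v axis l 1 = transpose (Mmat C) *v (OmegaM C *v ((commat + UpsilonG nu grp G P) *v b l))"
      unfolding infomat_def b_def by (simp only: matrix_vector_mul_assoc matrix_mul_assoc)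
    also have "axis k 1 \<bullet> \<dots> = b k \<bullet> ((commat + UpsilonG nu grp G P) *v b l)"
      unfolding b_def by (simp only: inner_matrix_vector transpose_transpose transpose_OmegaM[OF C])
    finally show ?thesis .
  qed
  have "has_bochner_integral lborel (\<lambda>v. \<Sum>i\<in>UNIV. \<Sum>j\<in>UNIV. \<Sum>k'\<in>UNIV. \<Sum>l'\<in>UNIV. H k $ i $ j * H l $ k' $ l' * (tdens nu grp G v * (a v i j * a v k' l')))
     (b k \<bullet> ((commat + UpsilonG nu grp G P) *v b l))"
    unfolding bB info_quadratic_form[OF P grp fun_cong[OF H_def] fun_cong[OF H_def]] a_def
    by (intro has_bochner_integral_sum has_bochner_integral_mult_right tdens_score_moment[OF grp nu])
  moreover have "(\<Sum>i\<in>UNIV. \<Sum>j\<in>UNIV. \<Sum>k'\<in>UNIV. \<Sum>l'\<in>UNIV. H k $ i $ j * H l $ k' $ l' * (tdens nu grp G v * (a v i j * a v k' l')))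
     = tdens nu grp G v * (sc k v * sc l v)" for v
  proof -
    have "d * ((\<Sum>i\<in>UNIV. \<Sum>j\<in>UNIV. p i j * x i j) * (\<Sum>k'\<in>UNIV. \<Sum>l'\<in>UNIV. q k' l' * x k' l'))
       = (\<Sum>i\<in>UNIV. \<Sum>j\<in>UNIV. \<Sum>k'\<in>UNIV. \<Sum>l'\<in>UNIV. p i j * q k' l' * (d * (x i j * x k' l')))"
      for d :: real and p q x :: "'n \<Rightarrow> 'n \<Rightarrow> real"
      unfolding sum_distrib_right unfolding sum_distrib_left by (simp only: mult_ac)
    then show ?thesis unfolding sc_def by (rule sym)
  qed
  ultimately have main: "has_bochner_integral lborel (\<lambda>v. tdens nu grp G v * (sc k v * sc l v)) (infomat nu grp G C P $ k $ l)"
    by (simp only: infok)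
  have lin: "linear ((*v) A)" by (rule matrix_vector_mul_linear)
  have mA: "matrix ((*v) A) = A" by (rule matrix_of_matrix_vector_mul)
  show ?thesis
  proof (rule has_bochner_integral_linear_image[OF lin])
    show "det (matrix ((*v) A)) \<noteq> 0" by (simp only: mA detA not_False_eq_True)
    show "has_bochner_integral lborel (\<lambda>x. \<bar>det (matrix ((*v) A))\<bar> * (ct_density nu grp G C P (A *v x) *
        (score nu grp G C P (A *v x) $ k * score nu grp G C P (A *v x) $ l))) (infomat nu grp G C P $ k $ l)"
      \<comment> \<open>The Jacobian |det A| cancels the denominator of \<open>ct_density\<close>,
        leaving the density of V.\<close>
      using main detA unfolding mA dens score RAv by simp
    have "?f
       = (\<lambda>z. tdens nu grp G (R *v z) / \<bar>det A\<bar> * (sc k (R *v z) * sc l (R *v z)))"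
      by (simp add: dens score[symmetric] ARz)
    moreover have [measurable]: "(\<lambda>z. R *v z) \<in> borel_measurable borel"
      by (intro borel_measurable_linear matrix_vector_mul_linear)
    have [measurable]: "sc k \<in> borel_measurable borel" for k
      unfolding sc_def a_def by measurable
    have "(\<lambda>z. tdens nu grp G (R *v z) / \<bar>det A\<bar> * (sc k (R *v z) * sc l (R *v z))) \<in> borel_measurable borel"
      by measurable
    ultimately show "?f \<in> borel_measurable borel"
      by simp
  qed
qed

theorem theorem2:
  fixes P C :: "((real, 'n::{finite,linorder}) vec, 'n) vec" and grp :: "'n \<Rightarrow> nat" and G :: nat
    and nu :: "nat \<Rightarrow> real"
  assumes "CARD('n) \<ge> 2" and "G \<ge> 1" and "range grp = {1..G}"
    and "\<forall>g\<in>{1..G}. nu g > 2"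
    and "orthogonal_matrix P" and "is_corr C"
  shows "(\<forall>z. \<forall>k\<in>lowidx.
            ((\<lambda>t. ln (ct_density nu grp G (corr_of (vecm (matlog C) + t *\<^sub>R axis k 1)) P z))
               has_real_derivative (score nu grp G C P z $ k)) (at 0))
       \<and> (\<forall>k\<in>lowidx. \<forall>l\<in>lowidx.
            integrable lborel (\<lambda>z. ct_density nu grp G C P z * (score nu grp G C P z $ k * score nu grp G C P z $ l))
          \<and> (\<integral>z. ct_density nu grp G C P z * (score nu grp G C P z $ k * score nu grp G C P z $ l) \<partial>lborel)
              = infomat nu grp G C P $ k $ l)"
proof (intro conjI allI ballI)
  fix z k assume "k \<in> (lowidx :: ('n \<times> 'n) set)"
  then show "((\<lambda>t. ln (ct_density nu grp G (corr_of (vecm (matlog C) + t *\<^sub>R axis k 1)) P z))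
               has_real_derivative (score nu grp G C P z $ k)) (at 0)"
    by (rule score_has_derivative[OF assms(4-6)])
next
  fix k l
  have C: "pos_def_mat C" using assms(6) by (simp add: is_corr_def)
  note info = information_matrix[OF assms(3-5) C, of k l]
  show "integrable lborel (\<lambda>z. ct_density nu grp G C P z * (score nu grp G C P z $ k * score nu grp G C P z $ l))"
    using info by (simp add: has_bochner_integral_iff)
  show "(\<integral>z. ct_density nu grp G C P z * (score nu grp G C P z $ k * score nu grp G C P z $ l) \<partial>lborel)
              = infomat nu grp G C P $ k $ l"
    using info by (simp add: has_bochner_integral_iff)
qed

end
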